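(* Let $\lambda$ be a regular cardinal and let $\mathcal{K}$ be a strongly $\lambda$-combinatorial model category which is $\lambda$-Brown on morphisms. Let $K$ be an object of $\mathcal{K}$ expressed as a $\lambda$-filtered colimit of a diagram $D:\mathcal{D}\to\mathcal{K}_\lambda$ with colimit cocone $(\delta_d:Dd\to K)_{d\in\mathcal{D}}$ in $\mathcal{K}$. Then $(P\delta_d:PDd\to PK)_{d\in\mathcal{D}}$ is a weak colimit cocone in $\mathrm{Ho}(\mathcal{K})$. Hence each object of $\mathrm{Ho}(\mathcal{K})$ is a weak $\lambda$-filtered colimit of objects from $\mathrm{Ho}(\mathcal{K}_\lambda)$. If, moreover, $E_\lambda$ reflects isomorphisms, then every morphism $f:PK\to PK$ with $f\circ P\delta_d=P\delta_d$ for each $d\in\mathcal{D}$ is an isomorphism, so that each object of $\mathrm{Ho}(\mathcal{K})$ is a minimal weak colimit of objects from $\mathrm{Ho}(\mathcal{K}_\lambda)$.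
   Context: Model categories are complete and cocomplete categories with a model structure in the sense of Hovey, so that both the (cofibration, trivial fibration) and the (trivial cofibration, fibration) factorizations are functorial. $\mathcal{K}^{\to}$ denotes the category of morphisms of $\mathcal{K}$. For a regular cardinal $\lambda$, a model category $\mathcal{K}$ is $\lambda$-combinatorial if $\mathcal{K}$ is locally $\lambda$-presentable and both cofibrations and trivial cofibrations are cofibrantly generated by sets of morphisms having $\lambda$-presentable domains and codomains. The factorization functors $\mathcal{K}^{\to}\to\mathcal{K}$ are then taken to be those given by the small object argument of length $\lambda$ applied to these generating sets; these functors preserve $\lambda$-filtered colimits. A $\lambda$-combinatorial model category is strongly $\lambda$-combinatorial if the functor $F:\mathcal{K}^{\to}\to\mathcal{K}$ giving the (cofibration, trivial fibration) factorization $A\to F(f)\to B$ of $f:A\to B$ preserves $\lambda$-presentable objects (that is, $F(f)$ is $\lambda$-presentable whenever $A$ and $B$ are). $P:\mathcal{K}\to\mathrm{Ho}(\mathcal{K})$ is the canonical functor to the homotopy category, $\mathcal{K}_\lambda$ is the (essentially small) full subcategory of $\lambda$-presentable objects of $\mathcal{K}$, and $\mathrm{Ho}(\mathcal{K}_\lambda)$ denotes the full subcategory of $\mathrm{Ho}(\mathcal{K})$ on the objects $PA$ with $A\in\mathcal{K}_\lambda$. The canonical functor $E_\lambda:\mathrm{Ho}(\mathcal{K})\to\mathbf{Set}^{\mathrm{Ho}(\mathcal{K}_\lambda)^{\mathrm{op}}}$ sends $X$ to the restriction of $\hom(-,X)$ to $\mathrm{Ho}(\mathcal{K}_\lambda)^{\mathrm{op}}$.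 For a small category $\mathcal{A}$, $\mathrm{Ind}_\lambda(\mathcal{A})$ is the free completion of $\mathcal{A}$ under $\lambda$-filtered colimits, identified with the full subcategory of $\mathbf{Set}^{\mathcal{A}^{\mathrm{op}}}$ consisting of $\lambda$-filtered colimits of representables. For $\mathcal{K}$ strongly $\lambda$-combinatorial, $E_\lambda$ takes values in $\mathrm{Ind}_\lambda\mathrm{Ho}(\mathcal{K}_\lambda)$. $\mathcal{K}$ is called $\lambda$-Brown on morphisms if $E_\lambda:\mathrm{Ho}(\mathcal{K})\to\mathrm{Ind}_\lambda\mathrm{Ho}(\mathcal{K}_\lambda)$ is full. A weak colimit of a diagram is a cocone through which every other cocone from the diagram factorizes, not necessarily uniquely. A weak colimit cocone $(\varphi_d:D'd\to X)_d$ is called minimal if every endomorphism $f:X\to X$ with $f\varphi_d=\varphi_d$ for all $d$ is an isomorphism. *)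

theory Defs
  imports Main "HOL-Library.FuncSet"
begin

unbundle cardinal_syntax

section \<open>Size conventions\<close>

text \<open>
  The distinction between sets and classes is made relative to a universe, given as a strongly
  inaccessible cardinal \<open>U :: 'u rel\<close>: a set is small if its cardinality is less than \<open>U\<close>.
  A small category is, up to isomorphism, one whose objects and arrows are elements of \<open>'u\<close>, so
  that quantification over small categories is quantification over the type \<open>('u, 'u) cat\<close>.
\<close>

definition regular_cardinal :: "'l rel \<Rightarrow> bool" where
  "regular_cardinal lam \<longleftrightarrow> Card_order lam \<and> cinfinite lam \<and> regularCard lam"

definition inaccessible :: "'u rel \<Rightarrow> bool" where
  "inaccessible U \<longleftrightarrow> regular_cardinal U \<and> natLeq <o U \<and>
     (\<forall>A :: 'u set. |A| <o U \<longrightarrow> |Pow A| <o U)"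

definition small :: "'u rel \<Rightarrow> 'a set \<Rightarrow> bool" where
  "small U A \<longleftrightarrow> |A| <o U"


section \<open>Categories, functors, natural transformations\<close>

record ('o, 'm) cat =
  Ob :: "'o set"
  Ar :: "'m set"
  dm :: "'m \<Rightarrow> 'o"
  cd :: "'m \<Rightarrow> 'o"
  idt :: "'o \<Rightarrow> 'm"
  cmp :: "'m \<Rightarrow> 'm \<Rightarrow> 'm"

abbreviation comp_in :: "'m \<Rightarrow> ('o, 'm) cat \<Rightarrow> 'm \<Rightarrow> 'm" (\<open>(_ \<cdot>\<^bsub>_\<^esub> _)\<close> [66, 0, 65] 65) where
  "g \<cdot>\<^bsub>C\<^esub> f \<equiv> cmp C g f"

definition Hom :: "('o, 'm) cat \<Rightarrow> 'o \<Rightarrow> 'o \<Rightarrow> 'm set" where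
  "Hom C x y = {f \<in> Ar C. dm C f = x \<and> cd C f = y}"

definition category :: "('o, 'm) cat \<Rightarrow> bool" where
  "category C \<longleftrightarrow>
     (\<forall>f \<in> Ar C. dm C f \<in> Ob C \<and> cd C f \<in> Ob C) \<and>
     (\<forall>x \<in> Ob C. idt C x \<in> Hom C x x) \<and>
     (\<forall>f \<in> Ar C. \<forall>g \<in> Ar C. dm C g = cd C f \<longrightarrow> g \<cdot>\<^bsub>C\<^esub> f \<in> Hom C (dm C f) (cd C g)) \<and>
     (\<forall>f \<in> Ar C. f \<cdot>\<^bsub>C\<^esub> idt C (dm C f) = f \<and> idt C (cd C f) \<cdot>\<^bsub>C\<^esub> f = f) \<and>
     (\<forall>f \<in> Ar C. \<forall>g \<in> Ar C. \<forall>h \<in> Ar C. dm C g = cd C f \<longrightarrow> dm C h = cd C g \<longrightarrow>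
        h \<cdot>\<^bsub>C\<^esub> (g \<cdot>\<^bsub>C\<^esub> f) = (h \<cdot>\<^bsub>C\<^esub> g) \<cdot>\<^bsub>C\<^esub> f)"

definition is_iso :: "('o, 'm) cat \<Rightarrow> 'm \<Rightarrow> bool" where
  "is_iso C f \<longleftrightarrow> f \<in> Ar C \<and>
     (\<exists>g \<in> Hom C (cd C f) (dm C f). g \<cdot>\<^bsub>C\<^esub> f = idt C (dm C f) \<and> f \<cdot>\<^bsub>C\<^esub> g = idt C (cd C f))"

definition retract_of :: "('o, 'm) cat \<Rightarrow> 'o \<Rightarrow> 'o \<Rightarrow> bool" where
  "retract_of C x y \<longleftrightarrow> x \<in> Ob C \<and> y \<in> Ob C \<and>
     (\<exists>s \<in> Hom C x y. \<exists>r \<in> Hom C y x. r \<cdot>\<^bsub>C\<^esub> s = idt C x)"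

definition op_cat :: "('o, 'm) cat \<Rightarrow> ('o, 'm) cat" where
  "op_cat C = \<lparr>Ob = Ob C, Ar = Ar C, dm = cd C, cd = dm C, idt = idt C, cmp = (\<lambda>g f. f \<cdot>\<^bsub>C\<^esub> g)\<rparr>"

definition full_subcat :: "('o, 'm) cat \<Rightarrow> 'o set \<Rightarrow> ('o, 'm) cat" where
  "full_subcat C S = C\<lparr>Ob := Ob C \<inter> S, Ar := {f \<in> Ar C. dm C f \<in> S \<and> cd C f \<in> S}\<rparr>"

definition locally_small :: "'u rel \<Rightarrow> ('o, 'm) cat \<Rightarrow> bool" where
  "locally_small U C \<longleftrightarrow> (\<forall>x \<in> Ob C. \<forall>y \<in> Ob C. small U (Hom C x y))"

definition small_category :: "'u rel \<Rightarrow> ('o, 'm) cat \<Rightarrow> bool" where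
  "small_category U C \<longleftrightarrow> category C \<and> small U (Ob C) \<and> small U (Ar C)"

record ('o, 'm, 'p, 'n) functr =
  FO :: "'o \<Rightarrow> 'p"
  FA :: "'m \<Rightarrow> 'n"

definition is_functor ::
  "('o, 'm) cat \<Rightarrow> ('p, 'n) cat \<Rightarrow> ('o, 'm, 'p, 'n) functr \<Rightarrow> bool" where
  "is_functor C D F \<longleftrightarrow> category C \<and> category D \<and>
     (\<forall>x \<in> Ob C. FO F x \<in> Ob D \<and> FA F (idt C x) = idt D (FO F x)) \<and>
     (\<forall>f \<in> Ar C. FA F f \<in> Hom D (FO F (dm C f)) (FO F (cd C f))) \<and>
     (\<forall>f \<in> Ar C. \<forall>g \<in> Ar C. dm C g = cd C f \<longrightarrow> FA F (g \<cdot>\<^bsub>C\<^esub> f) = FA F g \<cdot>\<^bsub>D\<^esub> FA F f)"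

definition functr_comp ::
  "('p, 'n, 'q, 'k) functr \<Rightarrow> ('o, 'm, 'p, 'n) functr \<Rightarrow> ('o, 'm, 'q, 'k) functr" where
  "functr_comp G F = \<lparr>FO = FO G \<circ> FO F, FA = FA G \<circ> FA F\<rparr>"

definition natural ::
  "('o, 'm) cat \<Rightarrow> ('p, 'n) cat \<Rightarrow> ('o, 'm, 'p, 'n) functr \<Rightarrow> ('o, 'm, 'p, 'n) functr \<Rightarrow>
     ('o \<Rightarrow> 'n) \<Rightarrow> bool" where
  "natural C D F G \<eta> \<longleftrightarrow> is_functor C D F \<and> is_functor C D G \<and>
     (\<forall>x \<in> Ob C. \<eta> x \<in> Hom D (FO F x) (FO G x)) \<and>
     (\<forall>f \<in> Ar C. \<eta> (cd C f) \<cdot>\<^bsub>D\<^esub> FA F f = FA G f \<cdot>\<^bsub>D\<^esub> \<eta> (dm C f))"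

definition full_functor ::
  "('o, 'm) cat \<Rightarrow> ('p, 'n) cat \<Rightarrow> ('o, 'm, 'p, 'n) functr \<Rightarrow> bool" where
  "full_functor C D F \<longleftrightarrow>
     (\<forall>x \<in> Ob C. \<forall>y \<in> Ob C. \<forall>g \<in> Hom D (FO F x) (FO F y). \<exists>f \<in> Hom C x y. FA F f = g)"

definition reflects_isos ::
  "('o, 'm) cat \<Rightarrow> ('p, 'n) cat \<Rightarrow> ('o, 'm, 'p, 'n) functr \<Rightarrow> bool" where
  "reflects_isos C D F \<longleftrightarrow> (\<forall>f \<in> Ar C. is_iso D (FA F f) \<longrightarrow> is_iso C f)"

text \<open>The objects of the category of morphisms of \<open>C\<close> are the arrows of \<open>C\<close>; an arrow
  \<open>(f, u, v, g)\<close> is the commutative square \<open>g u = v f\<close>.\<close>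

definition arrow_cat :: "('o, 'm) cat \<Rightarrow> ('m, 'm \<times> 'm \<times> 'm \<times> 'm) cat" where
  "arrow_cat C =
     \<lparr>Ob = Ar C,
      Ar = {(f, u, v, g). f \<in> Ar C \<and> g \<in> Ar C \<and> u \<in> Hom C (dm C f) (dm C g) \<and>
              v \<in> Hom C (cd C f) (cd C g) \<and> g \<cdot>\<^bsub>C\<^esub> u = v \<cdot>\<^bsub>C\<^esub> f},
      dm = (\<lambda>(f, u, v, g). f),
      cd = (\<lambda>(f, u, v, g). g),
      idt = (\<lambda>f. (f, idt C (dm C f), idt C (cd C f), f)),
      cmp = (\<lambda>(f', u', v', g') (f, u, v, g). (f, u' \<cdot>\<^bsub>C\<^esub> u, v' \<cdot>\<^bsub>C\<^esub> v, g'))\<rparr>"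

definition dom_functor :: "('o, 'm) cat \<Rightarrow> ('m, 'm \<times> 'm \<times> 'm \<times> 'm, 'o, 'm) functr" where
  "dom_functor C = \<lparr>FO = dm C, FA = (\<lambda>(f, u, v, g). u)\<rparr>"

definition cod_functor :: "('o, 'm) cat \<Rightarrow> ('m, 'm \<times> 'm \<times> 'm \<times> 'm, 'o, 'm) functr" where
  "cod_functor C = \<lparr>FO = cd C, FA = (\<lambda>(f, u, v, g). v)\<rparr>"

definition poset_cat :: "'a rel \<Rightarrow> 'a set \<Rightarrow> ('a, 'a \<times> 'a) cat" where
  "poset_cat r A =
     \<lparr>Ob = A, Ar = {(a, b). (a, b) \<in> r \<and> a \<in> A \<and> b \<in> A}, dm = fst, cd = snd,
      idt = (\<lambda>a. (a, a)), cmp = (\<lambda>g f. (fst f, snd g))\<rparr>"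

definition discrete_cat :: "'a set \<Rightarrow> ('a, 'a) cat" where
  "discrete_cat S = \<lparr>Ob = S, Ar = S, dm = id, cd = id, idt = id, cmp = (\<lambda>g f. f)\<rparr>"


section \<open>Colimits and weak colimits\<close>

definition is_cocone ::
  "('o, 'm) cat \<Rightarrow> ('i, 'j) cat \<Rightarrow> ('i, 'j, 'o, 'm) functr \<Rightarrow> 'o \<Rightarrow> ('i \<Rightarrow> 'm) \<Rightarrow> bool" where
  "is_cocone C J D X \<delta> \<longleftrightarrow> X \<in> Ob C \<and> (\<forall>d \<in> Ob J. \<delta> d \<in> Hom C (FO D d) X) \<and>
     (\<forall>m \<in> Ar J. \<delta> (cd J m) \<cdot>\<^bsub>C\<^esub> FA D m = \<delta> (dm J m))"

definition is_colimit ::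
  "('o, 'm) cat \<Rightarrow> ('i, 'j) cat \<Rightarrow> ('i, 'j, 'o, 'm) functr \<Rightarrow> 'o \<Rightarrow> ('i \<Rightarrow> 'm) \<Rightarrow> bool" where
  "is_colimit C J D X \<delta> \<longleftrightarrow> is_cocone C J D X \<delta> \<and>
     (\<forall>Y \<epsilon>. is_cocone C J D Y \<epsilon> \<longrightarrow>
        (\<exists>!h. h \<in> Hom C X Y \<and> (\<forall>d \<in> Ob J. h \<cdot>\<^bsub>C\<^esub> \<delta> d = \<epsilon> d)))"

definition is_weak_colimit ::
  "('o, 'm) cat \<Rightarrow> ('i, 'j) cat \<Rightarrow> ('i, 'j, 'o, 'm) functr \<Rightarrow> 'o \<Rightarrow> ('i \<Rightarrow> 'm) \<Rightarrow> bool" where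
  "is_weak_colimit C J D X \<delta> \<longleftrightarrow> is_cocone C J D X \<delta> \<and>
     (\<forall>Y \<epsilon>. is_cocone C J D Y \<epsilon> \<longrightarrow>
        (\<exists>h. h \<in> Hom C X Y \<and> (\<forall>d \<in> Ob J. h \<cdot>\<^bsub>C\<^esub> \<delta> d = \<epsilon> d)))"

definition is_minimal_weak_colimit ::
  "('o, 'm) cat \<Rightarrow> ('i, 'j) cat \<Rightarrow> ('i, 'j, 'o, 'm) functr \<Rightarrow> 'o \<Rightarrow> ('i \<Rightarrow> 'm) \<Rightarrow> bool" where
  "is_minimal_weak_colimit C J D X \<delta> \<longleftrightarrow> is_weak_colimit C J D X \<delta> \<and>
     (\<forall>f \<in> Hom C X X. (\<forall>d \<in> Ob J. f \<cdot>\<^bsub>C\<^esub> \<delta> d = \<delta> d) \<longrightarrow> is_iso C f)"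

definition is_coproduct ::
  "('o, 'm) cat \<Rightarrow> 'a set \<Rightarrow> ('a \<Rightarrow> 'o) \<Rightarrow> 'o \<Rightarrow> ('a \<Rightarrow> 'm) \<Rightarrow> bool" where
  "is_coproduct C S X A \<iota> \<longleftrightarrow>
     is_colimit C (discrete_cat S) \<lparr>FO = X, FA = (\<lambda>s. idt C (X s))\<rparr> A \<iota>"

definition is_pushout :: "('o, 'm) cat \<Rightarrow> 'm \<Rightarrow> 'm \<Rightarrow> 'm \<Rightarrow> 'm \<Rightarrow> 'o \<Rightarrow> bool" where
  "is_pushout C t h k j P \<longleftrightarrow> t \<in> Ar C \<and> h \<in> Ar C \<and> dm C t = dm C h \<and> P \<in> Ob C \<and>
     k \<in> Hom C (cd C t) P \<and> j \<in> Hom C (cd C h) P \<and> k \<cdot>\<^bsub>C\<^esub> t = j \<cdot>\<^bsub>C\<^esub> h \<and>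
     (\<forall>Y \<in> Ob C. \<forall>a \<in> Hom C (cd C t) Y. \<forall>b \<in> Hom C (cd C h) Y. a \<cdot>\<^bsub>C\<^esub> t = b \<cdot>\<^bsub>C\<^esub> h \<longrightarrow>
        (\<exists>!m. m \<in> Hom C P Y \<and> m \<cdot>\<^bsub>C\<^esub> k = a \<and> m \<cdot>\<^bsub>C\<^esub> j = b))"

definition cocomplete :: "'u rel \<Rightarrow> ('o, 'm) cat \<Rightarrow> bool" where
  "cocomplete U C \<longleftrightarrow>
     (\<forall>(J :: ('u, 'u) cat) D. small_category U J \<longrightarrow> is_functor J C D \<longrightarrow> (\<exists>X \<delta>. is_colimit C J D X \<delta>))"

definition complete :: "'u rel \<Rightarrow> ('o, 'm) cat \<Rightarrow> bool" where
  "complete U C \<longleftrightarrow> cocomplete U (op_cat C)"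

text \<open>Every subgraph with fewer than \<open>lam\<close> vertices and edges has a cocone.\<close>

definition filtered :: "'l rel \<Rightarrow> ('o, 'm) cat \<Rightarrow> bool" where
  "filtered lam J \<longleftrightarrow> category J \<and>
     (\<forall>S M. S \<subseteq> Ob J \<longrightarrow> M \<subseteq> Ar J \<longrightarrow> |S| <o lam \<longrightarrow> |M| <o lam \<longrightarrow>
        dm J ` M \<subseteq> S \<longrightarrow> cd J ` M \<subseteq> S \<longrightarrow>
        (\<exists>c \<in> Ob J. \<exists>\<tau>. (\<forall>s \<in> S. \<tau> s \<in> Hom J s c) \<and>
            (\<forall>m \<in> M. \<tau> (cd J m) \<cdot>\<^bsub>J\<^esub> m = \<tau> (dm J m))))"


section \<open>Sets and presheaves\<close>

text \<open>Small sets with elements in \<open>'a\<close>; a map is recorded together with its domain and codomain.\<close>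

definition set_cat :: "'u rel \<Rightarrow> ('a set, 'a set \<times> ('a \<Rightarrow> 'a) \<times> 'a set) cat" where
  "set_cat U =
     \<lparr>Ob = {A. small U A},
      Ar = {(A, f, B). small U A \<and> small U B \<and> f \<in> A \<rightarrow>\<^sub>E B},
      dm = (\<lambda>(A, f, B). A),
      cd = (\<lambda>(A, f, B). B),
      idt = (\<lambda>A. (A, restrict id A, A)),
      cmp = (\<lambda>(B', g, C) (A, f, B). (A, compose A g f, C))\<rparr>"

definition hom_functor ::
  "('o, 'm) cat \<Rightarrow> 'o \<Rightarrow> ('o, 'm, 'm set, 'm set \<times> ('m \<Rightarrow> 'm) \<times> 'm set) functr" where
  "hom_functor C A =
     \<lparr>FO = (\<lambda>X. Hom C A X),
      FA = (\<lambda>f. (Hom C A (dm C f), restrict (\<lambda>h. f \<cdot>\<^bsub>C\<^esub> h) (Hom C A (dm C f)), Hom C A (cd C f)))\<rparr>"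

definition functor_cat :: "('o, 'm) cat \<Rightarrow> ('p, 'n) cat \<Rightarrow>
    (('o, 'm, 'p, 'n) functr,
     ('o, 'm, 'p, 'n) functr \<times> ('o \<Rightarrow> 'n) \<times> ('o, 'm, 'p, 'n) functr) cat" where
  "functor_cat C D =
     (let Fun = {F. is_functor C D F \<and> FO F \<in> extensional (Ob C) \<and> FA F \<in> extensional (Ar C)} in
     \<lparr>Ob = Fun,
      Ar = {(F, \<eta>, G). F \<in> Fun \<and> G \<in> Fun \<and> natural C D F G \<eta> \<and> \<eta> \<in> extensional (Ob C)},
      dm = (\<lambda>(F, \<eta>, G). F),
      cd = (\<lambda>(F, \<eta>, G). G),
      idt = (\<lambda>F. (F, restrict (\<lambda>x. idt D (FO F x)) (Ob C), F)),
      cmp = (\<lambda>(G', \<theta>, H) (F, \<eta>, G). (F, restrict (\<lambda>x. \<theta> x \<cdot>\<^bsub>D\<^esub> \<eta> x) (Ob C), H))\<rparr>)"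

type_synonym ('o, 'm) presheaf = "('o, 'm, 'm set, 'm set \<times> ('m \<Rightarrow> 'm) \<times> 'm set) functr"
type_synonym ('o, 'm) presheaf_map =
  "('o, 'm) presheaf \<times> ('o \<Rightarrow> 'm set \<times> ('m \<Rightarrow> 'm) \<times> 'm set) \<times> ('o, 'm) presheaf"

definition presheaf_cat ::
  "'u rel \<Rightarrow> ('o, 'm) cat \<Rightarrow> (('o, 'm) presheaf, ('o, 'm) presheaf_map) cat" where
  "presheaf_cat U A = functor_cat (op_cat A) (set_cat U)"

text \<open>The functor \<open>X \<mapsto> hom(-, X)\<close> from \<open>C\<close> to presheaves on a full subcategory \<open>A\<close> of \<open>C\<close>.\<close>

definition hom_presheaf :: "('o, 'm) cat \<Rightarrow> ('o, 'm) cat \<Rightarrow> 'o \<Rightarrow> ('o, 'm) presheaf" where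
  "hom_presheaf C A X =
     \<lparr>FO = restrict (\<lambda>a. Hom C a X) (Ob A),
      FA = restrict (\<lambda>f. (Hom C (cd C f) X, restrict (\<lambda>h. h \<cdot>\<^bsub>C\<^esub> f) (Hom C (cd C f) X),
                           Hom C (dm C f) X)) (Ar A)\<rparr>"

definition restricted_yoneda ::
  "('o, 'm) cat \<Rightarrow> ('o, 'm) cat \<Rightarrow> ('o, 'm, ('o, 'm) presheaf, ('o, 'm) presheaf_map) functr" where
  "restricted_yoneda C A =
     \<lparr>FO = hom_presheaf C A,
      FA = (\<lambda>f. (hom_presheaf C A (dm C f),
                 restrict (\<lambda>a. (Hom C a (dm C f), restrict (\<lambda>h. f \<cdot>\<^bsub>C\<^esub> h) (Hom C a (dm C f)),
                                Hom C a (cd C f))) (Ob A),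
                 hom_presheaf C A (cd C f)))\<rparr>"

definition Ind ::
  "'u rel \<Rightarrow> 'l rel \<Rightarrow> ('o, 'm) cat \<Rightarrow> (('o, 'm) presheaf, ('o, 'm) presheaf_map) cat" where
  "Ind U lam A = full_subcat (presheaf_cat U A)
     {G. \<exists>(J :: ('u, 'u) cat) D \<delta>. small_category U J \<and> filtered lam J \<and> is_functor J A D \<and>
           is_colimit (presheaf_cat U A) J (functr_comp (restricted_yoneda A A) D) G \<delta>}"


section \<open>Locally presentable categories\<close>

definition presentable :: "'u rel \<Rightarrow> 'l rel \<Rightarrow> ('o, 'm) cat \<Rightarrow> 'o \<Rightarrow> bool" where
  "presentable U lam C A \<longleftrightarrow> A \<in> Ob C \<and>
     (\<forall>(J :: ('u, 'u) cat) D X \<delta>.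
        small_category U J \<longrightarrow> filtered lam J \<longrightarrow> is_functor J C D \<longrightarrow> is_colimit C J D X \<delta> \<longrightarrow>
        is_colimit (set_cat U) J (functr_comp (hom_functor C A) D)
          (FO (hom_functor C A) X) (\<lambda>d. FA (hom_functor C A) (\<delta> d)))"

definition presentables :: "'u rel \<Rightarrow> 'l rel \<Rightarrow> ('o, 'm) cat \<Rightarrow> ('o, 'm) cat" where
  "presentables U lam C = full_subcat C {A. presentable U lam C A}"

definition locally_presentable :: "'u rel \<Rightarrow> 'l rel \<Rightarrow> ('o, 'm) cat \<Rightarrow> bool" where
  "locally_presentable U lam C \<longleftrightarrow> category C \<and> locally_small U C \<and> cocomplete U C \<and>
     (\<exists>G. small U G \<and> (\<forall>A \<in> G. presentable U lam C A) \<and>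
        (\<forall>X \<in> Ob C. \<exists>(J :: ('u, 'u) cat) D \<delta>. small_category U J \<and> filtered lam J \<and>
            is_functor J (full_subcat C G) D \<and> is_colimit C J D X \<delta>))"


section \<open>Model categories\<close>

definition has_lift :: "('o, 'm) cat \<Rightarrow> 'm \<Rightarrow> 'm \<Rightarrow> bool" where
  "has_lift C i p \<longleftrightarrow>
     (\<forall>u \<in> Hom C (dm C i) (dm C p). \<forall>v \<in> Hom C (cd C i) (cd C p). p \<cdot>\<^bsub>C\<^esub> u = v \<cdot>\<^bsub>C\<^esub> i \<longrightarrow>
        (\<exists>h \<in> Hom C (cd C i) (dm C p). h \<cdot>\<^bsub>C\<^esub> i = u \<and> p \<cdot>\<^bsub>C\<^esub> h = v))"

definition llp :: "('o, 'm) cat \<Rightarrow> 'm set \<Rightarrow> 'm set" where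
  "llp C R = {i \<in> Ar C. \<forall>p \<in> R. has_lift C i p}"

definition rlp :: "('o, 'm) cat \<Rightarrow> 'm set \<Rightarrow> 'm set" where
  "rlp C L = {p \<in> Ar C. \<forall>i \<in> L. has_lift C i p}"

text \<open>A functorial factorization \<open>A \<rightarrow> F(f) \<rightarrow> B\<close> of \<open>f : A \<rightarrow> B\<close>.\<close>

record ('o, 'm) factorization =
  mid :: "('m, 'm \<times> 'm \<times> 'm \<times> 'm, 'o, 'm) functr"
  lft :: "'m \<Rightarrow> 'm"
  rgt :: "'m \<Rightarrow> 'm"

definition functorial_factorization ::
  "('o, 'm) cat \<Rightarrow> 'm set \<Rightarrow> 'm set \<Rightarrow> ('o, 'm) factorization \<Rightarrow> bool" where
  "functorial_factorization C L R \<phi> \<longleftrightarrow>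
     natural (arrow_cat C) C (dom_functor C) (mid \<phi>) (lft \<phi>) \<and>
     natural (arrow_cat C) C (mid \<phi>) (cod_functor C) (rgt \<phi>) \<and>
     (\<forall>f \<in> Ar C. lft \<phi> f \<in> L \<and> rgt \<phi> f \<in> R \<and> rgt \<phi> f \<cdot>\<^bsub>C\<^esub> lft \<phi> f = f)"

record ('o, 'm) model_structure =
  weq :: "'m set"
  cof :: "'m set"
  fib :: "'m set"
  fact_cof_tfib :: "('o, 'm) factorization"
  fact_tcof_fib :: "('o, 'm) factorization"

definition wide_subcategory :: "('o, 'm) cat \<Rightarrow> 'm set \<Rightarrow> bool" where
  "wide_subcategory C W \<longleftrightarrow> W \<subseteq> Ar C \<and> idt C ` Ob C \<subseteq> W \<and>
     (\<forall>f \<in> W. \<forall>g \<in> W. dm C g = cd C f \<longrightarrow> g \<cdot>\<^bsub>C\<^esub> f \<in> W)"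

definition is_model_structure :: "('o, 'm) cat \<Rightarrow> ('o, 'm) model_structure \<Rightarrow> bool" where
  "is_model_structure C M \<longleftrightarrow>
     wide_subcategory C (weq M) \<and> wide_subcategory C (cof M) \<and> wide_subcategory C (fib M) \<and>
     (\<forall>f \<in> Ar C. \<forall>g \<in> Ar C. dm C g = cd C f \<longrightarrow>
        (f \<in> weq M \<and> g \<in> weq M \<longrightarrow> g \<cdot>\<^bsub>C\<^esub> f \<in> weq M) \<and>
        (f \<in> weq M \<and> g \<cdot>\<^bsub>C\<^esub> f \<in> weq M \<longrightarrow> g \<in> weq M) \<and>
        (g \<in> weq M \<and> g \<cdot>\<^bsub>C\<^esub> f \<in> weq M \<longrightarrow> f \<in> weq M)) \<and>
     (\<forall>S \<in> {weq M, cof M, fib M}. \<forall>f g. retract_of (arrow_cat C) f g \<and> g \<in> S \<longrightarrow> f \<in> S) \<and>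
     (\<forall>i \<in> cof M \<inter> weq M. \<forall>p \<in> fib M. has_lift C i p) \<and>
     (\<forall>i \<in> cof M. \<forall>p \<in> fib M \<inter> weq M. has_lift C i p) \<and>
     functorial_factorization C (cof M) (fib M \<inter> weq M) (fact_cof_tfib M) \<and>
     functorial_factorization C (cof M \<inter> weq M) (fib M) (fact_tcof_fib M)"

definition model_category :: "'u rel \<Rightarrow> ('o, 'm) cat \<Rightarrow> ('o, 'm) model_structure \<Rightarrow> bool" where
  "model_category U C M \<longleftrightarrow>
     category C \<and> complete U C \<and> cocomplete U C \<and> is_model_structure C M"


section \<open>The small object argument\<close>

text \<open>The commutative squares \<open>(i, p, q)\<close>, \<open>r p = q i\<close>, from members \<open>i\<close> of \<open>I\<close> to \<open>r\<close>.\<close>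

definition squares_over :: "('o, 'm) cat \<Rightarrow> 'm set \<Rightarrow> 'm \<Rightarrow> ('m \<times> 'm \<times> 'm) set" where
  "squares_over C I r = {(i, p, q). i \<in> I \<and> p \<in> Hom C (dm C i) (dm C r) \<and>
     q \<in> Hom C (cd C i) (cd C r) \<and> r \<cdot>\<^bsub>C\<^esub> p = q \<cdot>\<^bsub>C\<^esub> i}"

text \<open>\<open>j : z \<rightarrow> z'\<close> is the pushout of the coproduct of the \<open>i\<close> along the map induced by the \<open>p\<close>,
  over all \<open>(i, p, q) \<in> S\<close>, with \<open>c (i, p, q) : cod i \<rightarrow> z'\<close> the characteristic map of the
  corresponding cell.\<close>

definition attach_cells ::
  "('o, 'm) cat \<Rightarrow> ('m \<times> 'm \<times> 'm) set \<Rightarrow> 'o \<Rightarrow> 'm \<Rightarrow> 'o \<Rightarrow> ('m \<times> 'm \<times> 'm \<Rightarrow> 'm) \<Rightarrow> bool" where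
  "attach_cells C S z j z' c \<longleftrightarrow>
     (\<exists>A a B b t h k.
        is_coproduct C S (\<lambda>(i, p, q). dm C i) A a \<and>
        is_coproduct C S (\<lambda>(i, p, q). cd C i) B b \<and>
        t \<in> Hom C A B \<and> (\<forall>(i, p, q) \<in> S. t \<cdot>\<^bsub>C\<^esub> a (i, p, q) = b (i, p, q) \<cdot>\<^bsub>C\<^esub> i) \<and>
        h \<in> Hom C A z \<and> (\<forall>(i, p, q) \<in> S. h \<cdot>\<^bsub>C\<^esub> a (i, p, q) = p) \<and>
        is_pushout C t h k j z' \<and>
        (\<forall>s \<in> S. c s = k \<cdot>\<^bsub>C\<^esub> b s))"

text \<open>
  The stages \<open>Z a\<close>, for \<open>a\<close> an ordinal below \<open>lam\<close> (that is, \<open>a \<in> Field lam\<close>), are functors of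
  \<open>f\<close> with transition maps \<open>t a b f : Z a f \<rightarrow> Z b f\<close> and augmentations \<open>\<rho> a f : Z a f \<rightarrow> cod f\<close>.
  The chain starts with \<open>\<rho> 0 f = f\<close>, attaches at successors all cells given by squares from
  \<open>I\<close> to \<open>\<rho> a f\<close>, and is continuous at limits; \<open>\<phi>\<close> is obtained from its colimit. The cells \<open>c\<close>
  determine the functors \<open>Z b\<close> at successor stages.
\<close>

definition chain_at ::
  "('l \<Rightarrow> ('m, 'm \<times> 'm \<times> 'm \<times> 'm, 'o, 'm) functr) \<Rightarrow> ('l \<Rightarrow> 'l \<Rightarrow> 'm \<Rightarrow> 'm) \<Rightarrow> 'm \<Rightarrow>
     ('l, 'l \<times> 'l, 'o, 'm) functr" where
  "chain_at Z t f = \<lparr>FO = (\<lambda>a. FO (Z a) f), FA = (\<lambda>(a, b). t a b f)\<rparr>"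

definition is_least_of :: "'l rel \<Rightarrow> 'l \<Rightarrow> bool" where
  "is_least_of r a \<longleftrightarrow> a \<in> Field r \<and> underS r a = {}"

definition is_succ_of :: "'l rel \<Rightarrow> 'l \<Rightarrow> 'l \<Rightarrow> bool" where
  "is_succ_of r a b \<longleftrightarrow> a \<in> Field r \<and> b \<in> Field r \<and> underS r b = under r a"

definition is_limit_of :: "'l rel \<Rightarrow> 'l \<Rightarrow> bool" where
  "is_limit_of r b \<longleftrightarrow> b \<in> Field r \<and> \<not> is_least_of r b \<and> (\<nexists>a. is_succ_of r a b)"

definition small_object_chain ::
  "('o, 'm) cat \<Rightarrow> 'l rel \<Rightarrow> 'm set \<Rightarrow>
     ('l \<Rightarrow> ('m, 'm \<times> 'm \<times> 'm \<times> 'm, 'o, 'm) functr) \<Rightarrow> ('l \<Rightarrow> 'l \<Rightarrow> 'm \<Rightarrow> 'm) \<Rightarrow>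
     ('l \<Rightarrow> 'm \<Rightarrow> 'm) \<Rightarrow> ('l \<Rightarrow> 'm \<Rightarrow> 'm \<times> 'm \<times> 'm \<Rightarrow> 'm) \<Rightarrow> bool" where
  "small_object_chain C lam I Z t \<rho> c \<longleftrightarrow>
     (\<forall>(a, b) \<in> lam. natural (arrow_cat C) C (Z a) (Z b) (t a b)) \<and>
     (\<forall>f \<in> Ar C. is_functor (poset_cat lam (Field lam)) C (chain_at Z t f)) \<and>
     (\<forall>a \<in> Field lam. natural (arrow_cat C) C (Z a) (cod_functor C) (\<rho> a)) \<and>
     (\<forall>(a, b) \<in> lam. \<forall>f \<in> Ar C. \<rho> b f \<cdot>\<^bsub>C\<^esub> t a b f = \<rho> a f) \<and>
     (\<forall>a. is_least_of lam a \<longrightarrow>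
        (\<forall>f \<in> Ar C. FO (Z a) f = dm C f \<and> \<rho> a f = f) \<and>
        (\<forall>(f, u, v, g) \<in> Ar (arrow_cat C). FA (Z a) (f, u, v, g) = u)) \<and>
     (\<forall>a b. is_succ_of lam a b \<longrightarrow>
        (\<forall>f \<in> Ar C. attach_cells C (squares_over C I (\<rho> a f)) (FO (Z a) f) (t a b f) (FO (Z b) f) (c a f) \<and>
           (\<forall>(i, p, q) \<in> squares_over C I (\<rho> a f). \<rho> b f \<cdot>\<^bsub>C\<^esub> c a f (i, p, q) = q)) \<and>
        (\<forall>(f, u, v, g) \<in> Ar (arrow_cat C). \<forall>(i, p, q) \<in> squares_over C I (\<rho> a f).
           FA (Z b) (f, u, v, g) \<cdot>\<^bsub>C\<^esub> c a f (i, p, q) =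
             c a g (i, FA (Z a) (f, u, v, g) \<cdot>\<^bsub>C\<^esub> p, v \<cdot>\<^bsub>C\<^esub> q))) \<and>
     (\<forall>b. is_limit_of lam b \<longrightarrow>
        (\<forall>f \<in> Ar C. is_colimit C (poset_cat lam (underS lam b)) (chain_at Z t f)
           (FO (Z b) f) (\<lambda>a. t a b f)))"

definition small_object_factorization ::
  "('o, 'm) cat \<Rightarrow> 'l rel \<Rightarrow> 'm set \<Rightarrow> ('o, 'm) factorization \<Rightarrow> bool" where
  "small_object_factorization C lam I \<phi> \<longleftrightarrow>
     (\<exists>Z t \<rho> c \<kappa>. small_object_chain C lam I Z t \<rho> c \<and>
        (\<forall>a \<in> Field lam. natural (arrow_cat C) C (Z a) (mid \<phi>) (\<kappa> a)) \<and>
        (\<forall>f \<in> Ar C. is_colimit C (poset_cat lam (Field lam)) (chain_at Z t f)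
           (FO (mid \<phi>) f) (\<lambda>a. \<kappa> a f)) \<and>
        (\<forall>f \<in> Ar C. \<forall>a. is_least_of lam a \<longrightarrow> lft \<phi> f = \<kappa> a f) \<and>
        (\<forall>f \<in> Ar C. \<forall>a \<in> Field lam. rgt \<phi> f \<cdot>\<^bsub>C\<^esub> \<kappa> a f = \<rho> a f))"


section \<open>Combinatorial model categories\<close>

definition generated_by_presentables ::
  "'u rel \<Rightarrow> 'l rel \<Rightarrow> ('o, 'm) cat \<Rightarrow> 'm set \<Rightarrow> 'm set \<Rightarrow> bool" where
  "generated_by_presentables U lam C L I \<longleftrightarrow> I \<subseteq> Ar C \<and> small U I \<and> L = llp C (rlp C I) \<and>
     (\<forall>i \<in> I. presentable U lam C (dm C i) \<and> presentable U lam C (cd C i))"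

definition combinatorial ::
  "'u rel \<Rightarrow> 'l rel \<Rightarrow> ('o, 'm) cat \<Rightarrow> ('o, 'm) model_structure \<Rightarrow> bool" where
  "combinatorial U lam C M \<longleftrightarrow> model_category U C M \<and> locally_presentable U lam C \<and>
     (\<exists>I. generated_by_presentables U lam C (cof M) I \<and>
          small_object_factorization C lam I (fact_cof_tfib M)) \<and>
     (\<exists>J. generated_by_presentables U lam C (cof M \<inter> weq M) J \<and>
          small_object_factorization C lam J (fact_tcof_fib M))"

definition strongly_combinatorial ::
  "'u rel \<Rightarrow> 'l rel \<Rightarrow> ('o, 'm) cat \<Rightarrow> ('o, 'm) model_structure \<Rightarrow> bool" where
  "strongly_combinatorial U lam C M \<longleftrightarrow> combinatorial U lam C M \<and>
     (\<forall>f \<in> Ar C. presentable U lam C (dm C f) \<longrightarrow> presentable U lam C (cd C f) \<longrightarrow>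
        presentable U lam C (FO (mid (fact_cof_tfib M)) f))"


section \<open>The homotopy category\<close>

text \<open>
  The localization at a class \<open>W\<close>: arrows are strings of arrows and of formal inverses of members
  of \<open>W\<close>, listed in the order in which they are traversed, modulo the congruence generated by the
  relations \<open>(id) = ()\<close>, \<open>(f, g) = (g f)\<close>, \<open>(w, w\<inverse>) = ()\<close> and \<open>(w\<inverse>, w) = ()\<close>. An arrow of the
  localization is an equivalence class together with its source and target.
\<close>

datatype 'm step = Fwd 'm | Bwd 'm

fun zigzag :: "('o, 'm) cat \<Rightarrow> 'm set \<Rightarrow> 'o \<Rightarrow> 'm step list \<Rightarrow> 'o \<Rightarrow> bool" where
  "zigzag C W X [] Y \<longleftrightarrow> X \<in> Ob C \<and> X = Y"
| "zigzag C W X (Fwd f # p) Y \<longleftrightarrow> f \<in> Ar C \<and> dm C f = X \<and> zigzag C W (cd C f) p Y"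
| "zigzag C W X (Bwd w # p) Y \<longleftrightarrow> w \<in> W \<and> cd C w = X \<and> zigzag C W (dm C w) p Y"

inductive zigzag_step :: "('o, 'm) cat \<Rightarrow> 'm set \<Rightarrow> 'm step list \<Rightarrow> 'm step list \<Rightarrow> bool"
  for C W where
  "x \<in> Ob C \<Longrightarrow> zigzag_step C W (p @ [Fwd (idt C x)] @ q) (p @ q)"
| "f \<in> Ar C \<Longrightarrow> g \<in> Ar C \<Longrightarrow> dm C g = cd C f \<Longrightarrow>
     zigzag_step C W (p @ [Fwd f, Fwd g] @ q) (p @ [Fwd (g \<cdot>\<^bsub>C\<^esub> f)] @ q)"
| "w \<in> W \<Longrightarrow> zigzag_step C W (p @ [Fwd w, Bwd w] @ q) (p @ q)"
| "w \<in> W \<Longrightarrow> zigzag_step C W (p @ [Bwd w, Fwd w] @ q) (p @ q)"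

definition zigzag_class ::
  "('o, 'm) cat \<Rightarrow> 'm set \<Rightarrow> 'o \<Rightarrow> 'm step list \<Rightarrow> 'o \<Rightarrow> 'm step list set" where
  "zigzag_class C W X p Y = {q. zigzag C W X q Y \<and>
     equivclp (\<lambda>p q. zigzag C W X p Y \<and> zigzag C W X q Y \<and> zigzag_step C W p q) p q}"

type_synonym ('o, 'm) ho_arrow = "'o \<times> 'm step list set \<times> 'o"

definition Ho :: "('o, 'm) cat \<Rightarrow> 'm set \<Rightarrow> ('o, ('o, 'm) ho_arrow) cat" where
  "Ho C W =
     \<lparr>Ob = Ob C,
      Ar = {(X, zigzag_class C W X p Y, Y) | X p Y. zigzag C W X p Y},
      dm = (\<lambda>(X, c, Y). X),
      cd = (\<lambda>(X, c, Y). Y),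
      idt = (\<lambda>X. (X, zigzag_class C W X [] X, X)),
      cmp = (\<lambda>(Y', d, Z) (X, c, Y).
               (X, \<Union>p \<in> c. \<Union>q \<in> d. zigzag_class C W X (p @ q) Z, Z))\<rparr>"

definition Ho_functor ::
  "('o, 'm) cat \<Rightarrow> 'm set \<Rightarrow> ('o, 'm, 'o, ('o, 'm) ho_arrow) functr" where
  "Ho_functor C W =
     \<lparr>FO = (\<lambda>X. X), FA = (\<lambda>f. (dm C f, zigzag_class C W (dm C f) [Fwd f] (cd C f), cd C f))\<rparr>"

definition Ho_presentables ::
  "'u rel \<Rightarrow> 'l rel \<Rightarrow> ('o, 'm) cat \<Rightarrow> 'm set \<Rightarrow> ('o, ('o, 'm) ho_arrow) cat" where
  "Ho_presentables U lam C W =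
     full_subcat (Ho C W) (FO (Ho_functor C W) ` Ob (presentables U lam C))"

definition E_functor :: "'u rel \<Rightarrow> 'l rel \<Rightarrow> ('o, 'm) cat \<Rightarrow> 'm set \<Rightarrow>
    ('o, ('o, 'm) ho_arrow, ('o, ('o, 'm) ho_arrow) presheaf, ('o, ('o, 'm) ho_arrow) presheaf_map) functr" where
  "E_functor U lam C W = restricted_yoneda (Ho C W) (Ho_presentables U lam C W)"

definition brown_on_morphisms ::
  "'u rel \<Rightarrow> 'l rel \<Rightarrow> ('o, 'm) cat \<Rightarrow> ('o, 'm) model_structure \<Rightarrow> bool" where
  "brown_on_morphisms U lam C M \<longleftrightarrow>
     full_functor (Ho C (weq M)) (Ind U lam (Ho_presentables U lam C (weq M)))
       (E_functor U lam C (weq M))"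

end

(*
  The key point is that for a lam-presentable object A the functor Ho(PA, P-) sends the lam-filtered
  colimit K of D to a colimit of sets. Here A may be taken cofibrant, since the strong
  hypothesis provides presentable cofibrant replacements and presentable cylinders. Then Ho(PA, PX)
  is the set of homotopy classes of maps A -> RX for a fibrant replacement R given by the small
  object argument. As the generating trivial cofibrations have presentable domains, R preserves
  lam-filtered colimits, and both maps A -> RK and homotopies between them descend to some RDd.

  Consequently E_lam(PK) is the colimit of the representables E_lam(PDd). A cocone from PD to Y
  therefore induces a map E_lam(PK) -> E_lam(Y), which lifts to PK -> Y by the Brown property. If f
  fixes all P(delta_d), then E_lam(f) is the identity, whence minimality when E_lam reflects
  isomorphisms.
*)
theory Submission
  imports Defs
begin

section \<open>Categories and functors\<close>

text \<open>Arrows of \<open>Ho\<close> are zigzags modulo a congruence, so homotopy is not built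
  into equality there. That homotopic maps become equal is immediate; the converse needs an
  invariant of zigzags. It is their action on homotopy classes of maps from A into fibrant
  replacements, and the relations of the congruence hold for it because weak equivalences between
  fibrant objects induce bijections on such classes.

  Homotopies refer to one chosen cylinder on A: a homotopy, like a map, descends to a stage of a
  filtered colimit when its source is presentable. Cofibrant replacement and cylinder are
  presentable because they arise by factoring maps between presentable objects, the map from the
  initial object and the codiagonal of A + A.

  For R one follows the stages of the small object argument. Over the terminal object a cell is just
  a map from the domain of a generator, so presentable domains control every stage.

  The Brown property concerns maps in Ind. Hence E must be shown to land there, and the hom-sets of
  \<open>Ho\<close> must be shown to be small, so that E has values in presheaves of small sets at
  all.\<close>

lemma HomI: "f \<in> Ar C \<Longrightarrow> dm C f = x \<Longrightarrow> cd C f = y \<Longrightarrow> f \<in> Hom C x y"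
  by (simp add: Hom_def)

lemma HomD: "f \<in> Hom C x y \<Longrightarrow> f \<in> Ar C \<and> dm C f = x \<and> cd C f = y"
  by (simp add: Hom_def)

lemma Ar_Hom: "f \<in> Ar C \<Longrightarrow> f \<in> Hom C (dm C f) (cd C f)"
  by (simp add: Hom_def)

lemma Hom_Ob: "category C \<Longrightarrow> f \<in> Hom C x y \<Longrightarrow> x \<in> Ob C \<and> y \<in> Ob C"
  by (auto simp: category_def Hom_def)

lemma idt_Hom: "category C \<Longrightarrow> x \<in> Ob C \<Longrightarrow> idt C x \<in> Hom C x x"
  by (auto simp: category_def)

lemma comp_Hom: "category C \<Longrightarrow> f \<in> Hom C x y \<Longrightarrow> g \<in> Hom C y z \<Longrightarrow> g \<cdot>\<^bsub>C\<^esub> f \<in> Hom C x z"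
  by (auto simp: category_def Hom_def)

lemma comp_idr: "category C \<Longrightarrow> f \<in> Hom C x y \<Longrightarrow> f \<cdot>\<^bsub>C\<^esub> idt C x = f"
  by (auto simp: category_def Hom_def)

lemma comp_idl: "category C \<Longrightarrow> f \<in> Hom C x y \<Longrightarrow> idt C y \<cdot>\<^bsub>C\<^esub> f = f"
  by (auto simp: category_def Hom_def)

lemma comp_assoc: "category C \<Longrightarrow> f \<in> Hom C x y \<Longrightarrow> g \<in> Hom C y z \<Longrightarrow> h \<in> Hom C z w \<Longrightarrow>
    (h \<cdot>\<^bsub>C\<^esub> g) \<cdot>\<^bsub>C\<^esub> f = h \<cdot>\<^bsub>C\<^esub> (g \<cdot>\<^bsub>C\<^esub> f)"
  by (auto simp: category_def Hom_def)

lemma comp_idl': "category C \<Longrightarrow> u \<in> Hom C w x \<Longrightarrow> f \<in> Hom C x y \<Longrightarrow> g \<in> Hom C y x \<Longrightarrow>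
    g \<cdot>\<^bsub>C\<^esub> f = idt C x \<Longrightarrow> g \<cdot>\<^bsub>C\<^esub> (f \<cdot>\<^bsub>C\<^esub> u) = u"
  by (metis comp_assoc comp_idl)

lemma functor_cats: "is_functor C D F \<Longrightarrow> category C \<and> category D"
  by (simp add: is_functor_def)

lemma functor_Ob: "is_functor C D F \<Longrightarrow> x \<in> Ob C \<Longrightarrow> FO F x \<in> Ob D"
  by (simp add: is_functor_def)

lemma functor_Hom: "is_functor C D F \<Longrightarrow> f \<in> Hom C x y \<Longrightarrow> FA F f \<in> Hom D (FO F x) (FO F y)"
  by (auto simp: is_functor_def Hom_def)

lemma functor_idt: "is_functor C D F \<Longrightarrow> x \<in> Ob C \<Longrightarrow> FA F (idt C x) = idt D (FO F x)"
  by (simp add: is_functor_def)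

lemma functor_comp: "is_functor C D F \<Longrightarrow> f \<in> Hom C x y \<Longrightarrow> g \<in> Hom C y z \<Longrightarrow>
    FA F (g \<cdot>\<^bsub>C\<^esub> f) = FA F g \<cdot>\<^bsub>D\<^esub> FA F f"
  by (auto simp: is_functor_def Hom_def)

lemma functr_comp_simps [simp]:
  "FO (functr_comp G F) x = FO G (FO F x)" "FA (functr_comp G F) m = FA G (FA F m)"
  by (simp_all add: functr_comp_def)

lemma is_functor_comp:
  assumes F: "is_functor A B F" and G: "is_functor B C G"
  shows "is_functor A C (functr_comp G F)"
  unfolding is_functor_def
proof (intro conjI ballI impI)
  fix f g assume "f \<in> Ar A" "g \<in> Ar A" "dm A g = cd A f"
  then have f: "f \<in> Hom A (dm A f) (cd A f)" and g: "g \<in> Hom A (cd A f) (cd A g)"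
    by (auto simp: Hom_def)
  show "FA (functr_comp G F) (g \<cdot>\<^bsub>A\<^esub> f) = FA (functr_comp G F) g \<cdot>\<^bsub>C\<^esub> FA (functr_comp G F) f"
    using functor_comp[OF F f g] functor_comp[OF G functor_Hom[OF F f] functor_Hom[OF F g]] by simp
qed (use functor_cats[OF F] functor_cats[OF G] functor_Ob[OF F] functor_Ob[OF G] functor_idt[OF F]
      functor_idt[OF G] functor_Hom[OF G functor_Hom[OF F Ar_Hom]] in simp_all)

lemma natural_Hom: "natural C D F G \<eta> \<Longrightarrow> x \<in> Ob C \<Longrightarrow> \<eta> x \<in> Hom D (FO F x) (FO G x)"
  by (simp add: natural_def)

lemma natural_comm: "natural C D F G \<eta> \<Longrightarrow> f \<in> Hom C x y \<Longrightarrow> \<eta> y \<cdot>\<^bsub>D\<^esub> FA F f = FA G f \<cdot>\<^bsub>D\<^esub> \<eta> x"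
  by (auto simp: natural_def Hom_def)

lemma category_op_cat: "category C \<Longrightarrow> category (op_cat C)"
  by (auto simp: category_def op_cat_def Hom_def)

lemma Hom_op_cat [simp]: "Hom (op_cat C) x y = Hom C y x"
  by (auto simp: op_cat_def Hom_def)

lemma op_cat_simps [simp]:
  "Ob (op_cat C) = Ob C" "Ar (op_cat C) = Ar C" "dm (op_cat C) = cd C" "cd (op_cat C) = dm C"
  "idt (op_cat C) = idt C" "g \<cdot>\<^bsub>op_cat C\<^esub> f = f \<cdot>\<^bsub>C\<^esub> g"
  by (simp_all add: op_cat_def)

lemma full_subcat_simps [simp]:
  "Ob (full_subcat C S) = Ob C \<inter> S" "Ar (full_subcat C S) = {f \<in> Ar C. dm C f \<in> S \<and> cd C f \<in> S}"
  "dm (full_subcat C S) = dm C" "cd (full_subcat C S) = cd C"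
  "idt (full_subcat C S) = idt C" "cmp (full_subcat C S) = cmp C"
  by (simp_all add: full_subcat_def)

lemma Hom_full_subcat: "x \<in> S \<Longrightarrow> y \<in> S \<Longrightarrow> Hom (full_subcat C S) x y = Hom C x y"
  by (auto simp: Hom_def)

lemma Hom_full_subcatD: "f \<in> Hom (full_subcat C S) x y \<Longrightarrow> f \<in> Hom C x y \<and> x \<in> S \<and> y \<in> S"
  by (auto simp: Hom_def)

lemma category_full_subcat: "category C \<Longrightarrow> category (full_subcat C S)"
  unfolding category_def by (auto simp: Hom_def)

lemma is_functor_full_subcat:
  assumes "is_functor J (full_subcat C S) D" "category C"
  shows "is_functor J C D"
  using assms unfolding is_functor_def by (auto simp: Hom_def)

lemma is_functor_into_full_subcat:
  assumes "is_functor J C D" "\<And>d. d \<in> Ob J \<Longrightarrow> FO D d \<in> S"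
  shows "is_functor J (full_subcat C S) D"
proof -
  have "category J" "category C" using assms(1) by (auto simp: is_functor_def)
  then show ?thesis
    using assms unfolding is_functor_def
    by (auto simp: category_full_subcat) (auto simp: Hom_def category_def)
qed

section \<open>Cocones and colimits\<close>

lemma cocone_Hom: "is_cocone C J D X \<delta> \<Longrightarrow> d \<in> Ob J \<Longrightarrow> \<delta> d \<in> Hom C (FO D d) X"
  by (simp add: is_cocone_def)

lemma cocone_comm: "is_cocone C J D X \<delta> \<Longrightarrow> m \<in> Hom J d e \<Longrightarrow> \<delta> e \<cdot>\<^bsub>C\<^esub> FA D m = \<delta> d"
  by (auto simp: is_cocone_def Hom_def)

lemma colimit_cocone: "is_colimit C J D X \<delta> \<Longrightarrow> is_cocone C J D X \<delta>"
  by (simp add: is_colimit_def)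

lemma colimit_ex: "is_colimit C J D X \<delta> \<Longrightarrow> is_cocone C J D Y \<epsilon> \<Longrightarrow>
    \<exists>h \<in> Hom C X Y. \<forall>d \<in> Ob J. h \<cdot>\<^bsub>C\<^esub> \<delta> d = \<epsilon> d"
  unfolding is_colimit_def by blast

lemma cocone_comp:
  assumes D: "is_functor J C D" and c: "is_cocone C J D X \<delta>" and h: "h \<in> Hom C X Y"
  shows "is_cocone C J D Y (\<lambda>d. h \<cdot>\<^bsub>C\<^esub> \<delta> d)"
  unfolding is_cocone_def
proof (intro conjI ballI)
  have C: "category C" and J: "category J" using functor_cats[OF D] by auto
  show "Y \<in> Ob C" using Hom_Ob[OF C h] by simp
  show "h \<cdot>\<^bsub>C\<^esub> \<delta> d \<in> Hom C (FO D d) Y" if "d \<in> Ob J" for d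
    using comp_Hom[OF C cocone_Hom[OF c that] h] .
  fix m assume "m \<in> Ar J"
  then have m: "m \<in> Hom J (dm J m) (cd J m)" by (rule Ar_Hom)
  show "(h \<cdot>\<^bsub>C\<^esub> \<delta> (cd J m)) \<cdot>\<^bsub>C\<^esub> FA D m = h \<cdot>\<^bsub>C\<^esub> \<delta> (dm J m)"
    using comp_assoc[OF C functor_Hom[OF D m] cocone_Hom[OF c] h] Hom_Ob[OF J m] cocone_comm[OF c m]
    by simp
qed

text \<open>The legs of a colimit are jointly epic: both \<open>h\<close> and \<open>h'\<close>
  factor the cocone obtained by composing the legs with \<open>h'\<close>.\<close>

lemma colimit_unique:
  assumes D: "is_functor J C D" and c: "is_colimit C J D X \<delta>"
    and h: "h \<in> Hom C X Y" and h': "h' \<in> Hom C X Y"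
    and e: "\<And>d. d \<in> Ob J \<Longrightarrow> h \<cdot>\<^bsub>C\<^esub> \<delta> d = h' \<cdot>\<^bsub>C\<^esub> \<delta> d"
  shows "h = h'"
proof -
  have "is_cocone C J D Y (\<lambda>d. h' \<cdot>\<^bsub>C\<^esub> \<delta> d)"
    by (rule cocone_comp[OF D colimit_cocone[OF c] h'])
  then have "\<exists>!k. k \<in> Hom C X Y \<and> (\<forall>d \<in> Ob J. k \<cdot>\<^bsub>C\<^esub> \<delta> d = h' \<cdot>\<^bsub>C\<^esub> \<delta> d)"
    using c unfolding is_colimit_def by blast
  then show ?thesis using h h' e by blast
qed

lemma colimitI:
  assumes "is_cocone C J D X \<delta>"
    and "\<And>Y \<epsilon>. is_cocone C J D Y \<epsilon> \<Longrightarrow> \<exists>h \<in> Hom C X Y. \<forall>d \<in> Ob J. h \<cdot>\<^bsub>C\<^esub> \<delta> d = \<epsilon> d"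
    and "\<And>Y h h'. h \<in> Hom C X Y \<Longrightarrow> h' \<in> Hom C X Y \<Longrightarrow>
           (\<And>d. d \<in> Ob J \<Longrightarrow> h \<cdot>\<^bsub>C\<^esub> \<delta> d = h' \<cdot>\<^bsub>C\<^esub> \<delta> d) \<Longrightarrow> h = h'"
  shows "is_colimit C J D X \<delta>"
  unfolding is_colimit_def
proof (intro conjI allI impI)
  fix Y \<epsilon> assume c: "is_cocone C J D Y \<epsilon>"
  obtain h where h: "h \<in> Hom C X Y" "\<forall>d \<in> Ob J. h \<cdot>\<^bsub>C\<^esub> \<delta> d = \<epsilon> d" using assms(2)[OF c] by blast
  show "\<exists>!h. h \<in> Hom C X Y \<and> (\<forall>d \<in> Ob J. h \<cdot>\<^bsub>C\<^esub> \<delta> d = \<epsilon> d)"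
    using h by (intro ex1I[of _ h]) (auto intro: assms(3))
qed (rule assms(1))

text \<open>A functor record carries arbitrary values off the objects and arrows of its source, so
  diagrams are compared only where they matter. Equality of records would be too much to
  ask.\<close>

lemma is_cocone_cong:
  assumes "category J" "\<And>d. d \<in> Ob J \<Longrightarrow> FO D d = FO D' d" "\<And>m. m \<in> Ar J \<Longrightarrow> FA D m = FA D' m"
    "\<And>d. d \<in> Ob J \<Longrightarrow> \<delta> d = \<delta>' d"
  shows "is_cocone C J D X \<delta> \<longleftrightarrow> is_cocone C J D' X \<delta>'"
  using assms unfolding is_cocone_def category_def by simp

lemma is_colimit_cong:
  assumes "category J" "\<And>d. d \<in> Ob J \<Longrightarrow> FO D d = FO D' d" "\<And>m. m \<in> Ar J \<Longrightarrow> FA D m = FA D' m"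
    "\<And>d. d \<in> Ob J \<Longrightarrow> \<delta> d = \<delta>' d"
  shows "is_colimit C J D X \<delta> \<longleftrightarrow> is_colimit C J D' X \<delta>'"
proof -
  have 1: "is_cocone C J D X \<delta> \<longleftrightarrow> is_cocone C J D' X \<delta>'" by (rule is_cocone_cong[OF assms])
  have 2: "is_cocone C J D Y \<epsilon> \<longleftrightarrow> is_cocone C J D' Y \<epsilon>" for Y \<epsilon>
    by (rule is_cocone_cong[OF assms(1-3) refl])
  show ?thesis unfolding is_colimit_def 1 2[of _ \<epsilon> for \<epsilon>] using 1 2 assms(4) by (simp cong: ball_cong)
qed

text \<open>Colimits commute with colimits. The array of objects is given by its rows
  \<open>Ch d\<close> and its columns \<open>Da a\<close>, and \<open>n1\<close> to
  \<open>n3\<close> are the squares that a functor of two variables would provide, so no product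
  category has to be formed. In the application \<open>A\<close> is a chain of stages and
  \<open>J\<close> the filtered index category.\<close>

lemma colimit_interchange:
  assumes J: "is_functor J C Db" and A: "is_functor A C (ChK)"
    and chd: "\<And>d. d \<in> Ob J \<Longrightarrow> is_functor A C (Ch d)"
    and Da: "\<And>a. a \<in> Ob A \<Longrightarrow> is_functor J C (Da a)"
    and cd: "\<And>d. d \<in> Ob J \<Longrightarrow> is_colimit C A (Ch d) (FO Db d) (\<lambda>a. t a d)"
    and c0: "is_colimit C A ChK X (\<lambda>a. tK a)"
    and ca: "\<And>a. a \<in> Ob A \<Longrightarrow> is_colimit C J (Da a) (FO ChK a) (\<lambda>d. \<delta> a d)"
    and ob: "\<And>a d. a \<in> Ob A \<Longrightarrow> d \<in> Ob J \<Longrightarrow> FO (Da a) d = FO (Ch d) a"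
    and coc: "is_cocone C J Db X \<gamma>"
    and n1: "\<And>a d. a \<in> Ob A \<Longrightarrow> d \<in> Ob J \<Longrightarrow> \<gamma> d \<cdot>\<^bsub>C\<^esub> t a d = tK a \<cdot>\<^bsub>C\<^esub> \<delta> a d"
    and n2: "\<And>a d e m. a \<in> Ob A \<Longrightarrow> m \<in> Hom J d e \<Longrightarrow> FA Db m \<cdot>\<^bsub>C\<^esub> t a d = t a e \<cdot>\<^bsub>C\<^esub> FA (Da a) m"
    and n3: "\<And>a b d n. n \<in> Hom A a b \<Longrightarrow> d \<in> Ob J \<Longrightarrow>
       FA ChK n \<cdot>\<^bsub>C\<^esub> \<delta> a d = \<delta> b d \<cdot>\<^bsub>C\<^esub> FA (Ch d) n"
  shows "is_colimit C J Db X \<gamma>"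
proof (rule colimitI[OF coc])
  have C: "category C" and Jc: "category J" using functor_cats[OF J] by auto
  have Ac: "category A" using functor_cats[OF A] by auto
  have t: "t a d \<in> Hom C (FO (Ch d) a) (FO Db d)" if "a \<in> Ob A" "d \<in> Ob J" for a d
    using cocone_Hom[OF colimit_cocone[OF cd]] that by blast
  have tK: "tK a \<in> Hom C (FO ChK a) X" if "a \<in> Ob A" for a
    using cocone_Hom[OF colimit_cocone[OF c0]] that by blast
  have del: "\<delta> a d \<in> Hom C (FO (Ch d) a) (FO ChK a)" if "a \<in> Ob A" "d \<in> Ob J" for a d
    using cocone_Hom[OF colimit_cocone[OF ca]] that ob by metis
  have gam: "\<gamma> d \<in> Hom C (FO Db d) X" if "d \<in> Ob J" for d
    using cocone_Hom[OF coc that] .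
  {
    fix Y h h' assume h: "h \<in> Hom C X Y" "h' \<in> Hom C X Y"
      and e: "\<And>d. d \<in> Ob J \<Longrightarrow> h \<cdot>\<^bsub>C\<^esub> \<gamma> d = h' \<cdot>\<^bsub>C\<^esub> \<gamma> d"
    show "h = h'"
    proof (rule colimit_unique[OF A c0 h])
      fix a assume a: "a \<in> Ob A"
      show "h \<cdot>\<^bsub>C\<^esub> tK a = h' \<cdot>\<^bsub>C\<^esub> tK a"
      proof (rule colimit_unique[OF Da[OF a] ca[OF a]])
        fix d assume d: "d \<in> Ob J"
        have "(k \<cdot>\<^bsub>C\<^esub> tK a) \<cdot>\<^bsub>C\<^esub> \<delta> a d = (k \<cdot>\<^bsub>C\<^esub> \<gamma> d) \<cdot>\<^bsub>C\<^esub> t a d" if "k \<in> Hom C X Y" for k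
          using comp_assoc[OF C del[OF a d] tK[OF a] that] comp_assoc[OF C t[OF a d] gam[OF d] that]
            n1[OF a d] by simp
        then show "(h \<cdot>\<^bsub>C\<^esub> tK a) \<cdot>\<^bsub>C\<^esub> \<delta> a d = (h' \<cdot>\<^bsub>C\<^esub> tK a) \<cdot>\<^bsub>C\<^esub> \<delta> a d"
          using h e[OF d] by simp
      qed (use comp_Hom[OF C tK[OF a]] h in auto)
    qed
  }
  fix Y \<epsilon> assume ce: "is_cocone C J Db Y \<epsilon>"
  have eps: "\<epsilon> d \<in> Hom C (FO Db d) Y" if "d \<in> Ob J" for d
    using cocone_Hom[OF ce that] .
  \<comment> \<open>Precomposing with the legs \<open>t a d\<close> turns \<open>\<epsilon>\<close>
    into a cocone under the column \<open>Da a\<close>; its factorization is the component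
    \<open>h a\<close>.\<close>
  have "\<exists>h. h \<in> Hom C (FO ChK a) Y \<and> (\<forall>d \<in> Ob J. h \<cdot>\<^bsub>C\<^esub> \<delta> a d = \<epsilon> d \<cdot>\<^bsub>C\<^esub> t a d)" if a: "a \<in> Ob A" for a
  proof -
    have "is_cocone C J (Da a) Y (\<lambda>d. \<epsilon> d \<cdot>\<^bsub>C\<^esub> t a d)"
      unfolding is_cocone_def
    proof (intro conjI ballI)
      show "Y \<in> Ob C" using ce by (simp add: is_cocone_def)
      show "\<epsilon> d \<cdot>\<^bsub>C\<^esub> t a d \<in> Hom C (FO (Da a) d) Y" if "d \<in> Ob J" for d
        using comp_Hom[OF C t[OF a that] eps[OF that]] ob[OF a that] by simp
      fix m assume "m \<in> Ar J"
      then have m: "m \<in> Hom J (dm J m) (cd J m)" by (rule Ar_Hom)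
      let ?d = "dm J m" and ?e = "cd J m"
      have d: "?d \<in> Ob J" and e: "?e \<in> Ob J" using Hom_Ob[OF Jc m] by auto
      have dm: "FA (Da a) m \<in> Hom C (FO (Ch ?d) a) (FO (Ch ?e) a)"
        using functor_Hom[OF Da[OF a] m] ob[OF a d] ob[OF a e] by simp
      have "(\<epsilon> ?e \<cdot>\<^bsub>C\<^esub> t a ?e) \<cdot>\<^bsub>C\<^esub> FA (Da a) m = \<epsilon> ?e \<cdot>\<^bsub>C\<^esub> (FA Db m \<cdot>\<^bsub>C\<^esub> t a ?d)"
        using comp_assoc[OF C dm t[OF a e] eps[OF e]] n2[OF a m] by simp
      also have "\<dots> = \<epsilon> ?d \<cdot>\<^bsub>C\<^esub> t a ?d"
        using comp_assoc[OF C t[OF a d] functor_Hom[OF J m] eps[OF e]] cocone_comm[OF ce m] by simp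
      finally show "(\<epsilon> ?e \<cdot>\<^bsub>C\<^esub> t a ?e) \<cdot>\<^bsub>C\<^esub> FA (Da a) m = \<epsilon> ?d \<cdot>\<^bsub>C\<^esub> t a ?d" .
    qed
    then show ?thesis using colimit_ex[OF ca[OF a]] by blast
  qed
  then obtain h where h: "\<And>a. a \<in> Ob A \<Longrightarrow> h a \<in> Hom C (FO ChK a) Y"
    and hd: "\<And>a d. a \<in> Ob A \<Longrightarrow> d \<in> Ob J \<Longrightarrow> h a \<cdot>\<^bsub>C\<^esub> \<delta> a d = \<epsilon> d \<cdot>\<^bsub>C\<^esub> t a d" by metis
  have "is_cocone C A ChK Y h"
    unfolding is_cocone_def
  proof (intro conjI ballI)
    show "Y \<in> Ob C" using ce by (simp add: is_cocone_def)
    show "h a \<in> Hom C (FO ChK a) Y" if "a \<in> Ob A" for a using h[OF that] .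
    fix n assume "n \<in> Ar A"
    then have n: "n \<in> Hom A (dm A n) (cd A n)" by (rule Ar_Hom)
    let ?a = "dm A n" and ?b = "cd A n"
    have a: "?a \<in> Ob A" and b: "?b \<in> Ob A" using Hom_Ob[OF Ac n] by auto
    \<comment> \<open>Maps out of \<open>FO ChK ?a\<close> may be compared on the column
      \<open>Da ?a\<close>, where \<open>n3\<close> and the cocone relations of the row
      \<open>Ch d\<close> apply.\<close>
    show "h ?b \<cdot>\<^bsub>C\<^esub> FA ChK n = h ?a"
    proof (rule colimit_unique[OF Da[OF a] ca[OF a]])
      show "h ?b \<cdot>\<^bsub>C\<^esub> FA ChK n \<in> Hom C (FO ChK ?a) Y"
        using comp_Hom[OF C functor_Hom[OF A n] h[OF b]] .
      show "h ?a \<in> Hom C (FO ChK ?a) Y" using h[OF a] .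
      fix d assume d: "d \<in> Ob J"
      have "(h ?b \<cdot>\<^bsub>C\<^esub> FA ChK n) \<cdot>\<^bsub>C\<^esub> \<delta> ?a d = h ?b \<cdot>\<^bsub>C\<^esub> (\<delta> ?b d \<cdot>\<^bsub>C\<^esub> FA (Ch d) n)"
        using comp_assoc[OF C del[OF a d] functor_Hom[OF A n] h[OF b]] n3[OF n d] by simp
      also have "\<dots> = \<epsilon> d \<cdot>\<^bsub>C\<^esub> (t ?b d \<cdot>\<^bsub>C\<^esub> FA (Ch d) n)"
        using comp_assoc[OF C functor_Hom[OF chd[OF d] n] del[OF b d] h[OF b]]
          comp_assoc[OF C functor_Hom[OF chd[OF d] n] t[OF b d] eps[OF d]] hd[OF b d] by simp
      also have "\<dots> = h ?a \<cdot>\<^bsub>C\<^esub> \<delta> ?a d"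
        using cocone_comm[OF colimit_cocone[OF cd[OF d]] n] hd[OF a d] by simp
      finally show "(h ?b \<cdot>\<^bsub>C\<^esub> FA ChK n) \<cdot>\<^bsub>C\<^esub> \<delta> ?a d = h ?a \<cdot>\<^bsub>C\<^esub> \<delta> ?a d" .
    qed
  qed
  then obtain k where k: "k \<in> Hom C X Y" and kt: "\<And>a. a \<in> Ob A \<Longrightarrow> k \<cdot>\<^bsub>C\<^esub> tK a = h a"
    using colimit_ex[OF c0] by blast
  have "k \<cdot>\<^bsub>C\<^esub> \<gamma> d = \<epsilon> d" if d: "d \<in> Ob J" for d
  proof (rule colimit_unique[OF chd[OF d] cd[OF d]])
    show "k \<cdot>\<^bsub>C\<^esub> \<gamma> d \<in> Hom C (FO Db d) Y" using comp_Hom[OF C gam[OF d] k] .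
    show "\<epsilon> d \<in> Hom C (FO Db d) Y" using eps[OF d] .
    fix a assume a: "a \<in> Ob A"
    show "(k \<cdot>\<^bsub>C\<^esub> \<gamma> d) \<cdot>\<^bsub>C\<^esub> t a d = \<epsilon> d \<cdot>\<^bsub>C\<^esub> t a d"
      using comp_assoc[OF C t[OF a d] gam[OF d] k] comp_assoc[OF C del[OF a d] tK[OF a] k]
        n1[OF a d] kt[OF a] hd[OF a d] by simp
  qed
  then show "\<exists>h \<in> Hom C X Y. \<forall>d \<in> Ob J. h \<cdot>\<^bsub>C\<^esub> \<gamma> d = \<epsilon> d" using k by blast
qed

text \<open>Colimits of functors are computed pointwise: the factorizations at the single objects
  are unique, and this uniqueness makes them natural. The components are read off with
  \<open>fst\<close> and \<open>snd\<close> because an arrow of \<open>functor_cat\<close> is a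
  triple of source, components and target.\<close>

lemma functor_cat_colimit_pointwise:
  fixes A :: "('a, 'b) cat" and B :: "('p, 'n) cat"
  assumes B: "category B"
    and coc: "is_cocone (functor_cat A B) J F G \<delta>"
    and F: "\<And>a. a \<in> Ob A \<Longrightarrow>
      is_functor J B \<lparr>FO = \<lambda>d. FO (FO F d) a, FA = \<lambda>m. fst (snd (FA F m)) a\<rparr>"
    and pw: "\<And>a. a \<in> Ob A \<Longrightarrow>
      is_colimit B J \<lparr>FO = \<lambda>d. FO (FO F d) a, FA = \<lambda>m. fst (snd (FA F m)) a\<rparr>
        (FO G a) (\<lambda>d. fst (snd (\<delta> d)) a)"
  shows "is_colimit (functor_cat A B) J F G \<delta>"
proof (rule colimitI[OF coc])
  let ?P = "functor_cat A B"
  let ?F = "\<lambda>a. \<lparr>FO = \<lambda>d. FO (FO F d) a, FA = \<lambda>m. fst (snd (FA F m)) a\<rparr>"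
  have HomP: "\<eta> \<in> Hom ?P X Y \<longleftrightarrow> (\<exists>\<theta>. \<eta> = (X, \<theta>, Y) \<and> X \<in> Ob ?P \<and> Y \<in> Ob ?P \<and> natural A B X Y \<theta> \<and>
      \<theta> \<in> extensional (Ob A))" for \<eta> X Y
    by (cases \<eta>) (auto simp: functor_cat_def Hom_def)
  have cmpP: "cmp ?P \<eta> \<theta> = (fst \<theta>, restrict (\<lambda>x. fst (snd \<eta>) x \<cdot>\<^bsub>B\<^esub> fst (snd \<theta>) x) (Ob A), snd (snd \<eta>))"
    for \<eta> \<theta>
    by (cases \<eta>; cases \<theta>) (simp add: functor_cat_def)
  have comp_at: "fst (snd \<eta>) a \<in> Hom B (FO X a) (FO Y a)" if "\<eta> \<in> Hom ?P X Y" "a \<in> Ob A" for \<eta> X Y a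
    using that by (auto simp: HomP natural_def)
  {
    fix Y h h' assume h: "h \<in> Hom ?P G Y" "h' \<in> Hom ?P G Y"
      and e: "\<And>d. d \<in> Ob J \<Longrightarrow> h \<cdot>\<^bsub>?P\<^esub> \<delta> d = h' \<cdot>\<^bsub>?P\<^esub> \<delta> d"
    obtain \<theta> \<theta>' where th: "h = (G, \<theta>, Y)" "h' = (G, \<theta>', Y)"
      "\<theta> \<in> extensional (Ob A)" "\<theta>' \<in> extensional (Ob A)" using h unfolding HomP by blast
    have "\<theta> a = \<theta>' a" if a: "a \<in> Ob A" for a
    proof (rule colimit_unique[OF F[OF a] pw[OF a]])
      show "\<theta> a \<in> Hom B (FO G a) (FO Y a)" "\<theta>' a \<in> Hom B (FO G a) (FO Y a)"
        using comp_at[OF h(1) a] comp_at[OF h(2) a] th by auto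
      fix d assume "d \<in> Ob J"
      from e[OF this] have "restrict (\<lambda>x. \<theta> x \<cdot>\<^bsub>B\<^esub> fst (snd (\<delta> d)) x) (Ob A) a =
          restrict (\<lambda>x. \<theta>' x \<cdot>\<^bsub>B\<^esub> fst (snd (\<delta> d)) x) (Ob A) a"
        unfolding cmpP th by simp
      then show "\<theta> a \<cdot>\<^bsub>B\<^esub> fst (snd (\<delta> d)) a = \<theta>' a \<cdot>\<^bsub>B\<^esub> fst (snd (\<delta> d)) a" using a by simp
    qed
    then have "\<theta> = \<theta>'" using th(3,4) by (rule extensionalityI[rotated 2])
    then show "h = h'" using th by simp
  }
  fix Y \<epsilon> assume ce: "is_cocone ?P J F Y \<epsilon>"
  have YP: "Y \<in> Ob ?P" and GP: "G \<in> Ob ?P" using ce coc by (auto simp: is_cocone_def)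
  then have Yf: "is_functor A B Y" and Gf: "is_functor A B G" by (auto simp: functor_cat_def)
  have "\<exists>h \<in> Hom B (FO G a) (FO Y a). \<forall>d \<in> Ob J. h \<cdot>\<^bsub>B\<^esub> fst (snd (\<delta> d)) a = fst (snd (\<epsilon> d)) a"
    if a: "a \<in> Ob A" for a
  proof (rule colimit_ex[OF pw[OF a]])
    show "is_cocone B J (?F a) (FO Y a) (\<lambda>d. fst (snd (\<epsilon> d)) a)"
      unfolding is_cocone_def
    proof (intro conjI ballI)
      show "FO Y a \<in> Ob B" using functor_Ob[OF Yf a] .
      show "fst (snd (\<epsilon> d)) a \<in> Hom B (FO (?F a) d) (FO Y a)" if "d \<in> Ob J" for d
        using comp_at[OF cocone_Hom[OF ce that] a] by simp
      fix m assume "m \<in> Ar J"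
      then have "\<epsilon> (cd J m) \<cdot>\<^bsub>?P\<^esub> FA F m = \<epsilon> (dm J m)" using ce by (simp add: is_cocone_def)
      then show "fst (snd (\<epsilon> (cd J m))) a \<cdot>\<^bsub>B\<^esub> FA (?F a) m = fst (snd (\<epsilon> (dm J m))) a"
        unfolding cmpP by (subst (asm) eq_commute) (simp add: a)
    qed
  qed
  then obtain h where h: "\<And>a. a \<in> Ob A \<Longrightarrow> h a \<in> Hom B (FO G a) (FO Y a)"
    and hd: "\<And>a d. a \<in> Ob A \<Longrightarrow> d \<in> Ob J \<Longrightarrow> h a \<cdot>\<^bsub>B\<^esub> fst (snd (\<delta> d)) a = fst (snd (\<epsilon> d)) a"
    by metis
  have natD: "fst (snd (\<delta> d)) y \<cdot>\<^bsub>B\<^esub> FA (FO F d) f = FA G f \<cdot>\<^bsub>B\<^esub> fst (snd (\<delta> d)) x"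
     "fst (snd (\<epsilon> d)) y \<cdot>\<^bsub>B\<^esub> FA (FO F d) f = FA Y f \<cdot>\<^bsub>B\<^esub> fst (snd (\<epsilon> d)) x"
     "FA (FO F d) f \<in> Hom B (FO (FO F d) x) (FO (FO F d) y)"
    if "d \<in> Ob J" "f \<in> Hom A x y" for d f x y
  proof -
    have 1: "natural A B (FO F d) G (fst (snd (\<delta> d)))" and 2: "natural A B (FO F d) Y (fst (snd (\<epsilon> d)))"
      using cocone_Hom[OF coc that(1)] cocone_Hom[OF ce that(1)] by (auto simp: HomP)
    show "fst (snd (\<delta> d)) y \<cdot>\<^bsub>B\<^esub> FA (FO F d) f = FA G f \<cdot>\<^bsub>B\<^esub> fst (snd (\<delta> d)) x"
      "fst (snd (\<epsilon> d)) y \<cdot>\<^bsub>B\<^esub> FA (FO F d) f = FA Y f \<cdot>\<^bsub>B\<^esub> fst (snd (\<epsilon> d)) x"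
      using natural_comm[OF 1 that(2)] natural_comm[OF 2 that(2)] .
    show "FA (FO F d) f \<in> Hom B (FO (FO F d) x) (FO (FO F d) y)"
      using 1 that(2) functor_Hom by (auto simp: natural_def)
  qed
  have hnat: "h y \<cdot>\<^bsub>B\<^esub> FA G f = FA Y f \<cdot>\<^bsub>B\<^esub> h x" if f: "f \<in> Hom A x y" for f x y
  proof -
    have xy: "x \<in> Ob A" "y \<in> Ob A" using Hom_Ob[OF _ f] functor_cats[OF Yf] by auto
    show ?thesis
    proof (rule colimit_unique[OF F[OF xy(1)] pw[OF xy(1)]])
      show "h y \<cdot>\<^bsub>B\<^esub> FA G f \<in> Hom B (FO G x) (FO Y y)"
        using comp_Hom[OF B functor_Hom[OF Gf f] h[OF xy(2)]] .
      show "FA Y f \<cdot>\<^bsub>B\<^esub> h x \<in> Hom B (FO G x) (FO Y y)"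
        using comp_Hom[OF B h[OF xy(1)] functor_Hom[OF Yf f]] .
      fix d assume d: "d \<in> Ob J"
      note D = comp_at[OF cocone_Hom[OF coc d]]
      have "(h y \<cdot>\<^bsub>B\<^esub> FA G f) \<cdot>\<^bsub>B\<^esub> fst (snd (\<delta> d)) x = h y \<cdot>\<^bsub>B\<^esub> (fst (snd (\<delta> d)) y \<cdot>\<^bsub>B\<^esub> FA (FO F d) f)"
        using comp_assoc[OF B D[OF xy(1)] functor_Hom[OF Gf f] h[OF xy(2)]] natD(1)[OF d f] by simp
      also have "\<dots> = fst (snd (\<epsilon> d)) y \<cdot>\<^bsub>B\<^esub> FA (FO F d) f"
        using comp_assoc[OF B natD(3)[OF d f] D[OF xy(2)] h[OF xy(2)]] hd[OF xy(2) d] by simp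
      also have "\<dots> = (FA Y f \<cdot>\<^bsub>B\<^esub> h x) \<cdot>\<^bsub>B\<^esub> fst (snd (\<delta> d)) x"
        using comp_assoc[OF B D[OF xy(1)] h[OF xy(1)] functor_Hom[OF Yf f]] hd[OF xy(1) d] natD(2)[OF d f]
        by simp
      finally show "(h y \<cdot>\<^bsub>B\<^esub> FA G f) \<cdot>\<^bsub>B\<^esub> fst (snd (\<delta> d)) x = (FA Y f \<cdot>\<^bsub>B\<^esub> h x) \<cdot>\<^bsub>B\<^esub> fst (snd (\<delta> d)) x" .
    qed
  qed
  have "category A" using functor_cats[OF Yf] by simp
  \<comment> \<open>The components are cut down to \<open>Ob A\<close>, since arrows of
    \<open>functor_cat\<close> are required to be extensional.\<close>
  then have "natural A B G Y (restrict h (Ob A))"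
    unfolding natural_def using Yf Gf h hnat[OF Ar_Hom] by (auto simp: category_def)
  then have k: "(G, restrict h (Ob A), Y) \<in> Hom ?P G Y" using GP YP by (auto simp: HomP)
  have "(G, restrict h (Ob A), Y) \<cdot>\<^bsub>?P\<^esub> \<delta> d = \<epsilon> d" if d: "d \<in> Ob J" for d
  proof -
    obtain \<theta> where th: "\<epsilon> d = (FO F d, \<theta>, Y)" "\<theta> \<in> extensional (Ob A)"
      using cocone_Hom[OF ce d] by (auto simp: HomP)
    have "fst (\<delta> d) = FO F d" using cocone_Hom[OF coc d] by (auto simp: HomP)
    then show ?thesis unfolding cmpP th(1) using th hd[OF _ d]
      by (auto simp: extensional_def restrict_def fun_eq_iff)
  qed
  then show "\<exists>h \<in> Hom ?P G Y. \<forall>d \<in> Ob J. h \<cdot>\<^bsub>?P\<^esub> \<delta> d = \<epsilon> d" using k by blast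
qed

section \<open>Filtered colimits of sets and presentable objects\<close>

lemma finite_less_regular:
  assumes "regular_cardinal r" "finite A"
  shows "|A| <o r"
  by (rule finite_ordLess_infinite)
    (use assms in \<open>simp_all add: regular_cardinal_def cinfinite_def card_order_on_well_order_on
      card_of_well_order_on Field_card_of\<close>)

text \<open>This and the next three lemmas extract cocones of finite subgraphs: a point, an upper
  bound, a completed span, a coequalized pair. Direct manipulations of the index category use just
  these; larger subgraphs enter through presentability.\<close>

lemma filtered_nonempty:
  assumes "filtered lam J" "regular_cardinal lam"
  shows "\<exists>c. c \<in> Ob J"
proof -
  show ?thesis
    using assms(1)[unfolded filtered_def, THEN conjunct2, rule_format, of "{}" "{}"]
    by (auto simp: finite_less_regular[OF assms(2)])
qed

lemma filtered_join:
  assumes "filtered lam J" "regular_cardinal lam" "x \<in> Ob J" "y \<in> Ob J"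
  shows "\<exists>z \<in> Ob J. \<exists>m n. m \<in> Hom J x z \<and> n \<in> Hom J y z"
proof -
  have "\<exists>c \<in> Ob J. \<exists>\<tau>. \<forall>s \<in> {x, y}. \<tau> s \<in> Hom J s c"
    using assms(1)[unfolded filtered_def, THEN conjunct2, rule_format, of "{x, y}" "{}"] assms(3,4)
    by (auto simp: finite_less_regular[OF assms(2)])
  then show ?thesis by auto
qed

lemma filtered_span:
  assumes "filtered lam J" "regular_cardinal lam" "m \<in> Hom J x y" "n \<in> Hom J x z"
  shows "\<exists>w p q. p \<in> Hom J y w \<and> q \<in> Hom J z w \<and> p \<cdot>\<^bsub>J\<^esub> m = q \<cdot>\<^bsub>J\<^esub> n"
proof -
  have J: "category J" using assms(1) by (simp add: filtered_def)
  have "|{x, y, z}| <o lam" "|{m, n}| <o lam"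
    by (simp_all add: finite_less_regular[OF assms(2)])
  moreover have "{x, y, z} \<subseteq> Ob J" "{m, n} \<subseteq> Ar J" "dm J ` {m, n} \<subseteq> {x, y, z}" "cd J ` {m, n} \<subseteq> {x, y, z}"
    using Hom_Ob[OF J assms(3)] Hom_Ob[OF J assms(4)] assms(3,4) by (auto simp: Hom_def)
  ultimately obtain w \<tau> where w: "\<forall>s \<in> {x, y, z}. \<tau> s \<in> Hom J s w"
      "\<forall>k \<in> {m, n}. \<tau> (cd J k) \<cdot>\<^bsub>J\<^esub> k = \<tau> (dm J k)"
    using assms(1) unfolding filtered_def by blast
  then have "\<tau> y \<in> Hom J y w" "\<tau> z \<in> Hom J z w" "\<tau> y \<cdot>\<^bsub>J\<^esub> m = \<tau> z \<cdot>\<^bsub>J\<^esub> n"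
    using HomD[OF assms(3)] HomD[OF assms(4)] by simp_all
  then show ?thesis by blast
qed

lemma filtered_coequalize:
  assumes "filtered lam J" "regular_cardinal lam" "m \<in> Hom J x y" "n \<in> Hom J x y"
  shows "\<exists>z p. p \<in> Hom J y z \<and> p \<cdot>\<^bsub>J\<^esub> m = p \<cdot>\<^bsub>J\<^esub> n"
proof -
  have J: "category J" using assms(1) by (simp add: filtered_def)
  have "|{x, y}| <o lam" "|{m, n}| <o lam"
    by (simp_all add: finite_less_regular[OF assms(2)])
  moreover have "{x, y} \<subseteq> Ob J" "{m, n} \<subseteq> Ar J" "dm J ` {m, n} \<subseteq> {x, y}" "cd J ` {m, n} \<subseteq> {x, y}"
    using Hom_Ob[OF J assms(3)] assms(3,4) by (auto simp: Hom_def)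
  ultimately obtain w \<tau> where w: "\<forall>s \<in> {x, y}. \<tau> s \<in> Hom J s w"
      "\<forall>k \<in> {m, n}. \<tau> (cd J k) \<cdot>\<^bsub>J\<^esub> k = \<tau> (dm J k)"
    using assms(1) unfolding filtered_def by blast
  then have "\<tau> y \<in> Hom J y w" "\<tau> y \<cdot>\<^bsub>J\<^esub> m = \<tau> y \<cdot>\<^bsub>J\<^esub> n"
    using HomD[OF assms(3)] HomD[OF assms(4)] by simp_all
  then show ?thesis by blast
qed

section \<open>Maps of sets and filtered colimits of sets\<close>

abbreviation ap :: "'a set \<times> ('a \<Rightarrow> 'a) \<times> 'a set \<Rightarrow> 'a \<Rightarrow> 'a" where
  "ap t \<equiv> fst (snd t)"

lemma Hom_set_cat: "t \<in> Hom (set_cat U) A B \<longleftrightarrow>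
    fst t = A \<and> snd (snd t) = B \<and> small U A \<and> small U B \<and> ap t \<in> A \<rightarrow>\<^sub>E B"
  by (cases t) (auto simp: set_cat_def Hom_def)

lemma comp_set_cat: "g \<cdot>\<^bsub>set_cat U\<^esub> f = (fst f, compose (fst f) (ap g) (ap f), snd (snd g))"
  by (cases f; cases g) (simp add: set_cat_def)

lemma set_cat_simps [simp]:
  "Ob (set_cat U) = {A. small U A}" "idt (set_cat U) A = (A, restrict id A, A)"
  by (simp_all add: set_cat_def)

lemma comp_set_cat_eqI:
  assumes "f \<in> Hom (set_cat U) A B" "g \<in> Hom (set_cat U) B C" "h \<in> Hom (set_cat U) A C"
    and "\<And>x. x \<in> A \<Longrightarrow> ap g (ap f x) = ap h x"
  shows "g \<cdot>\<^bsub>set_cat U\<^esub> f = h"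
proof -
  have "compose A (ap g) (ap f) = ap h"
    using assms(3,4) by (auto simp: Hom_set_cat compose_def PiE_def extensional_def)
  then show ?thesis using assms(1-3) unfolding comp_set_cat Hom_set_cat by (cases h) auto
qed

lemma ap_comp: "f \<in> Hom (set_cat U) A B \<Longrightarrow> x \<in> A \<Longrightarrow> ap (g \<cdot>\<^bsub>set_cat U\<^esub> f) x = ap g (ap f x)"
  by (auto simp: comp_set_cat Hom_set_cat compose_eq)

lemma ap_mem: "f \<in> Hom (set_cat U) A B \<Longrightarrow> x \<in> A \<Longrightarrow> ap f x \<in> B"
  by (auto simp: Hom_set_cat)

lemma set_map_eqI:
  assumes "f \<in> Hom (set_cat U) A B" "g \<in> Hom (set_cat U) A B" "\<And>x. x \<in> A \<Longrightarrow> ap f x = ap g x"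
  shows "f = g"
proof -
  have "ap f = ap g" using assms by (auto simp: Hom_set_cat PiE_def intro: extensionalityI)
  then show ?thesis using assms(1,2) unfolding Hom_set_cat by (cases f; cases g) auto
qed

lemma category_set_cat: "category (set_cat (U :: 'u rel) :: ('b set, 'b set \<times> ('b \<Rightarrow> 'b) \<times> 'b set) cat)"
proof -
  have id: "(A, restrict id A, A) \<in> Hom (set_cat U) A A" if "small U A" for A :: "'b set"
    using that by (auto simp: Hom_set_cat)
  have cmp: "g \<cdot>\<^bsub>set_cat U\<^esub> f \<in> Hom (set_cat U) A C"
    if "f \<in> Hom (set_cat U) A B" "g \<in> Hom (set_cat U) B C"
    for f g :: "'b set \<times> ('b \<Rightarrow> 'b) \<times> 'b set" and A B C
    using that by (auto simp: Hom_set_cat comp_set_cat compose_def)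
  have obs: "small U A \<and> small U B" if "f \<in> Hom (set_cat U) A B"
    for f :: "'b set \<times> ('b \<Rightarrow> 'b) \<times> 'b set" and A B :: "'b set"
    using that by (auto simp: Hom_set_cat)
  show ?thesis
    unfolding category_def
  proof (intro conjI ballI impI)
    fix f :: "'b set \<times> ('b \<Rightarrow> 'b) \<times> 'b set" assume "f \<in> Ar (set_cat U)"
    then have f: "f \<in> Hom (set_cat U) (dm (set_cat U) f) (cd (set_cat U) f)" by (rule Ar_Hom)
    show "dm (set_cat U) f \<in> Ob (set_cat U)" "cd (set_cat U) f \<in> Ob (set_cat U)" using obs[OF f] by auto
    have i: "idt (set_cat U) (dm (set_cat U) f) \<in> Hom (set_cat U) (dm (set_cat U) f) (dm (set_cat U) f)"
      "idt (set_cat U) (cd (set_cat U) f) \<in> Hom (set_cat U) (cd (set_cat U) f) (cd (set_cat U) f)"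
      using id obs[OF f] by auto
    show "f \<cdot>\<^bsub>set_cat U\<^esub> idt (set_cat U) (dm (set_cat U) f) = f"
      by (rule comp_set_cat_eqI[OF i(1) f f]) simp
    show "idt (set_cat U) (cd (set_cat U) f) \<cdot>\<^bsub>set_cat U\<^esub> f = f"
      by (rule comp_set_cat_eqI[OF f i(2) f]) (use ap_mem[OF f] in simp)
    fix g assume "g \<in> Ar (set_cat U)" and e: "dm (set_cat U) g = cd (set_cat U) f"
    then have g: "g \<in> Hom (set_cat U) (cd (set_cat U) f) (cd (set_cat U) g)" by (simp add: Hom_def)
    show "g \<cdot>\<^bsub>set_cat U\<^esub> f \<in> Hom (set_cat U) (dm (set_cat U) f) (cd (set_cat U) g)"
      using cmp[OF f g] .
    fix h assume "h \<in> Ar (set_cat U)" and e': "dm (set_cat U) h = cd (set_cat U) g"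
    then have h: "h \<in> Hom (set_cat U) (cd (set_cat U) g) (cd (set_cat U) h)" by (simp add: Hom_def)
    show "h \<cdot>\<^bsub>set_cat U\<^esub> (g \<cdot>\<^bsub>set_cat U\<^esub> f) = (h \<cdot>\<^bsub>set_cat U\<^esub> g) \<cdot>\<^bsub>set_cat U\<^esub> f"
      by (rule comp_set_cat_eqI[OF cmp[OF f g] h cmp[OF f cmp[OF g h]]])
        (simp add: ap_comp[OF f] ap_comp[OF g] ap_mem[OF f])
  next
    fix A :: "'b set" assume "A \<in> Ob (set_cat U)"
    then show "idt (set_cat U) A \<in> Hom (set_cat U) A A" using id by simp
  qed
qed

text \<open>Representatives of one element at different stages are first moved to a common stage by
  \<open>filtered_join\<close>; there \<open>inj\<close> makes them equal further on. Hence the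
  values prescribed by a cocone do not depend on the representative, although \<open>inj\<close>
  speaks of a single stage.\<close>

lemma set_filtered_colimitI:
  assumes J: "filtered lam J" and lam: "regular_cardinal lam"
    and F: "is_functor J (set_cat U) F" and coc: "is_cocone (set_cat U) J F X \<delta>"
    and sur: "\<And>x. x \<in> X \<Longrightarrow> \<exists>d \<in> Ob J. \<exists>y \<in> FO F d. ap (\<delta> d) y = x"
    and inj: "\<And>d u v. d \<in> Ob J \<Longrightarrow> u \<in> FO F d \<Longrightarrow> v \<in> FO F d \<Longrightarrow> ap (\<delta> d) u = ap (\<delta> d) v \<Longrightarrow>
      \<exists>e. \<exists>m \<in> Hom J d e. ap (FA F m) u = ap (FA F m) v"
  shows "is_colimit (set_cat U) J F X \<delta>"
proof (rule colimitI[OF coc])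
  have Jc: "category J" using J by (simp add: filtered_def)
  note \<delta> = cocone_Hom[OF coc]
  {
    fix Y h h' assume h: "h \<in> Hom (set_cat U) X Y" "h' \<in> Hom (set_cat U) X Y"
      and e: "\<And>d. d \<in> Ob J \<Longrightarrow> h \<cdot>\<^bsub>set_cat U\<^esub> \<delta> d = h' \<cdot>\<^bsub>set_cat U\<^esub> \<delta> d"
    show "h = h'"
    proof (rule set_map_eqI[OF h])
      fix x assume "x \<in> X"
      then obtain d y where d: "d \<in> Ob J" "y \<in> FO F d" "ap (\<delta> d) y = x" using sur by blast
      then show "ap h x = ap h' x"
        using e[OF d(1)] ap_comp[OF \<delta>[OF d(1)] d(2), of h] ap_comp[OF \<delta>[OF d(1)] d(2), of h'] by simp
    qed
  }
  fix Y \<epsilon> assume ce: "is_cocone (set_cat U) J F Y \<epsilon>"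
  note \<epsilon> = cocone_Hom[OF ce]
  have shift: "ap (\<delta> e) (ap (FA F m) y) = ap (\<delta> d) y" "ap (\<epsilon> e) (ap (FA F m) y) = ap (\<epsilon> d) y"
    if "m \<in> Hom J d e" "y \<in> FO F d" for m d e y
    using ap_comp[OF functor_Hom[OF F that(1)] that(2), of "\<delta> e"]
      ap_comp[OF functor_Hom[OF F that(1)] that(2), of "\<epsilon> e"]
      cocone_comm[OF coc that(1)] cocone_comm[OF ce that(1)] by simp_all
  have wd: "ap (\<epsilon> d) u = ap (\<epsilon> e) v" if H: "d \<in> Ob J" "e \<in> Ob J" "u \<in> FO F d" "v \<in> FO F e" "ap (\<delta> d) u = ap (\<delta> e) v"
    for d e u v
  proof -
    obtain z m n where z: "z \<in> Ob J" "m \<in> Hom J d z" "n \<in> Hom J e z"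
      using filtered_join[OF J lam H(1,2)] by blast
    let ?u = "ap (FA F m) u" and ?v = "ap (FA F n) v"
    have uv: "?u \<in> FO F z" "?v \<in> FO F z"
      using ap_mem[OF functor_Hom[OF F z(2)]] ap_mem[OF functor_Hom[OF F z(3)]] H by auto
    have "ap (\<delta> z) ?u = ap (\<delta> z) ?v" using shift z H by simp
    then obtain w k where k: "k \<in> Hom J z w" "ap (FA F k) ?u = ap (FA F k) ?v"
      using inj[OF z(1) uv] by blast
    then have "ap (\<epsilon> z) ?u = ap (\<epsilon> z) ?v" using shift(2)[OF k(1)] uv by metis
    then show ?thesis using shift z H by simp
  qed
  have ob: "small U X" "small U Y" using coc ce by (auto simp: is_cocone_def)
  \<comment> \<open>The value at \<open>x\<close> is constrained by all representatives at once, so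
    that the function obtained by choice satisfies the equation for each of them.\<close>
  have "\<exists>z \<in> Y. \<forall>d \<in> Ob J. \<forall>y \<in> FO F d. ap (\<delta> d) y = x \<longrightarrow> ap (\<epsilon> d) y = z" if "x \<in> X" for x
  proof -
    obtain d y where d: "d \<in> Ob J" "y \<in> FO F d" "ap (\<delta> d) y = x" using sur[OF \<open>x \<in> X\<close>] by blast
    have "\<forall>d' \<in> Ob J. \<forall>y' \<in> FO F d'. ap (\<delta> d') y' = x \<longrightarrow> ap (\<epsilon> d') y' = ap (\<epsilon> d) y"
      using wd[OF _ d(1) _ d(2)] unfolding d(3) by blast
    then show ?thesis using ap_mem[OF \<epsilon>[OF d(1)] d(2)] by blast
  qed
  then obtain f where f: "\<And>x. x \<in> X \<Longrightarrow> f x \<in> Y"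
    "\<And>x d y. x \<in> X \<Longrightarrow> d \<in> Ob J \<Longrightarrow> y \<in> FO F d \<Longrightarrow> ap (\<delta> d) y = x \<Longrightarrow> ap (\<epsilon> d) y = f x" by metis
  let ?h = "(X, restrict f X, Y)"
  have h: "?h \<in> Hom (set_cat U) X Y" using ob f by (auto simp: Hom_set_cat)
  have "?h \<cdot>\<^bsub>set_cat U\<^esub> \<delta> d = \<epsilon> d" if "d \<in> Ob J" for d
    by (rule comp_set_cat_eqI[OF \<delta>[OF that] h \<epsilon>[OF that]]) (use f(2)[OF ap_mem[OF \<delta>[OF that]] that _ refl] ap_mem[OF \<delta>[OF that]] in auto)
  then show "\<exists>h \<in> Hom (set_cat U) X Y. \<forall>d \<in> Ob J. h \<cdot>\<^bsub>set_cat U\<^esub> \<delta> d = \<epsilon> d" using h by blast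
qed

text \<open>The union \<open>?S\<close> of the images of the legs is again the vertex of a cocone.
  The induced map from \<open>X\<close> to \<open>?S\<close>, followed by the inclusion, fixes all
  legs and so is the identity of \<open>X\<close>; every element therefore lies in
  \<open>?S\<close>.\<close>

lemma set_colimit_surj:
  assumes F: "is_functor J (set_cat U) F" and col: "is_colimit (set_cat U) J F X \<delta>" and x: "x \<in> X"
  shows "\<exists>d \<in> Ob J. \<exists>y \<in> FO F d. ap (\<delta> d) y = x"
proof -
  note coc = colimit_cocone[OF col]
  note \<delta> = cocone_Hom[OF coc]
  have Jc: "category J" using functor_cats[OF F] by simp
  let ?S = "{x \<in> X. \<exists>d \<in> Ob J. \<exists>y \<in> FO F d. ap (\<delta> d) y = x}"
  have X: "small U X" using coc by (simp add: is_cocone_def)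
  then have S: "small U ?S" unfolding small_def
    by (rule ordLeq_ordLess_trans[rotated]) (auto intro: card_of_mono1)
  let ?\<epsilon> = "\<lambda>d. (FO F d, ap (\<delta> d), ?S)"
  have \<epsilon>: "?\<epsilon> d \<in> Hom (set_cat U) (FO F d) ?S" if "d \<in> Ob J" for d
  proof -
    have "ap (\<delta> d) \<in> FO F d \<rightarrow>\<^sub>E X" "small U (FO F d)" using \<delta>[OF that] by (auto simp: Hom_set_cat)
    then show ?thesis unfolding Hom_set_cat using that S by (auto simp: PiE_def extensional_def)
  qed
  have "is_cocone (set_cat U) J F ?S ?\<epsilon>"
    unfolding is_cocone_def
  proof (intro conjI ballI)
    fix m assume "m \<in> Ar J"
    then have m: "m \<in> Hom J (dm J m) (cd J m)" by (rule Ar_Hom)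
    then have ob: "dm J m \<in> Ob J" "cd J m \<in> Ob J" using Hom_Ob[OF Jc m] by auto
    show "?\<epsilon> (cd J m) \<cdot>\<^bsub>set_cat U\<^esub> FA F m = ?\<epsilon> (dm J m)"
    proof (rule comp_set_cat_eqI[OF functor_Hom[OF F m] \<epsilon>[OF ob(2)] \<epsilon>[OF ob(1)]])
      fix y assume "y \<in> FO F (dm J m)"
      then show "ap (?\<epsilon> (cd J m)) (ap (FA F m) y) = ap (?\<epsilon> (dm J m)) y"
        using ap_comp[OF functor_Hom[OF F m], of y "\<delta> (cd J m)"] cocone_comm[OF coc m] by simp
    qed
  qed (use S \<epsilon> in auto)
  then obtain h where h: "h \<in> Hom (set_cat U) X ?S" "\<forall>d \<in> Ob J. h \<cdot>\<^bsub>set_cat U\<^esub> \<delta> d = ?\<epsilon> d"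
    using colimit_ex[OF col] by blast
  let ?i = "(?S, restrict id ?S, X)"
  have i: "?i \<in> Hom (set_cat U) ?S X" using S X by (auto simp: Hom_set_cat)
  have ih: "?i \<cdot>\<^bsub>set_cat U\<^esub> h \<in> Hom (set_cat U) X X" by (rule comp_Hom[OF category_set_cat h(1) i])
  have id: "idt (set_cat U) X \<in> Hom (set_cat U) X X" using X by (intro idt_Hom category_set_cat) simp
  have "?i \<cdot>\<^bsub>set_cat U\<^esub> h = idt (set_cat U) X"
  proof (rule colimit_unique[OF F col ih id])
    fix d assume d: "d \<in> Ob J"
    have "(?i \<cdot>\<^bsub>set_cat U\<^esub> h) \<cdot>\<^bsub>set_cat U\<^esub> \<delta> d = ?i \<cdot>\<^bsub>set_cat U\<^esub> ?\<epsilon> d"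
      using comp_assoc[OF category_set_cat \<delta>[OF d] h(1) i] h(2) d by simp
    also have "\<dots> = \<delta> d"
      by (rule comp_set_cat_eqI[OF \<epsilon>[OF d] i \<delta>[OF d]]) (use ap_mem[OF \<epsilon>[OF d]] in simp)
    finally show "(?i \<cdot>\<^bsub>set_cat U\<^esub> h) \<cdot>\<^bsub>set_cat U\<^esub> \<delta> d = idt (set_cat U) X \<cdot>\<^bsub>set_cat U\<^esub> \<delta> d"
      using comp_idl[OF category_set_cat \<delta>[OF d]] by simp
  qed
  then have "ap ?i (ap h x) = x" using ap_comp[OF h(1) x, of ?i] x by simp
  then show ?thesis using ap_mem[OF h(1) x] by auto
qed

text \<open>To separate two elements \<open>u\<close>, \<open>v\<close> of \<open>F d\<close> that are not identified at any later stage, map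
  an element of \<open>F e\<close> to \<open>v\<close> if it is eventually equal to \<open>v\<close> and to \<open>u\<close> otherwise.\<close>

lemma set_filtered_colimit_inj:
  assumes J: "filtered lam J" and lam: "regular_cardinal lam"
    and F: "is_functor J (set_cat U) F" and col: "is_colimit (set_cat U) J F X \<delta>"
    and d: "d \<in> Ob J" and u: "u \<in> FO F d" and v: "v \<in> FO F d" and eq: "ap (\<delta> d) u = ap (\<delta> d) v"
  shows "\<exists>e. \<exists>m \<in> Hom J d e. ap (FA F m) u = ap (FA F m) v"
proof (rule ccontr)
  assume non: "\<not> ?thesis"
  note coc = colimit_cocone[OF col]
  note \<delta> = cocone_Hom[OF coc]
  have Jc: "category J" using functor_cats[OF F] by simp
  have Fc: "ap (FA F (n \<cdot>\<^bsub>J\<^esub> m)) y = ap (FA F n) (ap (FA F m) y)"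
    if "m \<in> Hom J a b" "n \<in> Hom J b c" "y \<in> FO F a" for m n a b c y
    using functor_comp[OF F that(1,2)] ap_comp[OF functor_Hom[OF F that(1)] that(3)] by simp
  define R where "R e x \<longleftrightarrow> (\<exists>k m n. m \<in> Hom J e k \<and> n \<in> Hom J d k \<and> ap (FA F m) x = ap (FA F n) v)" for e x
  let ?Y = "{u, v}"
  let ?\<epsilon> = "\<lambda>e. (FO F e, restrict (\<lambda>x. if R e x then v else u) (FO F e), ?Y)"
  have "small U (FO F d)" using functor_Ob[OF F d] by simp
  moreover have "?Y \<subseteq> FO F d" using u v by simp
  ultimately have Y: "small U ?Y" unfolding small_def
    by (metis card_of_mono1 ordLeq_ordLess_trans)
  have \<epsilon>: "?\<epsilon> e \<in> Hom (set_cat U) (FO F e) ?Y" if "e \<in> Ob J" for e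
    using functor_Ob[OF F that] Y by (auto simp: Hom_set_cat)
  have Rm: "R b (ap (FA F m) y) \<longleftrightarrow> R a y" if m: "m \<in> Hom J a b" and y: "y \<in> FO F a" for m a b y
  proof
    assume "R b (ap (FA F m) y)"
    then obtain k p n where k: "p \<in> Hom J b k" "n \<in> Hom J d k" "ap (FA F p) (ap (FA F m) y) = ap (FA F n) v"
      unfolding R_def by blast
    then show "R a y" unfolding R_def using Fc[OF m k(1) y] comp_Hom[OF Jc m k(1)] by metis
  next
    assume "R a y"
    then obtain k p n where k: "p \<in> Hom J a k" "n \<in> Hom J d k" "ap (FA F p) y = ap (FA F n) v"
      unfolding R_def by blast
    \<comment> \<open>Closing the span formed by \<open>m\<close> and the arrow that witnesses the
      eventual equality transports this equality beyond \<open>b\<close>.\<close>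
    obtain w q r where w: "q \<in> Hom J b w" "r \<in> Hom J k w" "q \<cdot>\<^bsub>J\<^esub> m = r \<cdot>\<^bsub>J\<^esub> p"
      using filtered_span[OF J lam m k(1)] by blast
    have "ap (FA F q) (ap (FA F m) y) = ap (FA F (r \<cdot>\<^bsub>J\<^esub> n)) v"
      using Fc[OF m w(1) y] Fc[OF k(1) w(2) y] Fc[OF k(2) w(2) v] w(3) k(3) by simp
    then show "R b (ap (FA F m) y)" unfolding R_def using w comp_Hom[OF Jc k(2) w(2)] by blast
  qed
  have "is_cocone (set_cat U) J F ?Y ?\<epsilon>"
    unfolding is_cocone_def
  proof (intro conjI ballI)
    fix m assume "m \<in> Ar J"
    then have m: "m \<in> Hom J (dm J m) (cd J m)" by (rule Ar_Hom)
    then have ob: "dm J m \<in> Ob J" "cd J m \<in> Ob J" using Hom_Ob[OF Jc m] by auto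
    show "?\<epsilon> (cd J m) \<cdot>\<^bsub>set_cat U\<^esub> FA F m = ?\<epsilon> (dm J m)"
      by (rule comp_set_cat_eqI[OF functor_Hom[OF F m] \<epsilon>[OF ob(2)] \<epsilon>[OF ob(1)]])
        (use Rm[OF m] ap_mem[OF functor_Hom[OF F m]] in simp)
  qed (use Y \<epsilon> in auto)
  then obtain h where h: "\<forall>d \<in> Ob J. h \<cdot>\<^bsub>set_cat U\<^esub> \<delta> d = ?\<epsilon> d"
    using colimit_ex[OF col] by blast
  have ev: "ap h (ap (\<delta> d) x) = (if R d x then v else u)" if "x \<in> FO F d" for x
    using ap_comp[OF \<delta>[OF d] that, of h] h d that by simp
  have "R d v" unfolding R_def using idt_Hom[OF Jc d] by blast
  moreover have "\<not> R d u"
  proof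
    assume "R d u"
    then obtain k m n where k: "m \<in> Hom J d k" "n \<in> Hom J d k" "ap (FA F m) u = ap (FA F n) v"
      unfolding R_def by blast
    \<comment> \<open>\<open>m\<close> and \<open>n\<close> both start at \<open>d\<close>.
      Coequalizing them turns an equality of two different transports into one along a single arrow,
      which \<open>non\<close> excludes.\<close>
    obtain z p where z: "p \<in> Hom J k z" "p \<cdot>\<^bsub>J\<^esub> m = p \<cdot>\<^bsub>J\<^esub> n"
      using filtered_coequalize[OF J lam k(1,2)] by blast
    have "ap (FA F (p \<cdot>\<^bsub>J\<^esub> m)) u = ap (FA F (p \<cdot>\<^bsub>J\<^esub> m)) v"
      using Fc[OF k(1) z(1) u] Fc[OF k(2) z(1) v] k(3) z(2) by simp
    then show False using non comp_Hom[OF Jc k(1) z(1)] by blast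
  qed
  ultimately have "u = v" using ev[OF u] ev[OF v] eq by metis
  then show False using non idt_Hom[OF Jc d] by blast
qed

section \<open>Hom-functors and presentable objects\<close>

lemma hom_functor_simps [simp]:
  "FO (hom_functor C A) X = Hom C A X"
  "FA (hom_functor C A) f =
    (Hom C A (dm C f), restrict (\<lambda>h. f \<cdot>\<^bsub>C\<^esub> h) (Hom C A (dm C f)), Hom C A (cd C f))"
  by (simp_all add: hom_functor_def)

lemma hom_functor_is_functor:
  assumes C: "category C" and s: "\<And>X. X \<in> Ob C \<Longrightarrow> small U (Hom C A X)"
  shows "is_functor C (set_cat U) (hom_functor C A)"
proof -
  have FA: "FA (hom_functor C A) f \<in> Hom (set_cat U) (Hom C A x) (Hom C A y)" if f: "f \<in> Hom C x y" for f x y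
    using HomD[OF f] s Hom_Ob[OF C f] comp_Hom[OF C _ f] by (auto simp: Hom_set_cat)
  show ?thesis
    unfolding is_functor_def
  proof (intro conjI ballI impI)
    fix f assume f: "f \<in> Ar C"
    then show "FA (hom_functor C A) f \<in> Hom (set_cat U) (FO (hom_functor C A) (dm C f)) (FO (hom_functor C A) (cd C f))"
      using FA[OF Ar_Hom[OF f]] by simp
    fix g assume g: "g \<in> Ar C" "dm C g = cd C f"
    have f': "f \<in> Hom C (dm C f) (cd C f)" and g': "g \<in> Hom C (cd C f) (cd C g)" using f g by (auto simp: Hom_def)
    show "FA (hom_functor C A) (g \<cdot>\<^bsub>C\<^esub> f) = FA (hom_functor C A) g \<cdot>\<^bsub>set_cat U\<^esub> FA (hom_functor C A) f"
    proof (rule comp_set_cat_eqI[symmetric, OF FA[OF f'] FA[OF g'] FA[OF comp_Hom[OF C f' g']]])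
      fix x assume "x \<in> Hom C A (dm C f)"
      then show "ap (FA (hom_functor C A) g) (ap (FA (hom_functor C A) f) x) = ap (FA (hom_functor C A) (g \<cdot>\<^bsub>C\<^esub> f)) x"
        using HomD[OF comp_Hom[OF C f' g']] comp_assoc[OF C _ f' g'] comp_Hom[OF C _ f'] g(2) by simp
    qed
  next
    fix x assume x: "x \<in> Ob C"
    then show "FO (hom_functor C A) x \<in> Ob (set_cat U)" using s by simp
    show "FA (hom_functor C A) (idt C x) = idt (set_cat U) (FO (hom_functor C A) x)"
      using HomD[OF idt_Hom[OF C x]] comp_idl[OF C] by (auto intro!: restrict_ext)
  qed (use C category_set_cat in auto)
qed

lemma functor_cocone:
  assumes G: "is_functor C B G" and D: "is_functor J C D" and c: "is_cocone C J D X \<delta>"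
  shows "is_cocone B J (functr_comp G D) (FO G X) (\<lambda>d. FA G (\<delta> d))"
  unfolding is_cocone_def
proof (intro conjI ballI)
  have J: "category J" using functor_cats[OF D] by simp
  show "FO G X \<in> Ob B" using functor_Ob[OF G] c by (simp add: is_cocone_def)
  show "FA G (\<delta> d) \<in> Hom B (FO (functr_comp G D) d) (FO G X)" if "d \<in> Ob J" for d
    using functor_Hom[OF G cocone_Hom[OF c that]] by simp
  fix m assume "m \<in> Ar J"
  then have m: "m \<in> Hom J (dm J m) (cd J m)" by (rule Ar_Hom)
  show "FA G (\<delta> (cd J m)) \<cdot>\<^bsub>B\<^esub> FA (functr_comp G D) m = FA G (\<delta> (dm J m))"
    using functor_comp[OF G functor_Hom[OF D m] cocone_Hom[OF c]] Hom_Ob[OF J m] cocone_comm[OF c m]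
    by simp
qed

text \<open>Presentability makes \<open>Hom C A X\<close> a colimit of the sets
  \<open>Hom C A (FO D d)\<close>, and a colimit of sets is covered by its stages.
  \<open>presentable_eq\<close> is the corresponding injectivity, and \<open>presentableI\<close>
  turns the two halves back into presentability.\<close>

lemma presentable_factor:
  fixes U :: "'u rel" and J :: "('u, 'u) cat"
  assumes C: "category C" "locally_small U C" and A: "presentable U lam C A"
    and J: "small_category U J" "filtered lam J" and D: "is_functor J C D" and col: "is_colimit C J D X \<delta>"
    and f: "f \<in> Hom C A X"
  shows "\<exists>d \<in> Ob J. \<exists>g \<in> Hom C A (FO D d). \<delta> d \<cdot>\<^bsub>C\<^esub> g = f"
proof -
  have "A \<in> Ob C" using A by (simp add: presentable_def)
  then have F: "is_functor J (set_cat U) (functr_comp (hom_functor C A) D)"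
    using C(2) by (intro is_functor_comp[OF D hom_functor_is_functor[OF C(1)]]) (simp add: locally_small_def)
  have S: "is_colimit (set_cat U) J (functr_comp (hom_functor C A) D)
          (FO (hom_functor C A) X) (\<lambda>d. FA (hom_functor C A) (\<delta> d))"
    using A[unfolded presentable_def, THEN conjunct2, rule_format, OF J D col] .
  obtain d g where "d \<in> Ob J" "g \<in> Hom C A (FO D d)" "ap (FA (hom_functor C A) (\<delta> d)) g = f"
    using set_colimit_surj[OF F S, of f] f by auto
  then show ?thesis using HomD[OF cocone_Hom[OF colimit_cocone[OF col]]] by force
qed

lemma presentable_eq:
  fixes U :: "'u rel" and J :: "('u, 'u) cat"
  assumes C: "category C" "locally_small U C" and lam: "regular_cardinal lam" and A: "presentable U lam C A"
    and J: "small_category U J" "filtered lam J" and D: "is_functor J C D" and col: "is_colimit C J D X \<delta>"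
    and d: "d \<in> Ob J" and u: "u \<in> Hom C A (FO D d)" "v \<in> Hom C A (FO D d)" and e: "\<delta> d \<cdot>\<^bsub>C\<^esub> u = \<delta> d \<cdot>\<^bsub>C\<^esub> v"
  shows "\<exists>e. \<exists>m \<in> Hom J d e. FA D m \<cdot>\<^bsub>C\<^esub> u = FA D m \<cdot>\<^bsub>C\<^esub> v"
proof -
  have "A \<in> Ob C" using A by (simp add: presentable_def)
  then have F: "is_functor J (set_cat U) (functr_comp (hom_functor C A) D)"
    using C(2) by (intro is_functor_comp[OF D hom_functor_is_functor[OF C(1)]]) (simp add: locally_small_def)
  have S: "is_colimit (set_cat U) J (functr_comp (hom_functor C A) D)
          (FO (hom_functor C A) X) (\<lambda>d. FA (hom_functor C A) (\<delta> d))"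
    using A[unfolded presentable_def, THEN conjunct2, rule_format, OF J D col] .
  have dd: "dm C (\<delta> d) = FO D d" using HomD[OF cocone_Hom[OF colimit_cocone[OF col] d]] by simp
  have "\<exists>e. \<exists>m \<in> Hom J d e. ap (FA (hom_functor C A) (FA D m)) u = ap (FA (hom_functor C A) (FA D m)) v"
    using set_filtered_colimit_inj[OF J(2) lam F S d, of u v] u e dd by simp
  then show ?thesis using HomD[OF functor_Hom[OF D]] u by force
qed

lemma presentableI:
  fixes U :: "'u rel"
  assumes C: "category C" "locally_small U C" and lam: "regular_cardinal lam" and A: "A \<in> Ob C"
    and factor: "\<And>(J :: ('u, 'u) cat) D X \<delta> f. small_category U J \<Longrightarrow> filtered lam J \<Longrightarrow> is_functor J C D \<Longrightarrow>
      is_colimit C J D X \<delta> \<Longrightarrow> f \<in> Hom C A X \<Longrightarrow> \<exists>d \<in> Ob J. \<exists>g \<in> Hom C A (FO D d). \<delta> d \<cdot>\<^bsub>C\<^esub> g = f"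
    and eq: "\<And>(J :: ('u, 'u) cat) D X \<delta> d u v. small_category U J \<Longrightarrow> filtered lam J \<Longrightarrow> is_functor J C D \<Longrightarrow>
      is_colimit C J D X \<delta> \<Longrightarrow> d \<in> Ob J \<Longrightarrow> u \<in> Hom C A (FO D d) \<Longrightarrow> v \<in> Hom C A (FO D d) \<Longrightarrow>
      \<delta> d \<cdot>\<^bsub>C\<^esub> u = \<delta> d \<cdot>\<^bsub>C\<^esub> v \<Longrightarrow> \<exists>e. \<exists>m \<in> Hom J d e. FA D m \<cdot>\<^bsub>C\<^esub> u = FA D m \<cdot>\<^bsub>C\<^esub> v"
  shows "presentable U lam C A"
  unfolding presentable_def
proof (intro conjI allI impI)
  fix J :: "('u, 'u) cat" and D X \<delta>
  assume J: "small_category U J" "filtered lam J" and D: "is_functor J C D" and col: "is_colimit C J D X \<delta>"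
  have G: "is_functor C (set_cat U) (hom_functor C A)"
    using C(2) A by (intro hom_functor_is_functor[OF C(1)]) (simp add: locally_small_def)
  note \<delta> = cocone_Hom[OF colimit_cocone[OF col]]
  show "is_colimit (set_cat U) J (functr_comp (hom_functor C A) D)
          (FO (hom_functor C A) X) (\<lambda>d. FA (hom_functor C A) (\<delta> d))"
  proof (rule set_filtered_colimitI[OF J(2) lam is_functor_comp[OF D G] functor_cocone[OF G D colimit_cocone[OF col]]])
    fix x assume "x \<in> FO (hom_functor C A) X"
    then have "x \<in> Hom C A X" by simp
    from factor[OF J D col this] obtain d g where "d \<in> Ob J" "g \<in> Hom C A (FO D d)" "\<delta> d \<cdot>\<^bsub>C\<^esub> g = x"
      by blast
    then show "\<exists>d \<in> Ob J. \<exists>y \<in> FO (functr_comp (hom_functor C A) D) d. ap (FA (hom_functor C A) (\<delta> d)) y = x"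
      using HomD[OF \<delta>] by (intro bexI[of _ d] bexI[of _ g]) auto
  next
    fix d u v assume d: "d \<in> Ob J" and u: "u \<in> FO (functr_comp (hom_functor C A) D) d"
      "v \<in> FO (functr_comp (hom_functor C A) D) d"
      and e: "ap (FA (hom_functor C A) (\<delta> d)) u = ap (FA (hom_functor C A) (\<delta> d)) v"
    then obtain e m where "m \<in> Hom J d e" "FA D m \<cdot>\<^bsub>C\<^esub> u = FA D m \<cdot>\<^bsub>C\<^esub> v"
      using eq[OF J D col d, of u v] HomD[OF \<delta>[OF d]] by auto
    then show "\<exists>e. \<exists>m \<in> Hom J d e. ap (FA (functr_comp (hom_functor C A) D) m) u =
        ap (FA (functr_comp (hom_functor C A) D) m) v"
      using HomD[OF functor_Hom[OF D]] u by (intro exI[of _ e] bexI[of _ m]) auto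
  qed
qed (rule A)

section \<open>The localization\<close>

text \<open>\<open>zigzag\<close> tests only the final vertex for being an object. When the first
  string is empty, its vertex must be recognised as an object from the second string, which is where
  \<open>W \<subseteq> Ar C\<close> is used.\<close>

lemma zigzag_append: "zigzag C W X (p @ q) Z \<longleftrightarrow> (\<exists>Y. zigzag C W X p Y \<and> zigzag C W Y q Z)"
  if "category C" "W \<subseteq> Ar C"
proof (induction p arbitrary: X)
  case Nil
  have "X \<in> Ob C" if "zigzag C W X q Z" for X
    using that \<open>category C\<close> \<open>W \<subseteq> Ar C\<close>
    by (induction C W X q Z rule: zigzag.induct) (auto simp: category_def)
  then show ?case by auto
next
  case (Cons s p)
  then show ?case by (cases s) auto
qed

lemma zigzag_Ob:
  assumes "category C" "W \<subseteq> Ar C" "zigzag C W X p Y"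
  shows "X \<in> Ob C" "Y \<in> Ob C"
  using assms(3) zigzag_append[OF assms(1,2), of X p "[]" Y] zigzag_append[OF assms(1,2), of X "[]" p Y]
  by auto

text \<open>The relation behind \<open>zigzag_class\<close>. Both sides of every elementary step
  must be zigzags with the given endpoints, so a chain of steps stays inside one hom-set.\<close>

definition zeq :: "('o, 'm) cat \<Rightarrow> 'm set \<Rightarrow> 'o \<Rightarrow> 'o \<Rightarrow> 'm step list \<Rightarrow> 'm step list \<Rightarrow> bool" where
  "zeq C W X Y = equivclp (\<lambda>p q. zigzag C W X p Y \<and> zigzag C W X q Y \<and> zigzag_step C W p q)"

definition zz :: "('o, 'm) cat \<Rightarrow> 'm set \<Rightarrow> 'o \<Rightarrow> 'm step list \<Rightarrow> 'o \<Rightarrow> ('o, 'm) ho_arrow" where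
  "zz C W X p Y = (X, zigzag_class C W X p Y, Y)"

lemma zeq_refl: "zeq C W X Y p p"
  by (simp add: zeq_def)

lemma zeq_sym: "zeq C W X Y p q \<Longrightarrow> zeq C W X Y q p"
  unfolding zeq_def by (rule equivclp_sym)

lemma zeq_trans: "zeq C W X Y p q \<Longrightarrow> zeq C W X Y q r \<Longrightarrow> zeq C W X Y p r"
  unfolding zeq_def by (rule equivclp_trans)

lemma zeq_step: "zigzag C W X p Y \<Longrightarrow> zigzag C W X q Y \<Longrightarrow> zigzag_step C W p q \<Longrightarrow> zeq C W X Y p q"
  unfolding zeq_def by (intro r_into_equivclp) blast

lemma zigzag_class_zeq: "zigzag_class C W X p Y = {q. zigzag C W X q Y \<and> zeq C W X Y p q}"
  by (simp add: zigzag_class_def zeq_def)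

lemma zz_eq_iff:
  assumes "zigzag C W X p Y" "zigzag C W X q Y"
  shows "zz C W X p Y = zz C W X q Y \<longleftrightarrow> zeq C W X Y p q"
proof
  assume "zz C W X p Y = zz C W X q Y"
  then have "q \<in> zigzag_class C W X p Y" using assms zeq_refl by (auto simp: zz_def zigzag_class_zeq)
  then show "zeq C W X Y p q" by (simp add: zigzag_class_zeq)
next
  assume "zeq C W X Y p q"
  then show "zz C W X p Y = zz C W X q Y"
    by (auto simp: zz_def zigzag_class_zeq intro: zeq_trans zeq_sym)
qed

lemma zigzag_step_context:
  assumes "zigzag_step C W p q"
  shows "zigzag_step C W (l @ p @ r) (l @ q @ r)"
  using assms
proof (cases rule: zigzag_step.cases)
  case (1 x p' q')
  show ?thesis using zigzag_step.intros(1)[OF 1(3), of W "l @ p'" "q' @ r"] 1 by simp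
next
  case (2 f g p' q')
  show ?thesis using zigzag_step.intros(2)[OF 2(3-5), of W "l @ p'" "q' @ r"] 2 by simp
next
  case (3 w p' q')
  show ?thesis using zigzag_step.intros(3)[OF 3(3), of C "l @ p'" "q' @ r"] 3 by simp
next
  case (4 w p' q')
  show ?thesis using zigzag_step.intros(4)[OF 4(3), of C "l @ p'" "q' @ r"] 4 by simp
qed

lemma zeq_context:
  assumes C: "category C" "W \<subseteq> Ar C" and "zigzag C W X' l X" "zigzag C W Y r Y'" "zeq C W X Y p q"
  shows "zeq C W X' Y' (l @ p @ r) (l @ q @ r)"
  using assms(5) unfolding zeq_def
proof (induction rule: equivclp_induct)
  case base
  then show ?case by simp
next
  case (step y z)
  have 1: "zigzag C W X' (l @ u @ r) Y'" if "zigzag C W X u Y" for u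
    using that assms(3,4) by (auto simp: zigzag_append[OF C])
  have "zeq C W X' Y' (l @ y @ r) (l @ z @ r)"
    using step(2) zeq_step[OF 1 1 zigzag_step_context] by (auto intro: zeq_sym)
  with step(3)[folded zeq_def] show ?case unfolding zeq_def[symmetric] by (rule zeq_trans)
qed

lemma zeq_append:
  assumes "category C" "W \<subseteq> Ar C" "zigzag C W X p Y" "zigzag C W Y q' Z" "zeq C W X Y p p'" "zeq C W Y Z q q'"
  shows "zeq C W X Z (p @ q) (p' @ q')"
proof (rule zeq_trans)
  show "zeq C W X Z (p @ q) (p @ q')"
    using zeq_context[OF assms(1,2,3) _ assms(6), of "[]" Z] zigzag_Ob[OF assms(1,2,4)] by simp
  show "zeq C W X Z (p @ q') (p' @ q')"
    using zeq_context[OF assms(1,2) _ assms(4,5), of X "[]"] zigzag_Ob[OF assms(1,2,3)] by simp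
qed

lemma Ho_simps [simp]: "Ob (Ho C W) = Ob C" "idt (Ho C W) X = zz C W X [] X"
  by (simp_all add: Ho_def zz_def)

lemma Hom_Ho: "f \<in> Hom (Ho C W) X Y \<longleftrightarrow> (\<exists>p. zigzag C W X p Y \<and> f = zz C W X p Y)"
  by (auto simp: Ho_def Hom_def zz_def)

lemma zz_Hom: "zigzag C W X p Y \<Longrightarrow> zz C W X p Y \<in> Hom (Ho C W) X Y"
  by (auto simp: Hom_Ho)

text \<open>Composition in \<open>Ho\<close> is a union over all representatives. By the congruence
  property the classes in this union coincide, and the class of the concatenation is one of
  them.\<close>

lemma zz_comp:
  assumes "category C" "W \<subseteq> Ar C" "zigzag C W X p Y" "zigzag C W Y q Z"
  shows "zz C W Y q Z \<cdot>\<^bsub>Ho C W\<^esub> zz C W X p Y = zz C W X (p @ q) Z"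
proof -
  have "(\<Union>p' \<in> zigzag_class C W X p Y. \<Union>q' \<in> zigzag_class C W Y q Z. zigzag_class C W X (p' @ q') Z) =
      zigzag_class C W X (p @ q) Z" (is "?L = ?R")
  proof -
    have "zigzag_class C W X (p' @ q') Z = ?R"
      if "p' \<in> zigzag_class C W X p Y" "q' \<in> zigzag_class C W Y q Z" for p' q'
    proof -
      have H: "zigzag C W X p' Y" "zigzag C W Y q' Z" "zeq C W X Y p p'" "zeq C W Y Z q q'"
        using that by (auto simp: zigzag_class_zeq)
      then have "zz C W X (p @ q) Z = zz C W X (p' @ q') Z"
        using zeq_append[OF assms(1-3) H(2-4)] assms by (subst zz_eq_iff) (auto simp: zigzag_append)
      then show ?thesis by (simp add: zz_def)
    qed
    moreover have "p \<in> zigzag_class C W X p Y" "q \<in> zigzag_class C W Y q Z"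
      using assms zeq_refl by (auto simp: zigzag_class_zeq)
    ultimately show ?thesis by blast
  qed
  then show ?thesis by (simp add: Ho_def zz_def)
qed

lemma category_Ho:
  assumes "category C" "W \<subseteq> Ar C"
  shows "category (Ho C W)"
proof -
  note app = zigzag_append[OF assms] and cmp = zz_comp[OF assms]
  note ob = zigzag_Ob[OF assms]
  show ?thesis
    unfolding category_def
  proof (intro conjI ballI impI)
    fix f assume "f \<in> Ar (Ho C W)"
    then obtain p where p: "zigzag C W (dm (Ho C W) f) p (cd (Ho C W) f)"
        "f = zz C W (dm (Ho C W) f) p (cd (Ho C W) f)" using Ar_Hom Hom_Ho by metis
    show "dm (Ho C W) f \<in> Ob (Ho C W)" "cd (Ho C W) f \<in> Ob (Ho C W)" using ob[OF p(1)] by auto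
    show "f \<cdot>\<^bsub>Ho C W\<^esub> idt (Ho C W) (dm (Ho C W) f) = f"
      using cmp[OF _ p(1), of "dm (Ho C W) f" "[]"] ob[OF p(1)] p(2) by simp
    show "idt (Ho C W) (cd (Ho C W) f) \<cdot>\<^bsub>Ho C W\<^esub> f = f"
      using cmp[OF p(1), of "[]" "cd (Ho C W) f"] ob[OF p(1)] p(2) by simp
    fix g assume "g \<in> Ar (Ho C W)" and e: "dm (Ho C W) g = cd (Ho C W) f"
    then obtain q where q: "zigzag C W (cd (Ho C W) f) q (cd (Ho C W) g)"
        "g = zz C W (cd (Ho C W) f) q (cd (Ho C W) g)" using Ar_Hom Hom_Ho by metis
    have gf: "g \<cdot>\<^bsub>Ho C W\<^esub> f = zz C W (dm (Ho C W) f) (p @ q) (cd (Ho C W) g)"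
      using cmp[OF p(1) q(1)] p(2) q(2) by simp
    show "g \<cdot>\<^bsub>Ho C W\<^esub> f \<in> Hom (Ho C W) (dm (Ho C W) f) (cd (Ho C W) g)"
      unfolding gf using p(1) q(1) by (intro zz_Hom) (auto simp: app)
    fix h assume "h \<in> Ar (Ho C W)" and "dm (Ho C W) h = cd (Ho C W) g"
    then obtain r where r: "zigzag C W (cd (Ho C W) g) r (cd (Ho C W) h)"
        "h = zz C W (cd (Ho C W) g) r (cd (Ho C W) h)" using Ar_Hom Hom_Ho by metis
    have hg: "h \<cdot>\<^bsub>Ho C W\<^esub> g = zz C W (cd (Ho C W) f) (q @ r) (cd (Ho C W) h)"
      using cmp[OF q(1) r(1)] q(2) r(2) by simp
    have pq: "zigzag C W (dm (Ho C W) f) (p @ q) (cd (Ho C W) g)"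
      "zigzag C W (cd (Ho C W) f) (q @ r) (cd (Ho C W) h)" using p(1) q(1) r(1) by (auto simp: app)
    show "h \<cdot>\<^bsub>Ho C W\<^esub> (g \<cdot>\<^bsub>Ho C W\<^esub> f) = (h \<cdot>\<^bsub>Ho C W\<^esub> g) \<cdot>\<^bsub>Ho C W\<^esub> f"
      unfolding gf hg using cmp[OF pq(1) r(1)] cmp[OF p(1) pq(2)] p(2) r(2) by simp
  next
    fix X assume "X \<in> Ob (Ho C W)"
    then show "idt (Ho C W) X \<in> Hom (Ho C W) X X" by (auto intro: zz_Hom)
  qed
qed

lemma Ho_functor_simps [simp]:
  "FO (Ho_functor C W) X = X" "FA (Ho_functor C W) f = zz C W (dm C f) [Fwd f] (cd C f)"
  by (simp_all add: Ho_functor_def zz_def)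

lemma Ho_functor_is_functor:
  assumes "category C" "W \<subseteq> Ar C"
  shows "is_functor C (Ho C W) (Ho_functor C W)"
  unfolding is_functor_def
proof (intro conjI ballI impI)
  fix f assume f: "f \<in> Ar C"
  then have zf: "zigzag C W (dm C f) [Fwd f] (cd C f)" using assms(1) by (simp add: category_def)
  show "FA (Ho_functor C W) f \<in> Hom (Ho C W) (FO (Ho_functor C W) (dm C f)) (FO (Ho_functor C W) (cd C f))"
    using zz_Hom[OF zf] by simp
  fix g assume g: "g \<in> Ar C" "dm C g = cd C f"
  have gf: "g \<cdot>\<^bsub>C\<^esub> f \<in> Hom C (dm C f) (cd C g)" using comp_Hom[OF assms(1) Ar_Hom[OF f] HomI[OF g refl]] .
  have zg: "zigzag C W (cd C f) [Fwd g] (cd C g)" using assms(1) g by (simp add: category_def)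
  have "FA (Ho_functor C W) g \<cdot>\<^bsub>Ho C W\<^esub> FA (Ho_functor C W) f = zz C W (dm C f) [Fwd f, Fwd g] (cd C g)"
    using zz_comp[OF assms zf zg] g by simp
  also have "\<dots> = zz C W (dm C f) [Fwd (g \<cdot>\<^bsub>C\<^esub> f)] (cd C g)"
  proof (subst zz_eq_iff)
    have z1: "zigzag C W (dm C f) [Fwd f, Fwd g] (cd C g)" using zg f g by simp
    have z2: "zigzag C W (dm C f) [Fwd (g \<cdot>\<^bsub>C\<^esub> f)] (cd C g)" using HomD[OF gf] Hom_Ob[OF assms(1) gf] by simp
    show "zigzag C W (dm C f) [Fwd f, Fwd g] (cd C g)" "zigzag C W (dm C f) [Fwd (g \<cdot>\<^bsub>C\<^esub> f)] (cd C g)"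
      by (fact z1, fact z2)
    show "zeq C W (dm C f) (cd C g) [Fwd f, Fwd g] [Fwd (g \<cdot>\<^bsub>C\<^esub> f)]"
      using zeq_step[OF z1 z2] zigzag_step.intros(2)[OF f g, of W "[]" "[]"] by simp
  qed
  finally show "FA (Ho_functor C W) (g \<cdot>\<^bsub>C\<^esub> f) = FA (Ho_functor C W) g \<cdot>\<^bsub>Ho C W\<^esub> FA (Ho_functor C W) f"
    using HomD[OF gf] by simp
next
  fix x assume x: "x \<in> Ob C"
  then show "FO (Ho_functor C W) x \<in> Ob (Ho C W)" by simp
  have z: "zigzag C W x [Fwd (idt C x)] x" "zigzag C W x [] x" using idt_Hom[OF assms(1) x] x by (auto simp: Hom_def)
  show "FA (Ho_functor C W) (idt C x) = idt (Ho C W) (FO (Ho_functor C W) x)"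
    using zz_eq_iff[OF z] zeq_step[OF z] zigzag_step.intros(1)[OF x, of W "[]" "[]"] HomD[OF idt_Hom[OF assms(1) x]]
    by simp
qed (use assms category_Ho in auto)

lemma Ho_functor_Hom:
  assumes "category C" "W \<subseteq> Ar C" "f \<in> Hom C X Y"
  shows "FA (Ho_functor C W) f \<in> Hom (Ho C W) X Y"
  using functor_Hom[OF Ho_functor_is_functor[OF assms(1,2)] assms(3)] by simp

lemma Ho_inverse:
  assumes C: "category C" "W \<subseteq> Ar C" and w: "w \<in> W" "w \<in> Hom C X Y"
  shows "zz C W Y [Bwd w] X \<in> Hom (Ho C W) Y X"
    and "zz C W Y [Bwd w] X \<cdot>\<^bsub>Ho C W\<^esub> FA (Ho_functor C W) w = idt (Ho C W) X"
    and "FA (Ho_functor C W) w \<cdot>\<^bsub>Ho C W\<^esub> zz C W Y [Bwd w] X = idt (Ho C W) Y"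
proof -
  have o: "X \<in> Ob C" "Y \<in> Ob C" using Hom_Ob[OF C(1) w(2)] by auto
  have z: "zigzag C W Y [Bwd w] X" "zigzag C W X [Fwd w] Y" "zigzag C W X [] X" "zigzag C W Y [] Y"
    "zigzag C W X [Fwd w, Bwd w] X" "zigzag C W Y [Bwd w, Fwd w] Y"
    using w o by (auto simp: Hom_def)
  show "zz C W Y [Bwd w] X \<in> Hom (Ho C W) Y X" using zz_Hom[OF z(1)] .
  show "zz C W Y [Bwd w] X \<cdot>\<^bsub>Ho C W\<^esub> FA (Ho_functor C W) w = idt (Ho C W) X"
    using zz_comp[OF C z(2,1)] HomD[OF w(2)] zz_eq_iff[OF z(5,3)] zeq_step[OF z(5,3)]
      zigzag_step.intros(3)[OF w(1), of C "[]" "[]"] by simp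
  show "FA (Ho_functor C W) w \<cdot>\<^bsub>Ho C W\<^esub> zz C W Y [Bwd w] X = idt (Ho C W) Y"
    using zz_comp[OF C z(1,2)] HomD[OF w(2)] zz_eq_iff[OF z(6,4)] zeq_step[OF z(6,4)]
      zigzag_step.intros(4)[OF w(1), of C "[]" "[]"] by simp
qed

text \<open>A member of \<open>W\<close> is invertible in \<open>Ho\<close>, hence monic. Equations
  between arrows into an object are later tested after composing with its fibrant replacement;
  \<open>Ho_cancel_right\<close> serves cofibrant replacements on the other side.\<close>

lemma Ho_cancel_left:
  assumes C: "category C" "W \<subseteq> Ar C" and w: "w \<in> W" "w \<in> Hom C X Y"
    and u: "u \<in> Hom (Ho C W) Z X" "v \<in> Hom (Ho C W) Z X"
    and e: "FA (Ho_functor C W) w \<cdot>\<^bsub>Ho C W\<^esub> u = FA (Ho_functor C W) w \<cdot>\<^bsub>Ho C W\<^esub> v"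
  shows "u = v"
proof -
  note k = comp_idl'[OF category_Ho[OF C] _ Ho_functor_Hom[OF C w(2)] Ho_inverse(1,2)[OF C w]]
  have "u = zz C W Y [Bwd w] X \<cdot>\<^bsub>Ho C W\<^esub> (FA (Ho_functor C W) w \<cdot>\<^bsub>Ho C W\<^esub> u)"
    by (rule k[OF u(1), symmetric])
  also have "\<dots> = v" unfolding e by (rule k[OF u(2)])
  finally show ?thesis .
qed

lemma Ho_cancel_right:
  assumes C: "category C" "W \<subseteq> Ar C" and w: "w \<in> W" "w \<in> Hom C X Y"
    and u: "u \<in> Hom (Ho C W) Y Z" "v \<in> Hom (Ho C W) Y Z"
    and e: "u \<cdot>\<^bsub>Ho C W\<^esub> FA (Ho_functor C W) w = v \<cdot>\<^bsub>Ho C W\<^esub> FA (Ho_functor C W) w"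
  shows "u = v"
proof -
  note H = category_Ho[OF C] and i = Ho_inverse[OF C w]
  have k: "(k \<cdot>\<^bsub>Ho C W\<^esub> FA (Ho_functor C W) w) \<cdot>\<^bsub>Ho C W\<^esub> zz C W Y [Bwd w] X = k"
    if "k \<in> Hom (Ho C W) Y Z" for k
    unfolding comp_assoc[OF H i(1) Ho_functor_Hom[OF C w(2)] that] i(3) by (rule comp_idr[OF H that])
  have "u = (u \<cdot>\<^bsub>Ho C W\<^esub> FA (Ho_functor C W) w) \<cdot>\<^bsub>Ho C W\<^esub> zz C W Y [Bwd w] X"
    by (rule k[OF u(1), symmetric])
  also have "\<dots> = v" unfolding e by (rule k[OF u(2)])
  finally show ?thesis .
qed

section \<open>The small object argument and filtered colimits\<close>

definition terminal :: "('o, 'm) cat \<Rightarrow> 'o \<Rightarrow> bool" where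
  "terminal C T \<longleftrightarrow> T \<in> Ob C \<and> (\<forall>X \<in> Ob C. \<exists>!f. f \<in> Hom C X T)"

definition bang :: "('o, 'm) cat \<Rightarrow> 'o \<Rightarrow> 'o \<Rightarrow> 'm" where
  "bang C T X = (THE f. f \<in> Hom C X T)"

lemma bang_Hom: "terminal C T \<Longrightarrow> X \<in> Ob C \<Longrightarrow> bang C T X \<in> Hom C X T"
  unfolding terminal_def bang_def by (rule theI') simp

lemma bang_unique: "terminal C T \<Longrightarrow> category C \<Longrightarrow> f \<in> Hom C X T \<Longrightarrow> f = bang C T X"
  using bang_Hom[of C T X] Hom_Ob[of C f X T] unfolding terminal_def by auto

text \<open>Factorizations take arrows as arguments, so an object is fed to them as its map to
  \<open>T\<close>. On arrows the lower side of the square is \<open>idt C T\<close>; because of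
  this the lower maps of cells stay fixed when an object varies.\<close>

definition over_terminal :: "('o, 'm) cat \<Rightarrow> 'o \<Rightarrow> ('o, 'm, 'm, 'm \<times> 'm \<times> 'm \<times> 'm) functr" where
  "over_terminal C T =
     \<lparr>FO = bang C T, FA = (\<lambda>m. (bang C T (dm C m), m, idt C T, bang C T (cd C m)))\<rparr>"

lemma over_terminal_is_functor:
  assumes C: "category C" "category (arrow_cat C)" and T: "terminal C T"
  shows "is_functor C (arrow_cat C) (over_terminal C T)"
proof -
  have TO: "T \<in> Ob C" using T by (simp add: terminal_def)
  have b: "bang C T X \<in> Ar C \<and> dm C (bang C T X) = X \<and> cd C (bang C T X) = T" if "X \<in> Ob C" for X
    using HomD[OF bang_Hom[OF T that]] .
  have FA: "(bang C T x, m, idt C T, bang C T y) \<in> Hom (arrow_cat C) (bang C T x) (bang C T y)"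
    if m: "m \<in> Hom C x y" for m x y
  proof -
    have xy: "x \<in> Ob C" "y \<in> Ob C" using Hom_Ob[OF C(1) m] by auto
    have "bang C T y \<cdot>\<^bsub>C\<^esub> m = bang C T x"
      by (rule bang_unique[OF T C(1) comp_Hom[OF C(1) m bang_Hom[OF T xy(2)]]])
    then show ?thesis
      using b[OF xy(1)] b[OF xy(2)] m idt_Hom[OF C(1) TO] comp_idl[OF C(1) bang_Hom[OF T xy(1)]]
      by (auto simp: arrow_cat_def Hom_def)
  qed
  show ?thesis
    unfolding is_functor_def
  proof (intro conjI ballI impI)
    fix f assume f: "f \<in> Ar C"
    show "FA (over_terminal C T) f \<in> Hom (arrow_cat C) (FO (over_terminal C T) (dm C f)) (FO (over_terminal C T) (cd C f))"
      using FA[OF Ar_Hom[OF f]] by (simp add: over_terminal_def)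
    fix g assume g: "g \<in> Ar C" "dm C g = cd C f"
    have gf: "g \<cdot>\<^bsub>C\<^esub> f \<in> Hom C (dm C f) (cd C g)" using comp_Hom[OF C(1) Ar_Hom[OF f] HomI[OF g refl]] .
    show "FA (over_terminal C T) (g \<cdot>\<^bsub>C\<^esub> f) = FA (over_terminal C T) g \<cdot>\<^bsub>arrow_cat C\<^esub> FA (over_terminal C T) f"
      using HomD[OF gf] g comp_idl[OF C(1) idt_Hom[OF C(1) TO]] by (simp add: over_terminal_def arrow_cat_def)
  next
    fix x assume x: "x \<in> Ob C"
    show "FO (over_terminal C T) x \<in> Ob (arrow_cat C)" using b[OF x] by (simp add: over_terminal_def arrow_cat_def)
    show "FA (over_terminal C T) (idt C x) = idt (arrow_cat C) (FO (over_terminal C T) x)"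
      using b[OF x] HomD[OF idt_Hom[OF C(1) x]] by (simp add: over_terminal_def arrow_cat_def)
  qed (use C in auto)
qed

section \<open>Coproducts, pushouts and the attachment of cells\<close>

lemma category_discrete_cat: "category (discrete_cat S)"
  by (auto simp: category_def discrete_cat_def Hom_def)

lemma coproduct_functor:
  assumes "category C" "is_coproduct C S X A \<iota>"
  shows "is_functor (discrete_cat S) C \<lparr>FO = X, FA = (\<lambda>s. idt C (X s))\<rparr>"
proof -
  have "\<iota> s \<in> Hom C (X s) A" if "s \<in> S" for s
    using cocone_Hom[OF colimit_cocone[OF assms(2)[unfolded is_coproduct_def]], of s] that
    by (simp add: discrete_cat_def)
  then have "X s \<in> Ob C" if "s \<in> S" for s
    using Hom_Ob[OF assms(1)] that by blast
  then show ?thesis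
    using assms(1) category_discrete_cat[of S] idt_Hom[OF assms(1)] comp_idl[OF assms(1) idt_Hom[OF assms(1)]]
    by (auto simp: is_functor_def discrete_cat_def)
qed

lemma coproduct_Hom: "is_coproduct C S X A \<iota> \<Longrightarrow> s \<in> S \<Longrightarrow> \<iota> s \<in> Hom C (X s) A"
  using cocone_Hom[OF colimit_cocone, of C "discrete_cat S" "\<lparr>FO = X, FA = (\<lambda>s. idt C (X s))\<rparr>" A \<iota> s]
  by (simp add: is_coproduct_def discrete_cat_def)

lemma coproduct_unique:
  assumes "category C" "is_coproduct C S X A \<iota>" "h \<in> Hom C A Y" "h' \<in> Hom C A Y"
    "\<And>s. s \<in> S \<Longrightarrow> h \<cdot>\<^bsub>C\<^esub> \<iota> s = h' \<cdot>\<^bsub>C\<^esub> \<iota> s"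
  shows "h = h'"
  by (rule colimit_unique[OF coproduct_functor[OF assms(1,2)] assms(2)[unfolded is_coproduct_def] assms(3,4)])
    (simp add: discrete_cat_def assms(5))

lemma coproduct_ex:
  assumes "category C" "is_coproduct C S X A \<iota>" "Y \<in> Ob C" "\<And>s. s \<in> S \<Longrightarrow> \<epsilon> s \<in> Hom C (X s) Y"
  shows "\<exists>h \<in> Hom C A Y. \<forall>s \<in> S. h \<cdot>\<^bsub>C\<^esub> \<iota> s = \<epsilon> s"
proof -
  have "is_cocone C (discrete_cat S) \<lparr>FO = X, FA = (\<lambda>s. idt C (X s))\<rparr> Y \<epsilon>"
    using assms(3,4) comp_idr[OF assms(1,4)] by (auto simp: is_cocone_def discrete_cat_def)
  from colimit_ex[OF assms(2)[unfolded is_coproduct_def] this] show ?thesis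
    by (simp add: discrete_cat_def)
qed

lemma pushout_unique:
  assumes C: "category C" and P: "is_pushout C t h k j P" and m: "m \<in> Hom C P Y" "m' \<in> Hom C P Y"
    and e: "m \<cdot>\<^bsub>C\<^esub> k = m' \<cdot>\<^bsub>C\<^esub> k" "m \<cdot>\<^bsub>C\<^esub> j = m' \<cdot>\<^bsub>C\<^esub> j"
  shows "m = m'"
proof -
  have p: "k \<in> Hom C (cd C t) P" "j \<in> Hom C (cd C h) P" "k \<cdot>\<^bsub>C\<^esub> t = j \<cdot>\<^bsub>C\<^esub> h"
    "t \<in> Hom C (dm C t) (cd C t)" "h \<in> Hom C (dm C t) (cd C h)"
    using P by (auto simp: is_pushout_def Hom_def)
  have Y: "Y \<in> Ob C" using Hom_Ob[OF C m(1)] by simp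
  have "(m \<cdot>\<^bsub>C\<^esub> k) \<cdot>\<^bsub>C\<^esub> t = (m \<cdot>\<^bsub>C\<^esub> j) \<cdot>\<^bsub>C\<^esub> h"
    using comp_assoc[OF C p(4,1) m(1)] comp_assoc[OF C p(5,2) m(1)] p(3) by simp
  then have "\<exists>!n. n \<in> Hom C P Y \<and> n \<cdot>\<^bsub>C\<^esub> k = m \<cdot>\<^bsub>C\<^esub> k \<and> n \<cdot>\<^bsub>C\<^esub> j = m \<cdot>\<^bsub>C\<^esub> j"
    using P Y comp_Hom[OF C p(1) m(1)] comp_Hom[OF C p(2) m(1)] unfolding is_pushout_def by blast
  then show ?thesis using m e by metis
qed

lemma pushout_ex:
  assumes "is_pushout C t h k j P" "Y \<in> Ob C" "a \<in> Hom C (cd C t) Y" "b \<in> Hom C (cd C h) Y"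
    "a \<cdot>\<^bsub>C\<^esub> t = b \<cdot>\<^bsub>C\<^esub> h"
  shows "\<exists>m \<in> Hom C P Y. m \<cdot>\<^bsub>C\<^esub> k = a \<and> m \<cdot>\<^bsub>C\<^esub> j = b"
  using assms unfolding is_pushout_def by blast

text \<open>Coproducts and pushout are absorbed here. What remains is that a map out of
  \<open>z'\<close> amounts to a map \<open>g\<close> out of \<open>z\<close> together with maps
  \<open>y s\<close> on the cells that match \<open>g\<close> along the boundaries; the last two
  clauses are uniqueness and existence.\<close>

lemma attach_cells_universal:
  assumes C: "category C" and S0: "\<forall>(i, p, q) \<in> S. i \<in> Ar C \<and> p \<in> Hom C (dm C i) z"
    and at: "attach_cells C S z j z' c"
  shows "j \<in> Hom C z z'"
    and "\<And>i p q. (i, p, q) \<in> S \<Longrightarrow> c (i, p, q) \<in> Hom C (cd C i) z'"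
    and "\<And>i p q. (i, p, q) \<in> S \<Longrightarrow> c (i, p, q) \<cdot>\<^bsub>C\<^esub> i = j \<cdot>\<^bsub>C\<^esub> p"
    and "\<And>Y m m'. m \<in> Hom C z' Y \<Longrightarrow> m' \<in> Hom C z' Y \<Longrightarrow> m \<cdot>\<^bsub>C\<^esub> j = m' \<cdot>\<^bsub>C\<^esub> j \<Longrightarrow>
      (\<And>s. s \<in> S \<Longrightarrow> m \<cdot>\<^bsub>C\<^esub> c s = m' \<cdot>\<^bsub>C\<^esub> c s) \<Longrightarrow> m = m'"
    and "\<And>Y g y. g \<in> Hom C z Y \<Longrightarrow> (\<And>i p q. (i, p, q) \<in> S \<Longrightarrow> y (i, p, q) \<in> Hom C (cd C i) Y) \<Longrightarrow>
      (\<And>i p q. (i, p, q) \<in> S \<Longrightarrow> g \<cdot>\<^bsub>C\<^esub> p = y (i, p, q) \<cdot>\<^bsub>C\<^esub> i) \<Longrightarrow>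
      \<exists>m \<in> Hom C z' Y. m \<cdot>\<^bsub>C\<^esub> j = g \<and> (\<forall>s \<in> S. m \<cdot>\<^bsub>C\<^esub> c s = y s)"
proof -
  have S: "i \<in> Ar C \<and> p \<in> Hom C (dm C i) z" if "(i, p, q) \<in> S" for i p q
    using S0 that by blast
  obtain A a B b t h k where A: "is_coproduct C S (\<lambda>(i, p, q). dm C i) A a"
    and B: "is_coproduct C S (\<lambda>(i, p, q). cd C i) B b"
    and t: "t \<in> Hom C A B" "\<And>i p q. (i, p, q) \<in> S \<Longrightarrow> t \<cdot>\<^bsub>C\<^esub> a (i, p, q) = b (i, p, q) \<cdot>\<^bsub>C\<^esub> i"
    and h: "h \<in> Hom C A z" "\<And>i p q. (i, p, q) \<in> S \<Longrightarrow> h \<cdot>\<^bsub>C\<^esub> a (i, p, q) = p"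
    and P: "is_pushout C t h k j z'" and cs: "\<And>s. s \<in> S \<Longrightarrow> c s = k \<cdot>\<^bsub>C\<^esub> b s"
    using at unfolding attach_cells_def by blast
  have k: "k \<in> Hom C B z'" and j: "j \<in> Hom C z z'" and kt: "k \<cdot>\<^bsub>C\<^esub> t = j \<cdot>\<^bsub>C\<^esub> h"
    using P HomD[OF t(1)] HomD[OF h(1)] by (auto simp: is_pushout_def)
  have a: "a (i, p, q) \<in> Hom C (dm C i) A" and b: "b (i, p, q) \<in> Hom C (cd C i) B"
    if "(i, p, q) \<in> S" for i p q
    using coproduct_Hom[OF A that] coproduct_Hom[OF B that] by simp_all
  show "j \<in> Hom C z z'" by (rule j)
  show "c (i, p, q) \<in> Hom C (cd C i) z'" if "(i, p, q) \<in> S" for i p q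
    using comp_Hom[OF C b[OF that] k] cs[OF that] by simp
  show "c (i, p, q) \<cdot>\<^bsub>C\<^esub> i = j \<cdot>\<^bsub>C\<^esub> p" if s: "(i, p, q) \<in> S" for i p q
  proof -
    have i: "i \<in> Hom C (dm C i) (cd C i)" using S[OF s] by (simp add: Ar_Hom)
    have "c (i, p, q) \<cdot>\<^bsub>C\<^esub> i = k \<cdot>\<^bsub>C\<^esub> (t \<cdot>\<^bsub>C\<^esub> a (i, p, q))"
      using comp_assoc[OF C i b[OF s] k] cs[OF s] t(2)[OF s] by simp
    also have "\<dots> = j \<cdot>\<^bsub>C\<^esub> (h \<cdot>\<^bsub>C\<^esub> a (i, p, q))"
      using comp_assoc[OF C a[OF s] t(1) k] comp_assoc[OF C a[OF s] h(1) j] kt by simp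
    finally show ?thesis using h(2)[OF s] by simp
  qed
  show "m = m'" if m: "m \<in> Hom C z' Y" "m' \<in> Hom C z' Y" and e: "m \<cdot>\<^bsub>C\<^esub> j = m' \<cdot>\<^bsub>C\<^esub> j"
    "\<And>s. s \<in> S \<Longrightarrow> m \<cdot>\<^bsub>C\<^esub> c s = m' \<cdot>\<^bsub>C\<^esub> c s" for Y m m'
  proof (rule pushout_unique[OF C P m _ e(1)])
    show "m \<cdot>\<^bsub>C\<^esub> k = m' \<cdot>\<^bsub>C\<^esub> k"
    proof (rule coproduct_unique[OF C B comp_Hom[OF C k m(1)] comp_Hom[OF C k m(2)]])
      fix s assume s: "s \<in> S"
      obtain i p q where ipq: "s = (i, p, q)" by (cases s)
      show "(m \<cdot>\<^bsub>C\<^esub> k) \<cdot>\<^bsub>C\<^esub> b s = (m' \<cdot>\<^bsub>C\<^esub> k) \<cdot>\<^bsub>C\<^esub> b s"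
        using comp_assoc[OF C b k m(1)] comp_assoc[OF C b k m(2)] e(2)[OF s] cs[OF s] s ipq by simp
    qed
  qed
  fix Y g y assume g: "g \<in> Hom C z Y" and y: "\<And>i p q. (i, p, q) \<in> S \<Longrightarrow> y (i, p, q) \<in> Hom C (cd C i) Y"
    and gy: "\<And>i p q. (i, p, q) \<in> S \<Longrightarrow> g \<cdot>\<^bsub>C\<^esub> p = y (i, p, q) \<cdot>\<^bsub>C\<^esub> i"
  have Y: "Y \<in> Ob C" using Hom_Ob[OF C g] by simp
  have "\<exists>\<beta> \<in> Hom C B Y. \<forall>s \<in> S. \<beta> \<cdot>\<^bsub>C\<^esub> b s = y s"
    by (rule coproduct_ex[OF C B Y]) (use y in auto)
  then obtain \<beta> where \<beta>: "\<beta> \<in> Hom C B Y" "\<And>s. s \<in> S \<Longrightarrow> \<beta> \<cdot>\<^bsub>C\<^esub> b s = y s" by blast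
  \<comment> \<open>The gluing condition is an equation of maps out of the coproduct of the domains,
    so it is checked on each boundary separately.\<close>
  have "\<beta> \<cdot>\<^bsub>C\<^esub> t = g \<cdot>\<^bsub>C\<^esub> h"
  proof (rule coproduct_unique[OF C A comp_Hom[OF C t(1) \<beta>(1)] comp_Hom[OF C h(1) g]])
    fix s assume s0: "s \<in> S"
    obtain i p q where ipq: "s = (i, p, q)" by (cases s)
    with s0 have s: "(i, p, q) \<in> S" by simp
    have i: "i \<in> Hom C (dm C i) (cd C i)" using S[OF s] by (simp add: Ar_Hom)
    have "(\<beta> \<cdot>\<^bsub>C\<^esub> t) \<cdot>\<^bsub>C\<^esub> a s = (\<beta> \<cdot>\<^bsub>C\<^esub> b s) \<cdot>\<^bsub>C\<^esub> i"
      using comp_assoc[OF C a[OF s] t(1) \<beta>(1)] comp_assoc[OF C i b[OF s] \<beta>(1)] t(2)[OF s] ipq by simp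
    also have "\<dots> = (g \<cdot>\<^bsub>C\<^esub> h) \<cdot>\<^bsub>C\<^esub> a s"
      using comp_assoc[OF C a[OF s] h(1) g] h(2)[OF s] gy[OF s] \<beta>(2)[OF s] ipq by simp
    finally show "(\<beta> \<cdot>\<^bsub>C\<^esub> t) \<cdot>\<^bsub>C\<^esub> a s = (g \<cdot>\<^bsub>C\<^esub> h) \<cdot>\<^bsub>C\<^esub> a s" .
  qed
  then obtain m where m: "m \<in> Hom C z' Y" "m \<cdot>\<^bsub>C\<^esub> k = \<beta>" "m \<cdot>\<^bsub>C\<^esub> j = g"
    using pushout_ex[OF P Y, of \<beta> g] \<beta>(1) g HomD[OF t(1)] HomD[OF h(1)] by auto
  have "m \<cdot>\<^bsub>C\<^esub> c s = y s" if s: "s \<in> S" for s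
  proof -
    obtain i p q where ipq: "s = (i, p, q)" by (cases s)
    show ?thesis using comp_assoc[OF C b k m(1)] cs[OF s] m(2) \<beta>(2)[OF s] s ipq by simp
  qed
  then show "\<exists>m \<in> Hom C z' Y. m \<cdot>\<^bsub>C\<^esub> j = g \<and> (\<forall>s \<in> S. m \<cdot>\<^bsub>C\<^esub> c s = y s)" using m by blast
qed

lemma category_poset_cat:
  assumes "Well_order r" "A \<subseteq> Field r"
  shows "category (poset_cat r A)"
proof -
  have "refl_on (Field r) r" "trans r"
    using assms(1) by (auto simp: order_on_defs)
  then show ?thesis using assms(2)
    by (auto simp: category_def poset_cat_def Hom_def refl_on_def dest: transD)
qed

lemma chain_restrict:
  assumes "Well_order r" "A \<subseteq> Field r" "is_functor (poset_cat r (Field r)) C F"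
  shows "is_functor (poset_cat r A) C F"
  using assms(3) category_poset_cat[OF assms(1,2)] assms(2) unfolding is_functor_def
  by (auto simp: poset_cat_def subset_eq)

section \<open>Stages of the small object argument and filtered colimits\<close>

locale small_object_filtered =
  fixes U :: "'u rel" and lam :: "'l rel" and C :: "('o, 'm) cat" and T :: 'o and I :: "'m set"
    and Z t \<rho> c and J :: "('u, 'u) cat" and D K \<delta>
  assumes C: "category C" "locally_small U C" and lam: "regular_cardinal lam" and T: "terminal C T"
    and I: "I \<subseteq> Ar C" "\<And>i. i \<in> I \<Longrightarrow> presentable U lam C (dm C i)"
    and chain: "small_object_chain C lam I Z t \<rho> c"
    and J: "small_category U J" "filtered lam J" and D: "is_functor J C D"
    and col: "is_colimit C J D K \<delta>"
begin

abbreviation comp_C (infixr "\<cdot>" 65) where "g \<cdot> f \<equiv> cmp C g f"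
abbreviation B where "B \<equiv> over_terminal C T"
abbreviation stage where "stage a \<equiv> functr_comp (Z a) B"

lemma lam_wo: "Well_order lam"
  using lam by (simp add: regular_cardinal_def card_order_on_well_order_on)

lemma Field_refl: "a \<in> Field lam \<Longrightarrow> (a, a) \<in> lam"
  using lam_wo by (auto simp: order_on_defs refl_on_def)

lemma trans_natural: "(a, b) \<in> lam \<Longrightarrow> natural (arrow_cat C) C (Z a) (Z b) (t a b)"
  using chain unfolding small_object_chain_def by blast

lemma rho_natural: "a \<in> Field lam \<Longrightarrow> natural (arrow_cat C) C (Z a) (cod_functor C) (\<rho> a)"
  using chain unfolding small_object_chain_def by blast

lemma chain_functor: "f \<in> Ar C \<Longrightarrow> is_functor (poset_cat lam (Field lam)) C (chain_at Z t f)"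
  using chain unfolding small_object_chain_def by blast

text \<open>Naturality of \<open>\<rho>\<close> at any stage includes that
  \<open>arrow_cat C\<close> is a category, and \<open>Field lam\<close> is not empty; so the axioms
  are read off instead of being checked.\<close>

lemma arrow_category: "category (arrow_cat C)"
proof -
  have "Field lam \<noteq> {}" using lam by (auto simp: regular_cardinal_def cinfinite_def)
  then obtain a where "a \<in> Field lam" by blast
  from rho_natural[OF this] show ?thesis by (simp add: natural_def is_functor_def)
qed

lemma B_functor: "is_functor C (arrow_cat C) B"
  by (rule over_terminal_is_functor[OF C(1) arrow_category T])

lemma FO_B [simp]: "FO B x = bang C T x"
  by (simp add: over_terminal_def)

lemma bang_Ob: "x \<in> Ob C \<Longrightarrow> bang C T x \<in> Ob (arrow_cat C)"
  using functor_Ob[OF B_functor] by simp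

lemma bang_Ar: "x \<in> Ob C \<Longrightarrow> bang C T x \<in> Ar C"
  using bang_Hom[OF T] by (auto simp: Hom_def)

lemma B_Hom: "m \<in> Hom C x y \<Longrightarrow> FA B m \<in> Hom (arrow_cat C) (bang C T x) (bang C T y)"
  using functor_Hom[OF B_functor] by simp

lemma FA_B: "m \<in> Hom C x y \<Longrightarrow> FA B m = (bang C T x, m, idt C T, bang C T y)"
  by (simp add: over_terminal_def Hom_def)

lemma stage_functor: "a \<in> Field lam \<Longrightarrow> is_functor C C (stage a)"
  using rho_natural[of a] by (intro is_functor_comp[OF B_functor]) (simp add: natural_def)

lemma trans_Hom: "(a, b) \<in> lam \<Longrightarrow> x \<in> Ob C \<Longrightarrow> t a b (bang C T x) \<in> Hom C (FO (stage a) x) (FO (stage b) x)"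
  using natural_Hom[OF trans_natural bang_Ob] by simp

lemma trans_comm: "(a, b) \<in> lam \<Longrightarrow> m \<in> Hom C x y \<Longrightarrow>
    t a b (bang C T y) \<cdot> FA (stage a) m = FA (stage b) m \<cdot> t a b (bang C T x)"
  using natural_comm[OF trans_natural B_Hom] by simp

lemma rho_Hom:
  assumes "a \<in> Field lam" "x \<in> Ob C"
  shows "\<rho> a (bang C T x) \<in> Hom C (FO (stage a) x) T"
  using natural_Hom[OF rho_natural[OF assms(1)] bang_Ob[OF assms(2)]] HomD[OF bang_Hom[OF T assms(2)]]
  by (simp add: cod_functor_def)

lemma J_category: "category J"
  using functor_cats[OF D] by simp

lemma K_Ob: "K \<in> Ob C"
  using colimit_cocone[OF col] by (simp add: is_cocone_def)

lemma D_Ob: "d \<in> Ob J \<Longrightarrow> FO D d \<in> Ob C"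
  using functor_Ob[OF D] .

lemma \<delta>_Hom: "d \<in> Ob J \<Longrightarrow> \<delta> d \<in> Hom C (FO D d) K"
  using cocone_Hom[OF colimit_cocone[OF col]] .

definition preserved :: "'l \<Rightarrow> bool" where
  "preserved a \<longleftrightarrow> is_colimit C J (functr_comp (stage a) D) (FO (stage a) K) (\<lambda>d. FA (stage a) (\<delta> d))"

lemma stage_cocone:
  "a \<in> Field lam \<Longrightarrow> is_cocone C J (functr_comp (stage a) D) (FO (stage a) K) (\<lambda>d. FA (stage a) (\<delta> d))"
  by (rule functor_cocone[OF stage_functor D colimit_cocone[OF col]])

text \<open>The least stage agrees with the identity functor on objects and arrows of
  \<open>C\<close>, so the given colimit is recovered through
  \<open>is_colimit_cong\<close>.\<close>

lemma preserved_least: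
  assumes "is_least_of lam a"
  shows "preserved a"
proof -
  have 1: "FO (Z a) f = dm C f" if "f \<in> Ar C" for f
    using chain assms that unfolding small_object_chain_def by blast
  have 2: "\<forall>(f, u, v, g) \<in> Ar (arrow_cat C). FA (Z a) (f, u, v, g) = u"
    using chain assms unfolding small_object_chain_def by blast
  have o: "FO (stage a) x = x" if "x \<in> Ob C" for x
    using 1[OF bang_Ar[OF that]] HomD[OF bang_Hom[OF T that]] by simp
  have m: "FA (stage a) m = m" if "m \<in> Hom C x y" for m x y
    using 2 HomD[OF B_Hom[OF that]] FA_B[OF that] by auto
  have "is_colimit C J (functr_comp (stage a) D) K (\<lambda>d. FA (stage a) (\<delta> d)) \<longleftrightarrow> is_colimit C J D K \<delta>"
    by (rule is_colimit_cong[OF J_category])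
      (use o[OF D_Ob] m[OF functor_Hom[OF D Ar_Hom]] m[OF \<delta>_Hom] in simp_all)
  then show ?thesis unfolding preserved_def o[OF K_Ob] using col by simp
qed

abbreviation cells where "cells a x \<equiv> squares_over C I (\<rho> a (bang C T x))"

text \<open>Maps into \<open>T\<close> are unique, so the lower side of a square is forced and
  commutativity is automatic. A cell is thus a map from the domain of a generator into the stage,
  and presentability of this domain is what lets cells descend along the diagram.\<close>

lemma cells_iff:
  assumes a: "a \<in> Field lam" and x: "x \<in> Ob C"
  shows "(i, p, q) \<in> cells a x \<longleftrightarrow> i \<in> I \<and> p \<in> Hom C (dm C i) (FO (stage a) x) \<and> q = bang C T (cd C i)"
proof -
  note r = rho_Hom[OF a x]
  show ?thesis
  proof
    assume "(i, p, q) \<in> cells a x"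
    then show "i \<in> I \<and> p \<in> Hom C (dm C i) (FO (stage a) x) \<and> q = bang C T (cd C i)"
      using HomD[OF r] bang_unique[OF T C(1)] by (auto simp: squares_over_def)
  next
    assume h: "i \<in> I \<and> p \<in> Hom C (dm C i) (FO (stage a) x) \<and> q = bang C T (cd C i)"
    then have i: "i \<in> Hom C (dm C i) (cd C i)" and p: "p \<in> Hom C (dm C i) (FO (stage a) x)"
      using I(1) Ar_Hom[of i C] by auto
    have q: "q \<in> Hom C (cd C i) T" using h bang_Hom[OF T] Hom_Ob[OF C(1) i] by simp
    have "\<rho> a (bang C T x) \<cdot> p = q \<cdot> i"
      using bang_unique[OF T C(1) comp_Hom[OF C(1) p r]] bang_unique[OF T C(1) comp_Hom[OF C(1) i q]]
      by simp
    then show "(i, p, q) \<in> cells a x" using h q HomD[OF r] by (simp add: squares_over_def)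
  qed
qed

text \<open>A map out of stage \<open>b\<close> at \<open>K\<close> consists of a map out of stage
  \<open>a\<close> and of values on the cells. The first part is governed by
  \<open>preserved a\<close>. For the second, the attaching map of a cell at \<open>K\<close> comes
  from stage \<open>a\<close> of some \<open>FO D d\<close>, since domains of generators are
  presentable; so the cell is the image of one over \<open>FO D d\<close>, and its value is dictated
  by the cocone.\<close>

lemma preserved_succ:
  assumes ab: "is_succ_of lam a b" and pa: "preserved a"
  shows "preserved b"
proof -
  have a: "a \<in> Field lam" and b: "b \<in> Field lam" using ab by (auto simp: is_succ_of_def)
  have "a \<in> under lam a" using Field_refl[OF a] by (simp add: under_def)
  then have "a \<in> underS lam b" using ab by (simp add: is_succ_of_def)
  then have l: "(a, b) \<in> lam" by (simp add: underS_def)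
  note cat = C(1)
  have colA: "is_colimit C J (functr_comp (stage a) D) (FO (stage a) K) (\<lambda>d. FA (stage a) (\<delta> d))"
    using pa by (simp add: preserved_def)
  have DA: "is_functor J C (functr_comp (stage a) D)" by (rule is_functor_comp[OF D stage_functor[OF a]])
  let ?c = "\<lambda>x. c a (bang C T x)" and ?t = "\<lambda>x. t a b (bang C T x)"
  have at: "attach_cells C (cells a x) (FO (stage a) x) (?t x) (FO (stage b) x) (?c x)" if "x \<in> Ob C" for x
    using chain ab bang_Ar[OF that] unfolding small_object_chain_def by simp
  have S: "i \<in> Ar C \<and> p \<in> Hom C (dm C i) (FO (stage a) x)" if "x \<in> Ob C" "(i, p, q) \<in> cells a x" for i p q x
    using that cells_iff[OF a] I(1) by blast
  {
    fix x assume o: "x \<in> Ob C"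
    have "\<forall>(i, p, q) \<in> cells a x. i \<in> Ar C \<and> p \<in> Hom C (dm C i) (FO (stage a) x)" using S[OF o] by blast
    note attach_cells_universal[OF cat this at[OF o]]
  }
  note att = this
  \<comment> \<open>This is the naturality of cells built into the chain. The lower map
    \<open>q\<close> does not change because the square belonging to \<open>m\<close> has
    \<open>idt C T\<close> at the bottom.\<close>
  have cc: "FA (stage b) m \<cdot> ?c x (i, p, q) = ?c y (i, FA (stage a) m \<cdot> p, q)"
    if m: "m \<in> Hom C x y" and s: "(i, p, q) \<in> cells a x" for m x y i p q
  proof -
    have xy: "x \<in> Ob C" "y \<in> Ob C" using Hom_Ob[OF cat m] by auto
    have s': "i \<in> I" "q = bang C T (cd C i)" using s cells_iff[OF a xy(1)] by auto
    then have "cd C i \<in> Ob C" using I(1) Hom_Ob[OF cat Ar_Hom] by blast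
    then have "idt C T \<cdot> q = q" using comp_idl[OF cat bang_Hom[OF T]] s'(2) by simp
    moreover have "\<forall>(f, u, v, g) \<in> Ar (arrow_cat C). \<forall>(i, p, q) \<in> squares_over C I (\<rho> a f).
           FA (Z b) (f, u, v, g) \<cdot> c a f (i, p, q) = c a g (i, FA (Z a) (f, u, v, g) \<cdot> p, v \<cdot> q)"
      using chain ab unfolding small_object_chain_def by simp
    ultimately show ?thesis using s HomD[OF B_Hom[OF m]] FA_B[OF m] by fastforce
  qed
  have stA: "FA (stage a) m \<in> Hom C (FO (stage a) x) (FO (stage a) y)" if "m \<in> Hom C x y" for m x y
    using functor_Hom[OF stage_functor[OF a] that] .
  have stB: "FA (stage b) m \<in> Hom C (FO (stage b) x) (FO (stage b) y)" if "m \<in> Hom C x y" for m x y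
    using functor_Hom[OF stage_functor[OF b] that] .
  have shift: "(i, FA (stage a) m \<cdot> p, q) \<in> cells a y" if m: "m \<in> Hom C x y" and s: "(i, p, q) \<in> cells a x" for m x y i p q
  proof -
    have xy: "x \<in> Ob C" "y \<in> Ob C" using Hom_Ob[OF cat m] by auto
    have "p \<in> Hom C (dm C i) (FO (stage a) x)" "i \<in> I" "q = bang C T (cd C i)" using s cells_iff[OF a xy(1)] by auto
    then show ?thesis using comp_Hom[OF cat _ stA[OF m]] cells_iff[OF a xy(2)] by simp
  qed
  have fac: "\<exists>d \<in> Ob J. \<exists>p' \<in> Hom C (dm C i) (FO (stage a) (FO D d)). FA (stage a) (\<delta> d) \<cdot> p' = p"
    if "i \<in> I" "p \<in> Hom C (dm C i) (FO (stage a) K)" for i p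
    using presentable_factor[OF C I(2)[OF that(1)] J DA colA that(2)] by simp
  show ?thesis unfolding preserved_def
  proof (rule colimitI[OF stage_cocone[OF b]])
    fix Y h h' assume h: "h \<in> Hom C (FO (stage b) K) Y" "h' \<in> Hom C (FO (stage b) K) Y"
      and e: "\<And>d. d \<in> Ob J \<Longrightarrow> h \<cdot> FA (stage b) (\<delta> d) = h' \<cdot> FA (stage b) (\<delta> d)"
    show "h = h'"
    proof (rule att(4)[OF K_Ob h])
      show "h \<cdot> ?t K = h' \<cdot> ?t K"
      proof (rule colimit_unique[OF DA colA comp_Hom[OF cat trans_Hom[OF l K_Ob] h(1)] comp_Hom[OF cat trans_Hom[OF l K_Ob] h(2)]])
        fix d assume d: "d \<in> Ob J"
        have "(k \<cdot> ?t K) \<cdot> FA (stage a) (\<delta> d) = (k \<cdot> FA (stage b) (\<delta> d)) \<cdot> ?t (FO D d)"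
          if "k \<in> Hom C (FO (stage b) K) Y" for k
          using comp_assoc[OF cat stA[OF \<delta>_Hom[OF d]] trans_Hom[OF l K_Ob] that]
            comp_assoc[OF cat trans_Hom[OF l D_Ob[OF d]] stB[OF \<delta>_Hom[OF d]] that]
            trans_comm[OF l \<delta>_Hom[OF d]] by simp
        then show "(h \<cdot> ?t K) \<cdot> FA (stage a) (\<delta> d) = (h' \<cdot> ?t K) \<cdot> FA (stage a) (\<delta> d)"
          using h e[OF d] by simp
      qed
      fix s assume s0: "s \<in> cells a K"
      obtain i p q where ipq: "s = (i, p, q)" by (cases s)
      with s0 have s: "(i, p, q) \<in> cells a K" by simp
      then have i: "i \<in> I" "p \<in> Hom C (dm C i) (FO (stage a) K)" "q = bang C T (cd C i)"
        using cells_iff[OF a K_Ob] by auto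
      obtain d p' where d: "d \<in> Ob J" "p' \<in> Hom C (dm C i) (FO (stage a) (FO D d))"
        "FA (stage a) (\<delta> d) \<cdot> p' = p" using fac[OF i(1,2)] by blast
      have s': "(i, p', q) \<in> cells a (FO D d)" using i d cells_iff[OF a D_Ob[OF d(1)]] by simp
      have "k \<cdot> ?c K s = (k \<cdot> FA (stage b) (\<delta> d)) \<cdot> ?c (FO D d) (i, p', q)"
        if "k \<in> Hom C (FO (stage b) K) Y" for k
        using comp_assoc[OF cat att(2)[OF D_Ob[OF d(1)] s'] stB[OF \<delta>_Hom[OF d(1)]] that]
          cc[OF \<delta>_Hom[OF d(1)] s'] d(3) ipq by simp
      then show "h \<cdot> ?c K s = h' \<cdot> ?c K s" using h e[OF d(1)] by simp
    qed
  next
    fix Y \<epsilon> assume ce: "is_cocone C J (functr_comp (stage b) D) Y \<epsilon>"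
    then have Y: "Y \<in> Ob C" by (simp add: is_cocone_def)
    have \<epsilon>: "\<epsilon> d \<in> Hom C (FO (stage b) (FO D d)) Y" if "d \<in> Ob J" for d
      using cocone_Hom[OF ce that] by simp
    have \<epsilon>m: "\<epsilon> e \<cdot> FA (stage b) (FA D m) = \<epsilon> d" if "m \<in> Hom J d e" for m d e
      using cocone_comm[OF ce that] by simp
    have "is_cocone C J (functr_comp (stage a) D) Y (\<lambda>d. \<epsilon> d \<cdot> ?t (FO D d))"
      unfolding is_cocone_def
    proof (intro conjI ballI)
      show "\<epsilon> d \<cdot> ?t (FO D d) \<in> Hom C (FO (functr_comp (stage a) D) d) Y" if "d \<in> Ob J" for d
        using comp_Hom[OF cat trans_Hom[OF l D_Ob[OF that]] \<epsilon>[OF that]] by simp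
      fix m assume "m \<in> Ar J"
      then have m: "m \<in> Hom J (dm J m) (cd J m)" by (rule Ar_Hom)
      then have ob: "dm J m \<in> Ob J" "cd J m \<in> Ob J" using Hom_Ob[OF J_category m] by auto
      note Dm = functor_Hom[OF D m]
      show "(\<epsilon> (cd J m) \<cdot> ?t (FO D (cd J m))) \<cdot> FA (functr_comp (stage a) D) m = \<epsilon> (dm J m) \<cdot> ?t (FO D (dm J m))"
        using comp_assoc[OF cat stA[OF Dm] trans_Hom[OF l D_Ob[OF ob(2)]] \<epsilon>[OF ob(2)]] trans_comm[OF l Dm]
          comp_assoc[OF cat trans_Hom[OF l D_Ob[OF ob(1)]] stB[OF Dm] \<epsilon>[OF ob(2)]] \<epsilon>m[OF m] by simp
    qed (rule Y)
    then obtain g where g: "g \<in> Hom C (FO (stage a) K) Y"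
      and gd: "\<And>d. d \<in> Ob J \<Longrightarrow> g \<cdot> FA (stage a) (\<delta> d) = \<epsilon> d \<cdot> ?t (FO D d)"
      using colimit_ex[OF colA] by blast
    \<comment> \<open>The value assigned to a cell must not depend on the factorization of its
      attaching map. Two factorizations are moved to a common object \<open>z\<close>, where
      presentability of the domain makes them equal after one more arrow \<open>k\<close>; the
      values prescribed by the cocone are invariant under all these moves.\<close>
    have wd: "\<epsilon> d \<cdot> ?c (FO D d) (i, p1, q) = \<epsilon> e \<cdot> ?c (FO D e) (i, p2, q)"
      if d: "d \<in> Ob J" and e: "e \<in> Ob J" and s1: "(i, p1, q) \<in> cells a (FO D d)" and s2: "(i, p2, q) \<in> cells a (FO D e)"
        and eq: "FA (stage a) (\<delta> d) \<cdot> p1 = FA (stage a) (\<delta> e) \<cdot> p2" for d e i p1 p2 q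
    proof -
      have i: "i \<in> I" using s1 cells_iff[OF a D_Ob[OF d]] by simp
      have p1: "p1 \<in> Hom C (dm C i) (FO (stage a) (FO D d))" and p2: "p2 \<in> Hom C (dm C i) (FO (stage a) (FO D e))"
        using S[OF D_Ob[OF d] s1] S[OF D_Ob[OF e] s2] by auto
      obtain z m n where z: "z \<in> Ob J" and m: "m \<in> Hom J d z" and n: "n \<in> Hom J e z"
        using filtered_join[OF J(2) lam d e] by blast
      note Dm = functor_Hom[OF D m] and Dn = functor_Hom[OF D n]
      have dz: "FA (stage a) (\<delta> z) \<cdot> (FA (stage a) (FA D k) \<cdot> r) = FA (stage a) (\<delta> f) \<cdot> r"
        if "k \<in> Hom J f z" "r \<in> Hom C x (FO (stage a) (FO D f))" for k f r x
        using comp_assoc[OF cat that(2) stA[OF functor_Hom[OF D that(1)]] stA[OF \<delta>_Hom[OF z]]]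
          cocone_comm[OF colimit_cocone[OF colA] that(1)] by simp
      have "\<exists>w. \<exists>k \<in> Hom J z w. FA (functr_comp (stage a) D) k \<cdot> (FA (stage a) (FA D m) \<cdot> p1) =
          FA (functr_comp (stage a) D) k \<cdot> (FA (stage a) (FA D n) \<cdot> p2)"
      proof (rule presentable_eq[OF C lam I(2)[OF i] J DA colA z])
        show "FA (stage a) (FA D m) \<cdot> p1 \<in> Hom C (dm C i) (FO (functr_comp (stage a) D) z)"
          "FA (stage a) (FA D n) \<cdot> p2 \<in> Hom C (dm C i) (FO (functr_comp (stage a) D) z)"
          using comp_Hom[OF cat p1 stA[OF Dm]] comp_Hom[OF cat p2 stA[OF Dn]] by simp_all
        show "FA (stage a) (\<delta> z) \<cdot> (FA (stage a) (FA D m) \<cdot> p1) =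
            FA (stage a) (\<delta> z) \<cdot> (FA (stage a) (FA D n) \<cdot> p2)"
          unfolding dz[OF m p1] dz[OF n p2] by (rule eq)
      qed
      then obtain w k where k: "k \<in> Hom J z w"
        and kk: "FA (stage a) (FA D k) \<cdot> (FA (stage a) (FA D m) \<cdot> p1) =
          FA (stage a) (FA D k) \<cdot> (FA (stage a) (FA D n) \<cdot> p2)" by auto
      have move: "\<epsilon> f \<cdot> ?c (FO D f) (i, r, q) = \<epsilon> f' \<cdot> ?c (FO D f') (i, FA (stage a) (FA D k) \<cdot> r, q)"
        if k: "k \<in> Hom J f f'" and s: "(i, r, q) \<in> cells a (FO D f)" for f f' k r
      proof -
        have f: "f \<in> Ob J" "f' \<in> Ob J" using Hom_Ob[OF J_category k] by auto
        show ?thesis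
          using comp_assoc[OF cat att(2)[OF D_Ob[OF f(1)] s] stB[OF functor_Hom[OF D k]] \<epsilon>[OF f(2)]]
            \<epsilon>m[OF k] cc[OF functor_Hom[OF D k] s] by simp
      qed
      show ?thesis
        unfolding move[OF m s1] move[OF n s2] move[OF k shift[OF Dm s1]] move[OF k shift[OF Dn s2]] kk ..
    qed
    have "\<exists>y. \<forall>d p'. d \<in> Ob J \<longrightarrow> p' \<in> Hom C (dm C i) (FO (stage a) (FO D d)) \<longrightarrow>
        FA (stage a) (\<delta> d) \<cdot> p' = p \<longrightarrow> y = \<epsilon> d \<cdot> ?c (FO D d) (i, p', q)"
      if s: "(i, p, q) \<in> cells a K" for i p q
    proof -
      have i: "i \<in> I" "p \<in> Hom C (dm C i) (FO (stage a) K)" "q = bang C T (cd C i)"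
        using s cells_iff[OF a K_Ob] by auto
      have s': "(i, p', q) \<in> cells a (FO D d)" if "d \<in> Ob J" "p' \<in> Hom C (dm C i) (FO (stage a) (FO D d))" for d p'
        using i that cells_iff[OF a D_Ob] by simp
      obtain d p' where d: "d \<in> Ob J" "p' \<in> Hom C (dm C i) (FO (stage a) (FO D d))"
        "FA (stage a) (\<delta> d) \<cdot> p' = p" using fac[OF i(1,2)] by blast
      show ?thesis
      proof (intro exI allI impI)
        fix d' p'' assume d': "d' \<in> Ob J" "p'' \<in> Hom C (dm C i) (FO (stage a) (FO D d'))"
          "FA (stage a) (\<delta> d') \<cdot> p'' = p"
        show "\<epsilon> d \<cdot> ?c (FO D d) (i, p', q) = \<epsilon> d' \<cdot> ?c (FO D d') (i, p'', q)"
          by (rule wd[OF d(1) d'(1) s'[OF d(1,2)] s'[OF d'(1,2)]]) (simp only: d(3) d'(3))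
      qed
    qed
    \<comment> \<open>The triple is packed into one variable so that \<open>choice\<close> yields a
      single function \<open>y\<close> on all cells at \<open>K\<close>.\<close>
    then have "\<forall>s. \<exists>y. s \<in> cells a K \<longrightarrow> (\<forall>d p'. d \<in> Ob J \<longrightarrow> p' \<in> Hom C (dm C (fst s)) (FO (stage a) (FO D d)) \<longrightarrow>
        FA (stage a) (\<delta> d) \<cdot> p' = fst (snd s) \<longrightarrow> y = \<epsilon> d \<cdot> ?c (FO D d) (fst s, p', snd (snd s)))"
      by (metis prod.collapse)
    from choice[OF this] obtain y where y0: "\<forall>s. s \<in> cells a K \<longrightarrow> (\<forall>d p'. d \<in> Ob J \<longrightarrow> p' \<in> Hom C (dm C (fst s)) (FO (stage a) (FO D d)) \<longrightarrow>
        FA (stage a) (\<delta> d) \<cdot> p' = fst (snd s) \<longrightarrow> y s = \<epsilon> d \<cdot> ?c (FO D d) (fst s, p', snd (snd s)))" by blast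
    have y: "y (i, p, q) = \<epsilon> d \<cdot> ?c (FO D d) (i, p', q)"
      if "(i, p, q) \<in> cells a K" "d \<in> Ob J" "p' \<in> Hom C (dm C i) (FO (stage a) (FO D d))" "FA (stage a) (\<delta> d) \<cdot> p' = p"
      for i p q d p'
      using y0[rule_format, OF that(1,2)] that(3,4) by simp
    have ys: "y (i, p, q) \<in> Hom C (cd C i) Y \<and> g \<cdot> p = y (i, p, q) \<cdot> i" if s: "(i, p, q) \<in> cells a K" for i p q
    proof -
      have i: "i \<in> I" "p \<in> Hom C (dm C i) (FO (stage a) K)" "q = bang C T (cd C i)"
        using s cells_iff[OF a K_Ob] by auto
      obtain d p' where d: "d \<in> Ob J" "p' \<in> Hom C (dm C i) (FO (stage a) (FO D d))"
        "FA (stage a) (\<delta> d) \<cdot> p' = p" using fac[OF i(1,2)] by blast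
      have s': "(i, p', q) \<in> cells a (FO D d)" using i d cells_iff[OF a D_Ob[OF d(1)]] by simp
      note o = D_Ob[OF d(1)]
      have ci: "?c (FO D d) (i, p', q) \<in> Hom C (cd C i) (FO (stage b) (FO D d))" by (rule att(2)[OF o s'])
      have iH: "i \<in> Hom C (dm C i) (cd C i)" using i(1) I(1) Ar_Hom[of i C] by auto
      \<comment> \<open>The boundary condition at \<open>K\<close> reduces to the attaching equation
        \<open>att(3)\<close> over \<open>FO D d\<close>, because \<open>g\<close> restricts there
        to \<open>\<epsilon> d\<close> after the transition map.\<close>
      have "g \<cdot> p = (g \<cdot> FA (stage a) (\<delta> d)) \<cdot> p'"
        using comp_assoc[OF cat d(2) stA[OF \<delta>_Hom[OF d(1)]] g] d(3) by simp
      also have "\<dots> = \<epsilon> d \<cdot> (?c (FO D d) (i, p', q) \<cdot> i)"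
        using gd[OF d(1)] comp_assoc[OF cat d(2) trans_Hom[OF l o] \<epsilon>[OF d(1)]] att(3)[OF o s'] by simp
      also have "\<dots> = y (i, p, q) \<cdot> i"
        using comp_assoc[OF cat iH ci \<epsilon>[OF d(1)]] y[OF s d] by simp
      finally show ?thesis using comp_Hom[OF cat ci \<epsilon>[OF d(1)]] y[OF s d] by simp
    qed
    have "\<exists>m \<in> Hom C (FO (stage b) K) Y. m \<cdot> ?t K = g \<and> (\<forall>s \<in> cells a K. m \<cdot> ?c K s = y s)"
      using att(5)[OF K_Ob g, of y] ys by blast
    then obtain m where m: "m \<in> Hom C (FO (stage b) K) Y" "m \<cdot> ?t K = g"
      "\<And>s. s \<in> cells a K \<Longrightarrow> m \<cdot> ?c K s = y s" by blast
    have "m \<cdot> FA (stage b) (\<delta> d) = \<epsilon> d" if d: "d \<in> Ob J" for d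
    proof (rule att(4)[OF D_Ob[OF d] comp_Hom[OF cat stB[OF \<delta>_Hom[OF d]] m(1)] \<epsilon>[OF d]])
      note o = D_Ob[OF d]
      show "(m \<cdot> FA (stage b) (\<delta> d)) \<cdot> ?t (FO D d) = \<epsilon> d \<cdot> ?t (FO D d)"
        using comp_assoc[OF cat trans_Hom[OF l o] stB[OF \<delta>_Hom[OF d]] m(1)] trans_comm[OF l \<delta>_Hom[OF d]]
          comp_assoc[OF cat stA[OF \<delta>_Hom[OF d]] trans_Hom[OF l K_Ob] m(1)] m(2) gd[OF d] by simp
      fix s assume s0: "s \<in> cells a (FO D d)"
      obtain i p q where ipq: "s = (i, p, q)" by (cases s)
      with s0 have s: "(i, p, q) \<in> cells a (FO D d)" by simp
      have p: "p \<in> Hom C (dm C i) (FO (stage a) (FO D d))" using S[OF o s] by simp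
      \<comment> \<open>The image of a cell over \<open>FO D d\<close> has an attaching map that
        comes with a factorization, namely through \<open>p\<close> itself, so \<open>y\<close> is
        known on it.\<close>
      show "(m \<cdot> FA (stage b) (\<delta> d)) \<cdot> ?c (FO D d) s = \<epsilon> d \<cdot> ?c (FO D d) s"
        using comp_assoc[OF cat att(2)[OF o s] stB[OF \<delta>_Hom[OF d]] m(1)] cc[OF \<delta>_Hom[OF d] s]
          m(3)[OF shift[OF \<delta>_Hom[OF d] s]] y[OF shift[OF \<delta>_Hom[OF d] s] d p refl] ipq by simp
    qed
    then show "\<exists>h \<in> Hom C (FO (stage b) K) Y. \<forall>d \<in> Ob J. h \<cdot> FA (stage b) (\<delta> d) = \<epsilon> d"
      using m(1) by blast
  qed
qed

text \<open>The limit stages and the end of the chain are both obtained by interchanging colimits.\<close>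

lemma preserved_chain_colimit:
  assumes A: "A \<subseteq> Field lam" "\<And>a. a \<in> A \<Longrightarrow> preserved a"
    and G: "is_functor (arrow_cat C) C G"
    and \<kappa>: "\<And>a. a \<in> A \<Longrightarrow> natural (arrow_cat C) C (Z a) G (\<kappa> a)"
    and colim: "\<And>f. f \<in> Ar C \<Longrightarrow> is_colimit C (poset_cat lam A) (chain_at Z t f) (FO G f) (\<lambda>a. \<kappa> a f)"
  shows "is_colimit C J (functr_comp (functr_comp G B) D) (FO (functr_comp G B) K) (\<lambda>d. FA (functr_comp G B) (\<delta> d))"
proof (rule colimit_interchange[where A = "poset_cat lam A" and ChK = "chain_at Z t (bang C T K)"
      and Ch = "\<lambda>d. chain_at Z t (bang C T (FO D d))" and Da = "\<lambda>a. functr_comp (stage a) D"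
      and t = "\<lambda>a d. \<kappa> a (bang C T (FO D d))" and tK = "\<lambda>a. \<kappa> a (bang C T K)"
      and \<delta> = "\<lambda>a d. FA (stage a) (\<delta> d)"])
  have GB: "is_functor C C (functr_comp G B)" by (rule is_functor_comp[OF B_functor G])
  show "is_functor J C (functr_comp (functr_comp G B) D)" by (rule is_functor_comp[OF D GB])
  show "is_cocone C J (functr_comp (functr_comp G B) D) (FO (functr_comp G B) K) (\<lambda>d. FA (functr_comp G B) (\<delta> d))"
    by (rule functor_cocone[OF GB D colimit_cocone[OF col]])
  show "is_functor (poset_cat lam A) C (chain_at Z t (bang C T K))"
    by (rule chain_restrict[OF lam_wo A(1) chain_functor[OF bang_Ar[OF K_Ob]]])
  show "is_functor (poset_cat lam A) C (chain_at Z t (bang C T (FO D d)))" if "d \<in> Ob J" for d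
    by (rule chain_restrict[OF lam_wo A(1) chain_functor[OF bang_Ar[OF D_Ob[OF that]]]])
  show "is_colimit C (poset_cat lam A) (chain_at Z t (bang C T (FO D d))) (FO (functr_comp (functr_comp G B) D) d)
      (\<lambda>a. \<kappa> a (bang C T (FO D d)))" if "d \<in> Ob J" for d
    using colim[OF bang_Ar[OF D_Ob[OF that]]] by simp
  show "is_colimit C (poset_cat lam A) (chain_at Z t (bang C T K)) (FO (functr_comp G B) K) (\<lambda>a. \<kappa> a (bang C T K))"
    using colim[OF bang_Ar[OF K_Ob]] by simp
  {
    fix a assume "a \<in> Ob (poset_cat lam A)"
    then have aA: "a \<in> A" and a: "a \<in> Field lam" using A(1) by (auto simp: poset_cat_def)
    show "is_functor J C (functr_comp (stage a) D)" by (rule is_functor_comp[OF D stage_functor[OF a]])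
    show "is_colimit C J (functr_comp (stage a) D) (FO (chain_at Z t (bang C T K)) a) (\<lambda>d. FA (stage a) (\<delta> d))"
      using A(2)[OF aA] by (simp add: preserved_def chain_at_def)
    show "FO (functr_comp (stage a) D) d = FO (chain_at Z t (bang C T (FO D d))) a" for d
      by (simp add: chain_at_def)
    show "FA (functr_comp G B) (\<delta> d) \<cdot> \<kappa> a (bang C T (FO D d)) = \<kappa> a (bang C T K) \<cdot> FA (stage a) (\<delta> d)"
      if "d \<in> Ob J" for d
      using natural_comm[OF \<kappa>[OF aA] B_Hom[OF \<delta>_Hom[OF that]]] by simp
    show "FA (functr_comp (functr_comp G B) D) m \<cdot> \<kappa> a (bang C T (FO D d)) =
        \<kappa> a (bang C T (FO D e)) \<cdot> FA (functr_comp (stage a) D) m" if "m \<in> Hom J d e" for m d e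
      using natural_comm[OF \<kappa>[OF aA] B_Hom[OF functor_Hom[OF D that]]] by simp
  }
  fix a b d n assume "n \<in> Hom (poset_cat lam A) a b" and d: "d \<in> Ob J"
  then have n: "n = (a, b)" "(a, b) \<in> lam" by (auto simp: poset_cat_def Hom_def)
  show "FA (chain_at Z t (bang C T K)) n \<cdot> FA (stage a) (\<delta> d) =
      FA (stage b) (\<delta> d) \<cdot> FA (chain_at Z t (bang C T (FO D d))) n"
    using trans_comm[OF n(2) \<delta>_Hom[OF d]] n(1) by (simp add: chain_at_def)
qed

lemma preserved_limit:
  assumes b: "is_limit_of lam b" and IH: "\<And>a. a \<in> underS lam b \<Longrightarrow> preserved a"
  shows "preserved b"
  unfolding preserved_def
proof (rule preserved_chain_colimit[where A = "underS lam b" and \<kappa> = "\<lambda>a. t a b"])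
  have bF: "b \<in> Field lam" using b by (simp add: is_limit_of_def)
  show "underS lam b \<subseteq> Field lam" by (auto simp: underS_def Field_def)
  show "is_functor (arrow_cat C) C (Z b)" using rho_natural[OF bF] by (simp add: natural_def)
  show "natural (arrow_cat C) C (Z a) (Z b) (t a b)" if "a \<in> underS lam b" for a
    using that by (intro trans_natural) (simp add: underS_def)
  show "is_colimit C (poset_cat lam (underS lam b)) (chain_at Z t f) (FO (Z b) f) (\<lambda>a. t a b f)" if "f \<in> Ar C" for f
    using chain b that unfolding small_object_chain_def by blast
qed (rule IH)

lemma preserved_all: "a \<in> Field lam \<Longrightarrow> preserved a"
proof (induction a rule: wo_rel.well_order_induct[of lam])
  case 1
  show ?case using lam_wo by (simp add: wo_rel_def)
next
  case (2 b)
  have IH: "preserved a" if "a \<in> underS lam b" for a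
    using that 2 by (auto simp: underS_def Field_def)
  consider "is_least_of lam b" | a where "is_succ_of lam a b" | "is_limit_of lam b"
    using 2(2) unfolding is_limit_of_def by blast
  then show ?case
  proof cases
    case 1
    then show ?thesis by (rule preserved_least)
  next
    case (2 a)
    then have "a \<in> Field lam" by (simp add: is_succ_of_def)
    then have "a \<in> under lam a" using Field_refl by (simp add: under_def)
    then have "a \<in> underS lam b" using 2 by (simp add: is_succ_of_def)
    then show ?thesis using preserved_succ[OF 2] IH by blast
  next
    case 3
    then show ?thesis using preserved_limit IH by blast
  qed
qed

end

text \<open>The middle object of the factorization is the colimit of the whole chain, so the
  interchange argument applies once more, now with all of \<open>Field lam\<close> as index
  poset.\<close>

lemma small_object_factorization_preserves:
  fixes U :: "'u rel" and J :: "('u, 'u) cat"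
  assumes "category C" "locally_small U C" "regular_cardinal lam" "terminal C T"
    and "I \<subseteq> Ar C" "\<And>i. i \<in> I \<Longrightarrow> presentable U lam C (dm C i)"
    and \<phi>: "small_object_factorization C lam I \<phi>"
    and "small_category U J" "filtered lam J" "is_functor J C D" "is_colimit C J D K \<delta>"
  defines "R \<equiv> functr_comp (mid \<phi>) (over_terminal C T)"
  shows "is_colimit C J (functr_comp R D) (FO R K) (\<lambda>d. FA R (\<delta> d))"
proof -
  obtain Z t \<rho> c \<kappa> where ch: "small_object_chain C lam I Z t \<rho> c"
    and k: "\<And>a. a \<in> Field lam \<Longrightarrow> natural (arrow_cat C) C (Z a) (mid \<phi>) (\<kappa> a)"
      "\<And>f. f \<in> Ar C \<Longrightarrow> is_colimit C (poset_cat lam (Field lam)) (chain_at Z t f) (FO (mid \<phi>) f) (\<lambda>a. \<kappa> a f)"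
    using \<phi> unfolding small_object_factorization_def by blast
  interpret small_object_filtered U lam C T I Z t \<rho> c J D K \<delta>
    using assms ch by unfold_locales auto
  have "Field lam \<noteq> {}" using lam by (auto simp: regular_cardinal_def cinfinite_def)
  then obtain a where "a \<in> Field lam" by blast
  from k(1)[OF this] have "is_functor (arrow_cat C) C (mid \<phi>)" by (simp add: natural_def)
  then show ?thesis
    unfolding R_def using preserved_chain_colimit[OF subset_refl preserved_all _ k] by blast
qed

section \<open>Initial objects and pushouts\<close>

text \<open>This is the colimit of the empty diagram. The formulation through \<open>op_cat\<close>
  lets the same lemma produce the terminal object from completeness.\<close>

lemma cocomplete_initial:
  fixes U :: "'u rel"
  assumes C: "category C" and cc: "cocomplete U C" and s: "small U ({} :: 'u set)"
  shows "\<exists>Z. terminal (op_cat C) Z"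
proof -
  let ?J = "\<lparr>Ob = {}, Ar = {}, dm = id, cd = id, idt = id, cmp = (\<lambda>g f. f)\<rparr> :: ('u, 'u) cat"
  let ?D = "\<lparr>FO = undefined, FA = undefined\<rparr> :: ('u, 'u, 'a, 'b) functr"
  have "small_category U ?J" "is_functor ?J C ?D"
    using s C by (auto simp: small_category_def category_def is_functor_def)
  then obtain Z \<delta> where Z: "is_colimit C ?J ?D Z \<delta>" using cc unfolding cocomplete_def by blast
  have "Z \<in> Ob C" using Z by (simp add: is_colimit_def is_cocone_def)
  moreover have "\<exists>!f. f \<in> Hom C Z X" if "X \<in> Ob C" for X
  proof -
    have "is_cocone C ?J ?D X undefined" using that by (simp add: is_cocone_def)
    then have "\<exists>!h. h \<in> Hom C Z X \<and> (\<forall>d \<in> Ob ?J. h \<cdot>\<^bsub>C\<^esub> \<delta> d = undefined d)"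
      using Z unfolding is_colimit_def by blast
    then show ?thesis by simp
  qed
  ultimately show ?thesis unfolding terminal_def by (intro exI[of _ Z]) simp
qed

lemma cocomplete_pushout:
  fixes U :: "'u rel"
  assumes C: "category C" and cc: "cocomplete U C" and U: "inaccessible U"
    and f: "f \<in> Hom C x y" and g: "g \<in> Hom C x z"
  shows "\<exists>P k j. is_pushout C f g k j P"
proof -
  have reg: "regular_cardinal U" using U by (simp add: inaccessible_def)
  then have "infinite (UNIV :: 'u set)"
    using finite_subset[OF subset_UNIV] by (auto simp: regular_cardinal_def cinfinite_def)
  then obtain e :: "nat \<Rightarrow> 'u" where "inj e" using infinite_countable_subset by blast
  then have ne: "e m = e n \<longleftrightarrow> m = n" for m n by (simp add: inj_eq)
  \<comment> \<open>Index categories must have objects and arrows in \<open>'u\<close>, which is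
    infinite because \<open>U\<close> is. The span is coded on five distinct elements:
    \<open>e 0\<close> is the apex, \<open>e 1\<close> and \<open>e 2\<close> are the feet,
    \<open>e 3\<close> and \<open>e 4\<close> the arrows to them, and an object serves as its own
    identity. At most one factor of a composite is not an identity, which explains
    \<open>cmp\<close>.\<close>
  let ?J = "\<lparr>Ob = {e 0, e 1, e 2}, Ar = {e 0, e 1, e 2, e 3, e 4},
     dm = (\<lambda>v. if v = e 3 \<or> v = e 4 then e 0 else v),
     cd = (\<lambda>v. if v = e 3 then e 1 else if v = e 4 then e 2 else v), idt = (\<lambda>v. v),
     cmp = (\<lambda>v w. if v = e 3 \<or> v = e 4 then v else w)\<rparr> :: ('u, 'u) cat"
  let ?o = "\<lambda>v. if v = e 0 then x else if v = e 1 then y else z"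
  let ?D = "\<lparr>FO = ?o, FA = (\<lambda>v. if v = e 3 then f else if v = e 4 then g else idt C (?o v))\<rparr>"
  have o: "x \<in> Ob C" "y \<in> Ob C" "z \<in> Ob C" using Hom_Ob[OF C f] Hom_Ob[OF C g] by auto
  note id = idt_Hom[OF C o(1)] idt_Hom[OF C o(2)] idt_Hom[OF C o(3)]
  note idc = comp_idl[OF C id(1)] comp_idl[OF C id(2)] comp_idl[OF C id(3)] comp_idl[OF C f] comp_idr[OF C f]
    comp_idl[OF C g] comp_idr[OF C g]
  have Jc: "category ?J" unfolding category_def Hom_def by (simp add: ne)
  have "small U (Ob ?J)" "small U (Ar ?J)" unfolding small_def by (simp_all add: finite_less_regular[OF reg])
  with Jc have J: "small_category U ?J" by (simp add: small_category_def)
  have D: "is_functor ?J C ?D" unfolding is_functor_def using Jc C o id idc f g by (simp add: ne)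
  obtain P \<delta> where P: "is_colimit C ?J ?D P \<delta>" using cc J D unfolding cocomplete_def by blast
  note coc = colimit_cocone[OF P]
  have \<delta>: "\<delta> (e 0) \<in> Hom C x P" "\<delta> (e 1) \<in> Hom C y P" "\<delta> (e 2) \<in> Hom C z P"
    using cocone_Hom[OF coc, of "e 0"] cocone_Hom[OF coc, of "e 1"] cocone_Hom[OF coc, of "e 2"] by (simp_all add: ne)
  have k: "\<delta> (e 1) \<cdot>\<^bsub>C\<^esub> f = \<delta> (e 0)" "\<delta> (e 2) \<cdot>\<^bsub>C\<^esub> g = \<delta> (e 0)"
    using cocone_comm[OF coc, of "e 3" "e 0" "e 1"] cocone_comm[OF coc, of "e 4" "e 0" "e 2"]
    by (simp_all add: Hom_def ne)
  have "\<exists>!m. m \<in> Hom C P Y \<and> m \<cdot>\<^bsub>C\<^esub> \<delta> (e 1) = a \<and> m \<cdot>\<^bsub>C\<^esub> \<delta> (e 2) = b"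
    if Y: "Y \<in> Ob C" and a: "a \<in> Hom C y Y" and b: "b \<in> Hom C z Y" and ab: "a \<cdot>\<^bsub>C\<^esub> f = b \<cdot>\<^bsub>C\<^esub> g" for Y a b
  proof -
    \<comment> \<open>A cocone under the span is determined by its legs at the feet, so the leg at
      the apex is taken to be the composite.\<close>
    let ?\<epsilon> = "\<lambda>v. if v = e 0 then a \<cdot>\<^bsub>C\<^esub> f else if v = e 1 then a else b"
    have "is_cocone C ?J ?D Y ?\<epsilon>"
      unfolding is_cocone_def using Y a b ab comp_Hom[OF C f a] comp_idr[OF C a] comp_idr[OF C b]
        comp_idr[OF C comp_Hom[OF C f a]] by (simp add: ne)
    then have ex: "\<exists>!m. m \<in> Hom C P Y \<and> (\<forall>d \<in> Ob ?J. m \<cdot>\<^bsub>C\<^esub> \<delta> d = ?\<epsilon> d)" using P unfolding is_colimit_def by blast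
    have "(\<forall>d \<in> Ob ?J. m \<cdot>\<^bsub>C\<^esub> \<delta> d = ?\<epsilon> d) \<longleftrightarrow> m \<cdot>\<^bsub>C\<^esub> \<delta> (e 1) = a \<and> m \<cdot>\<^bsub>C\<^esub> \<delta> (e 2) = b"
      if "m \<in> Hom C P Y" for m
      using comp_assoc[OF C f \<delta>(2) that] k(1) by (auto simp: ne)
    then have "(\<lambda>m. m \<in> Hom C P Y \<and> (\<forall>d \<in> Ob ?J. m \<cdot>\<^bsub>C\<^esub> \<delta> d = ?\<epsilon> d)) =
        (\<lambda>m. m \<in> Hom C P Y \<and> m \<cdot>\<^bsub>C\<^esub> \<delta> (e 1) = a \<and> m \<cdot>\<^bsub>C\<^esub> \<delta> (e 2) = b)" by (intro ext conj_cong refl)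
    from this[THEN arg_cong[where f = Ex1]] ex show ?thesis by (rule iffD1)
  qed
  moreover have "P \<in> Ob C" using coc by (simp add: is_cocone_def)
  ultimately have "is_pushout C f g (\<delta> (e 1)) (\<delta> (e 2)) P"
    unfolding is_pushout_def using HomD[OF f] HomD[OF g] \<delta> k by auto
  then show ?thesis by blast
qed

section \<open>Strongly combinatorial model categories\<close>

locale strong_comb =
  fixes U :: "'u rel" and lam :: "'l rel" and C :: "('o, 'm) cat" and M :: "('o, 'm) model_structure"
  assumes U: "inaccessible U" and lam: "regular_cardinal lam" and sc: "strongly_combinatorial U lam C M"
begin

abbreviation "W \<equiv> weq M"
abbreviation "H \<equiv> Ho C W"
abbreviation "P \<equiv> Ho_functor C W"
abbreviation comp_C (infixr "\<cdot>" 65) where "g \<cdot> f \<equiv> cmp C g f"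
abbreviation comp_H (infixr "\<star>" 65) where "g \<star> f \<equiv> cmp H g f"

lemma comb: "combinatorial U lam C M"
  using sc by (simp add: strongly_combinatorial_def)

lemma model: "is_model_structure C M" and C: "category C" and complete: "complete U C"
  and cocomplete: "cocomplete U C" and ls: "locally_small U C"
  using comb by (simp_all add: combinatorial_def model_category_def locally_presentable_def)

lemmas model_axioms = model[unfolded is_model_structure_def]

lemma W_wide: "wide_subcategory C W" and fib_wide: "wide_subcategory C (fib M)"
  using model_axioms by (rule conjunct1, elim conjE)

lemma W_Ar: "W \<subseteq> Ar C"
  using W_wide by (simp add: wide_subcategory_def)

lemma idt_W: "x \<in> Ob C \<Longrightarrow> idt C x \<in> W"
  using W_wide by (simp add: wide_subcategory_def image_subset_iff)

lemma
  assumes "f \<in> Hom C x y" "g \<in> Hom C y z"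
  shows W_comp: "f \<in> W \<Longrightarrow> g \<in> W \<Longrightarrow> g \<cdot> f \<in> W"
    and W_left: "f \<in> W \<Longrightarrow> g \<cdot> f \<in> W \<Longrightarrow> g \<in> W"
    and W_right: "g \<in> W \<Longrightarrow> g \<cdot> f \<in> W \<Longrightarrow> f \<in> W"
    and fib_comp: "f \<in> fib M \<Longrightarrow> g \<in> fib M \<Longrightarrow> g \<cdot> f \<in> fib M"
proof -
  have "f \<in> Ar C" "g \<in> Ar C" "dm C g = cd C f" using assms by (auto simp: Hom_def)
  moreover have "\<forall>f \<in> Ar C. \<forall>g \<in> Ar C. dm C g = cd C f \<longrightarrow>
        (f \<in> weq M \<and> g \<in> weq M \<longrightarrow> g \<cdot> f \<in> weq M) \<and>
        (f \<in> weq M \<and> g \<cdot> f \<in> weq M \<longrightarrow> g \<in> weq M) \<and>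
        (g \<in> weq M \<and> g \<cdot> f \<in> weq M \<longrightarrow> f \<in> weq M)"
    using model_axioms by (elim conjE)
  moreover have "\<forall>f \<in> fib M. \<forall>g \<in> fib M. dm C g = cd C f \<longrightarrow> g \<cdot> f \<in> fib M"
    using fib_wide by (simp add: wide_subcategory_def)
  ultimately show "f \<in> W \<Longrightarrow> g \<in> W \<Longrightarrow> g \<cdot> f \<in> W" "f \<in> W \<Longrightarrow> g \<cdot> f \<in> W \<Longrightarrow> g \<in> W"
    "g \<in> W \<Longrightarrow> g \<cdot> f \<in> W \<Longrightarrow> f \<in> W" "f \<in> fib M \<Longrightarrow> g \<in> fib M \<Longrightarrow> g \<cdot> f \<in> fib M"
    by simp_all
qed

lemma lift:
  assumes "i \<in> Hom C a b" "p \<in> Hom C x y" "u \<in> Hom C a x" "v \<in> Hom C b y" "p \<cdot> u = v \<cdot> i"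
    and "i \<in> cof M" "p \<in> fib M" "i \<in> W \<or> p \<in> W"
  shows "\<exists>h \<in> Hom C b x. h \<cdot> i = u \<and> p \<cdot> h = v"
proof -
  have "(\<forall>i \<in> cof M \<inter> weq M. \<forall>p \<in> fib M. has_lift C i p) \<and>
     (\<forall>i \<in> cof M. \<forall>p \<in> fib M \<inter> weq M. has_lift C i p)"
    using model_axioms by (elim conjE, intro conjI)
  then have "has_lift C i p" using assms(6-8) by blast
  then show ?thesis using assms(1-5) HomD[OF assms(1)] HomD[OF assms(2)] unfolding has_lift_def by simp
qed

text \<open>The clause on presentability is the strong hypothesis. The presentable cofibrant
  replacements and cylinders below are middle objects of this factorization.\<close>

lemma cof_tfib_factor:
  assumes f: "f \<in> Hom C x y"
  shows "\<exists>m l r. l \<in> Hom C x m \<and> r \<in> Hom C m y \<and> l \<in> cof M \<and> r \<in> fib M \<and> r \<in> W \<and> r \<cdot> l = f \<and>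
    (presentable U lam C x \<longrightarrow> presentable U lam C y \<longrightarrow> presentable U lam C m)"
proof -
  have ff: "functorial_factorization C (cof M) (fib M \<inter> weq M) (fact_cof_tfib M)"
    using model_axioms by (elim conjE)
  have fA: "f \<in> Ar C" "dm C f = x" "cd C f = y" using f by (auto simp: Hom_def)
  then have fO: "f \<in> Ob (arrow_cat C)" by (simp add: arrow_cat_def)
  have "lft (fact_cof_tfib M) f \<in> Hom C x (FO (mid (fact_cof_tfib M)) f)"
    "rgt (fact_cof_tfib M) f \<in> Hom C (FO (mid (fact_cof_tfib M)) f) y"
    using ff natural_Hom[OF _ fO] fA unfolding functorial_factorization_def
    by (fastforce simp: dom_functor_def, fastforce simp: cod_functor_def)
  moreover have "lft (fact_cof_tfib M) f \<in> cof M" "rgt (fact_cof_tfib M) f \<in> fib M"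
    "rgt (fact_cof_tfib M) f \<in> W" "rgt (fact_cof_tfib M) f \<cdot> lft (fact_cof_tfib M) f = f"
    using ff fA unfolding functorial_factorization_def by blast+
  moreover have "presentable U lam C x \<longrightarrow> presentable U lam C y \<longrightarrow>
      presentable U lam C (FO (mid (fact_cof_tfib M)) f)"
    using sc fA unfolding strongly_combinatorial_def by blast
  ultimately show ?thesis by blast
qed

lemma ff_tcof: "functorial_factorization C (cof M \<inter> W) (fib M) (fact_tcof_fib M)"
  using model_axioms by (elim conjE)

lemma tcof_fib_Hom:
  assumes f: "f \<in> Hom C x y"
  shows "lft (fact_tcof_fib M) f \<in> Hom C x (FO (mid (fact_tcof_fib M)) f)"
    and "rgt (fact_tcof_fib M) f \<in> Hom C (FO (mid (fact_tcof_fib M)) f) y"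
    and "lft (fact_tcof_fib M) f \<in> cof M" "lft (fact_tcof_fib M) f \<in> W"
    and "rgt (fact_tcof_fib M) f \<in> fib M"
    and "rgt (fact_tcof_fib M) f \<cdot> lft (fact_tcof_fib M) f = f"
proof -
  have fA: "f \<in> Ar C" "dm C f = x" "cd C f = y" using f by (auto simp: Hom_def)
  then have fO: "f \<in> Ob (arrow_cat C)" by (simp add: arrow_cat_def)
  show "lft (fact_tcof_fib M) f \<in> Hom C x (FO (mid (fact_tcof_fib M)) f)"
    "rgt (fact_tcof_fib M) f \<in> Hom C (FO (mid (fact_tcof_fib M)) f) y"
    using ff_tcof natural_Hom[OF _ fO] fA unfolding functorial_factorization_def
    by (fastforce simp: dom_functor_def, fastforce simp: cod_functor_def)
  show "lft (fact_tcof_fib M) f \<in> cof M" "lft (fact_tcof_fib M) f \<in> W" "rgt (fact_tcof_fib M) f \<in> fib M"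
    "rgt (fact_tcof_fib M) f \<cdot> lft (fact_tcof_fib M) f = f"
    using ff_tcof fA unfolding functorial_factorization_def by blast+
qed

section \<open>Initial and terminal objects, the coproduct of two copies, presentability\<close>

lemma small_empty: "small U {}"
  unfolding small_def by (rule finite_less_regular) (use U in \<open>simp_all add: inaccessible_def\<close>)

definition "T = (SOME T. terminal C T)"

lemma T: "terminal C T"
proof -
  have "\<exists>T. terminal (op_cat (op_cat C)) T"
    by (rule cocomplete_initial[OF category_op_cat[OF C] _ small_empty]) (use complete in \<open>simp add: complete_def\<close>)
  then have "\<exists>T. terminal C T" by (simp add: terminal_def)
  then show ?thesis unfolding T_def by (rule someI_ex)
qed

lemma initial: "\<exists>Z. Z \<in> Ob C \<and> (\<forall>X \<in> Ob C. \<exists>!f. f \<in> Hom C Z X)"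
  using cocomplete_initial[OF C cocomplete small_empty] by (simp add: terminal_def)

text \<open>\<open>A + A\<close> arises as the pushout of two copies of the map from the initial
  object. It is the source of the codiagonal, whose factorization gives the cylinder.\<close>

lemma coproduct:
  assumes A: "A \<in> Ob C"
  shows "\<exists>S i j. i \<in> Hom C A S \<and> j \<in> Hom C A S \<and>
    (\<forall>Y x y. x \<in> Hom C A Y \<longrightarrow> y \<in> Hom C A Y \<longrightarrow> (\<exists>h \<in> Hom C S Y. h \<cdot> i = x \<and> h \<cdot> j = y)) \<and>
    (\<forall>Y h h'. h \<in> Hom C S Y \<longrightarrow> h' \<in> Hom C S Y \<longrightarrow> h \<cdot> i = h' \<cdot> i \<longrightarrow> h \<cdot> j = h' \<cdot> j \<longrightarrow> h = h')"
proof -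
  obtain Z where Z: "Z \<in> Ob C" "\<And>X. X \<in> Ob C \<Longrightarrow> \<exists>!f. f \<in> Hom C Z X" using initial by blast
  obtain z where z: "z \<in> Hom C Z A" using Z(2)[OF A] by blast
  obtain S i j where po: "is_pushout C z z i j S" using cocomplete_pushout[OF C cocomplete U z z] by blast
  have zA: "cd C z = A" using HomD[OF z] by simp
  have "i \<in> Hom C A S" "j \<in> Hom C A S" using po zA by (auto simp: is_pushout_def)
  moreover have "\<exists>h \<in> Hom C S Y. h \<cdot> i = x \<and> h \<cdot> j = y" if "x \<in> Hom C A Y" "y \<in> Hom C A Y" for x y Y
  proof -
    have Y: "Y \<in> Ob C" using Hom_Ob[OF C that(1)] by simp
    have "x \<cdot> z = y \<cdot> z" using Z(2)[OF Y] comp_Hom[OF C z that(1)] comp_Hom[OF C z that(2)] by blast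
    then show ?thesis using pushout_ex[OF po Y] that zA by simp
  qed
  ultimately show ?thesis using pushout_unique[OF C po] by blast
qed

text \<open>A filtered category is not empty, so the unique map into a colimit passes through a
  stage. The result is needed because a cofibrant replacement is obtained by factoring a map out of
  the initial object, and both ends of that map must be presentable.\<close>

lemma presentable_initial:
  assumes Z: "Z \<in> Ob C" "\<And>X. X \<in> Ob C \<Longrightarrow> \<exists>!f. f \<in> Hom C Z X"
  shows "presentable U lam C Z"
proof (rule presentableI[OF C ls lam Z(1)])
  fix J :: "('u, 'u) cat" and D X \<delta>
  assume J: "filtered lam J" and D: "is_functor J C D" and col: "is_colimit C J D X \<delta>"
  note \<delta> = cocone_Hom[OF colimit_cocone[OF col]]
  show "\<exists>d \<in> Ob J. \<exists>g \<in> Hom C Z (FO D d). \<delta> d \<cdot> g = f" if f: "f \<in> Hom C Z X" for f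
  proof -
    obtain d where d: "d \<in> Ob J" using filtered_nonempty[OF J lam] by blast
    obtain g where g: "g \<in> Hom C Z (FO D d)" using Z(2)[OF functor_Ob[OF D d]] by blast
    have "X \<in> Ob C" using Hom_Ob[OF C f] by simp
    then have "\<delta> d \<cdot> g = f" using Z(2) comp_Hom[OF C g \<delta>[OF d]] f by blast
    then show ?thesis using d g by blast
  qed
  show "\<exists>e. \<exists>m \<in> Hom J d e. FA D m \<cdot> u = FA D m \<cdot> v"
    if d: "d \<in> Ob J" and uv: "u \<in> Hom C Z (FO D d)" "v \<in> Hom C Z (FO D d)" for d u v
  proof -
    have "u = v" using Z(2)[OF functor_Ob[OF D d]] uv by blast
    then show ?thesis using idt_Hom[OF _ d] J by (auto simp: filtered_def)
  qed
qed

text \<open>The two components of a map out of \<open>S\<close> descend separately and are then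
  moved to a common stage. This makes the source of the codiagonal presentable.\<close>

lemma presentable_coproduct:
  assumes A: "presentable U lam C A" and i: "i \<in> Hom C A S" "j \<in> Hom C A S"
    and ex: "\<And>Y x y. x \<in> Hom C A Y \<Longrightarrow> y \<in> Hom C A Y \<Longrightarrow> \<exists>h \<in> Hom C S Y. h \<cdot> i = x \<and> h \<cdot> j = y"
    and un: "\<And>Y h h'. h \<in> Hom C S Y \<Longrightarrow> h' \<in> Hom C S Y \<Longrightarrow> h \<cdot> i = h' \<cdot> i \<Longrightarrow> h \<cdot> j = h' \<cdot> j \<Longrightarrow> h = h'"
  shows "presentable U lam C S"
proof (rule presentableI[OF C ls lam])
  show "S \<in> Ob C" using Hom_Ob[OF C i(1)] by simp
  fix J :: "('u, 'u) cat" and D X \<delta>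
  assume sJ: "small_category U J" and J: "filtered lam J" and D: "is_functor J C D" and col: "is_colimit C J D X \<delta>"
  note \<delta> = cocone_Hom[OF colimit_cocone[OF col]] and \<delta>c = cocone_comm[OF colimit_cocone[OF col]]
  have Jc: "category J" using J by (simp add: filtered_def)
  show "\<exists>d \<in> Ob J. \<exists>g \<in> Hom C S (FO D d). \<delta> d \<cdot> g = f" if f: "f \<in> Hom C S X" for f
  proof -
    obtain d g where d: "d \<in> Ob J" "g \<in> Hom C A (FO D d)" "\<delta> d \<cdot> g = f \<cdot> i"
      using presentable_factor[OF C ls A sJ J D col comp_Hom[OF C i(1) f]] by blast
    obtain d' g' where d': "d' \<in> Ob J" "g' \<in> Hom C A (FO D d')" "\<delta> d' \<cdot> g' = f \<cdot> j"
      using presentable_factor[OF C ls A sJ J D col comp_Hom[OF C i(2) f]] by blast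
    obtain e m n where e: "e \<in> Ob J" "m \<in> Hom J d e" "n \<in> Hom J d' e"
      using filtered_join[OF J lam d(1) d'(1)] by blast
    note Dm = functor_Hom[OF D e(2)] and Dn = functor_Hom[OF D e(3)]
    obtain h where h: "h \<in> Hom C S (FO D e)" "h \<cdot> i = FA D m \<cdot> g" "h \<cdot> j = FA D n \<cdot> g'"
      using ex[OF comp_Hom[OF C d(2) Dm] comp_Hom[OF C d'(2) Dn]] by blast
    have "\<delta> e \<cdot> h = f"
    proof (rule un[OF comp_Hom[OF C h(1) \<delta>[OF e(1)]] f])
      show "(\<delta> e \<cdot> h) \<cdot> i = f \<cdot> i"
        using comp_assoc[OF C i(1) h(1) \<delta>[OF e(1)]] comp_assoc[OF C d(2) Dm \<delta>[OF e(1)]] \<delta>c[OF e(2)] h(2) d(3) by simp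
      show "(\<delta> e \<cdot> h) \<cdot> j = f \<cdot> j"
        using comp_assoc[OF C i(2) h(1) \<delta>[OF e(1)]] comp_assoc[OF C d'(2) Dn \<delta>[OF e(1)]] \<delta>c[OF e(3)] h(3) d'(3) by simp
    qed
    then show ?thesis using e(1) h(1) by blast
  qed
  show "\<exists>e. \<exists>m \<in> Hom J d e. FA D m \<cdot> u = FA D m \<cdot> v"
    if d: "d \<in> Ob J" and u: "u \<in> Hom C S (FO D d)" and v: "v \<in> Hom C S (FO D d)" and eq: "\<delta> d \<cdot> u = \<delta> d \<cdot> v" for d u v
  proof -
    have "\<delta> d \<cdot> (u \<cdot> k) = \<delta> d \<cdot> (v \<cdot> k)" if "k \<in> Hom C A S" for k
      using comp_assoc[OF C that u \<delta>[OF d]] comp_assoc[OF C that v \<delta>[OF d]] eq by simp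
    note k = this[OF i(1)] this[OF i(2)]
    obtain e m where m: "m \<in> Hom J d e" "FA D m \<cdot> (u \<cdot> i) = FA D m \<cdot> (v \<cdot> i)"
      using presentable_eq[OF C ls lam A sJ J D col d comp_Hom[OF C i(1) u] comp_Hom[OF C i(1) v] k(1)] by blast
    obtain e' m' where m': "m' \<in> Hom J d e'" "FA D m' \<cdot> (u \<cdot> j) = FA D m' \<cdot> (v \<cdot> j)"
      using presentable_eq[OF C ls lam A sJ J D col d comp_Hom[OF C i(2) u] comp_Hom[OF C i(2) v] k(2)] by blast
    \<comment> \<open>The arrows that equalize the first and the second components differ; closing
      the span they form yields one arrow equalizing both.\<close>
    obtain w p q where w: "p \<in> Hom J e w" "q \<in> Hom J e' w" "p \<cdot>\<^bsub>J\<^esub> m = q \<cdot>\<^bsub>J\<^esub> m'"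
      using filtered_span[OF J lam m(1) m'(1)] by blast
    let ?n = "p \<cdot>\<^bsub>J\<^esub> m"
    have n: "?n \<in> Hom J d w" by (rule comp_Hom[OF Jc m(1) w(1)])
    have split: "(FA D (b \<cdot>\<^bsub>J\<^esub> a) \<cdot> x) \<cdot> k = FA D b \<cdot> (FA D a \<cdot> (x \<cdot> k))"
      if "a \<in> Hom J d c" "b \<in> Hom J c w" "x \<in> Hom C S (FO D d)" "k \<in> Hom C A S" for a b c x k
      using functor_comp[OF D that(1,2)] comp_assoc[OF C that(4,3) functor_Hom[OF D comp_Hom[OF Jc that(1,2)]]]
        comp_assoc[OF C comp_Hom[OF C that(4,3)] functor_Hom[OF D that(1)] functor_Hom[OF D that(2)]] by simp
    have "FA D ?n \<cdot> u = FA D ?n \<cdot> v"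
    proof (rule un[OF comp_Hom[OF C u functor_Hom[OF D n]] comp_Hom[OF C v functor_Hom[OF D n]]])
      show "(FA D ?n \<cdot> u) \<cdot> i = (FA D ?n \<cdot> v) \<cdot> i"
        unfolding split[OF m(1) w(1) u i(1)] split[OF m(1) w(1) v i(1)] m(2) ..
      show "(FA D ?n \<cdot> u) \<cdot> j = (FA D ?n \<cdot> v) \<cdot> j"
        unfolding w(3) split[OF m'(1) w(2) u i(2)] split[OF m'(1) w(2) v i(2)] m'(2) ..
    qed
    then show ?thesis using n by blast
  qed
qed

section \<open>Cofibrant and fibrant objects, cylinders\<close>

definition cofibrant :: "'o \<Rightarrow> bool" where
  "cofibrant A \<longleftrightarrow> A \<in> Ob C \<and> (\<forall>X Y p y. p \<in> fib M \<longrightarrow> p \<in> W \<longrightarrow> p \<in> Hom C X Y \<longrightarrow> y \<in> Hom C A Y \<longrightarrow>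
     (\<exists>x \<in> Hom C A X. p \<cdot> x = y))"

definition fibrant :: "'o \<Rightarrow> bool" where
  "fibrant X \<longleftrightarrow> X \<in> Ob C \<and> bang C T X \<in> fib M"

text \<open>As in \<open>cofibrant\<close>, the cofibration condition is encoded by the lifts it
  provides. Here it is the lifting property of the map from \<open>A + A\<close> to \<open>V\<close>
  against trivial fibrations, written with its two components so that the coproduct does not
  occur.\<close>

definition cylinder :: "'o \<Rightarrow> 'o \<Rightarrow> 'm \<Rightarrow> 'm \<Rightarrow> 'm \<Rightarrow> bool" where
  "cylinder A V e0 e1 t \<longleftrightarrow> e0 \<in> Hom C A V \<and> e1 \<in> Hom C A V \<and> t \<in> Hom C V A \<and> t \<in> W \<and>
     t \<cdot> e0 = idt C A \<and> t \<cdot> e1 = idt C A \<and>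
     (\<forall>X Y p x0 x1 h. p \<in> fib M \<longrightarrow> p \<in> W \<longrightarrow> p \<in> Hom C X Y \<longrightarrow> x0 \<in> Hom C A X \<longrightarrow> x1 \<in> Hom C A X \<longrightarrow>
        h \<in> Hom C V Y \<longrightarrow> h \<cdot> e0 = p \<cdot> x0 \<longrightarrow> h \<cdot> e1 = p \<cdot> x1 \<longrightarrow>
        (\<exists>k \<in> Hom C V X. k \<cdot> e0 = x0 \<and> k \<cdot> e1 = x1))"

lemma cofibrant_replacement:
  assumes A: "A \<in> Ob C"
  shows "\<exists>Q q. q \<in> Hom C Q A \<and> q \<in> W \<and> cofibrant Q \<and> (presentable U lam C A \<longrightarrow> presentable U lam C Q)"
proof -
  obtain Z where Z: "Z \<in> Ob C" "\<And>X. X \<in> Ob C \<Longrightarrow> \<exists>!f. f \<in> Hom C Z X" using initial by blast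
  obtain z where z: "z \<in> Hom C Z A" using Z(2)[OF A] by blast
  obtain Q l q where Q: "l \<in> Hom C Z Q" "q \<in> Hom C Q A" "l \<in> cof M" "q \<in> W"
    "presentable U lam C Z \<longrightarrow> presentable U lam C A \<longrightarrow> presentable U lam C Q"
    using cof_tfib_factor[OF z] by blast
  have "\<exists>x \<in> Hom C Q X. p \<cdot> x = y" if p: "p \<in> fib M" "p \<in> W" "p \<in> Hom C X Y" and y: "y \<in> Hom C Q Y" for X Y p y
  proof -
    have o: "X \<in> Ob C" "Y \<in> Ob C" using Hom_Ob[OF C p(3)] by auto
    obtain u where u: "u \<in> Hom C Z X" using Z(2)[OF o(1)] by blast
    have "p \<cdot> u = y \<cdot> l" using Z(2)[OF o(2)] comp_Hom[OF C u p(3)] comp_Hom[OF C Q(1) y] by blast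
    then show ?thesis using lift[OF Q(1) p(3) u y _ Q(3) p(1)] p(2) by blast
  qed
  then have "cofibrant Q" using Hom_Ob[OF C Q(1)] unfolding cofibrant_def by blast
  then show ?thesis using Q presentable_initial[OF Z] by blast
qed

text \<open>The cylinder is the middle of a factorization of the codiagonal \<open>s\<close>. Two
  maps out of \<open>A\<close> amount to one map out of \<open>S\<close>, which translates the
  lifting condition of \<open>cylinder\<close> into an ordinary lift against the cofibration
  \<open>l\<close>.\<close>

lemma cylinder_exists:
  assumes A: "A \<in> Ob C"
  shows "\<exists>V e0 e1 t. cylinder A V e0 e1 t \<and> (presentable U lam C A \<longrightarrow> presentable U lam C V)"
proof -
  obtain S i j where S: "i \<in> Hom C A S" "j \<in> Hom C A S"
    and ex: "\<And>Y x y. x \<in> Hom C A Y \<Longrightarrow> y \<in> Hom C A Y \<Longrightarrow> \<exists>h \<in> Hom C S Y. h \<cdot> i = x \<and> h \<cdot> j = y"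
    and un: "\<And>Y h h'. h \<in> Hom C S Y \<Longrightarrow> h' \<in> Hom C S Y \<Longrightarrow> h \<cdot> i = h' \<cdot> i \<Longrightarrow> h \<cdot> j = h' \<cdot> j \<Longrightarrow> h = h'"
    using coproduct[OF A] by blast
  obtain s where s: "s \<in> Hom C S A" "s \<cdot> i = idt C A" "s \<cdot> j = idt C A"
    using ex[OF idt_Hom[OF C A] idt_Hom[OF C A]] by blast
  obtain V l t where V: "l \<in> Hom C S V" "t \<in> Hom C V A" "l \<in> cof M" "t \<in> W" "t \<cdot> l = s"
    "presentable U lam C S \<longrightarrow> presentable U lam C A \<longrightarrow> presentable U lam C V"
    using cof_tfib_factor[OF s(1)] by blast
  have lifts: "\<exists>k \<in> Hom C V X. k \<cdot> (l \<cdot> i) = x0 \<and> k \<cdot> (l \<cdot> j) = x1"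
    if p: "p \<in> fib M" "p \<in> W" "p \<in> Hom C X Y" and x: "x0 \<in> Hom C A X" "x1 \<in> Hom C A X"
      and h: "h \<in> Hom C V Y" "h \<cdot> (l \<cdot> i) = p \<cdot> x0" "h \<cdot> (l \<cdot> j) = p \<cdot> x1" for X Y p x0 x1 h
  proof -
    obtain u where u: "u \<in> Hom C S X" "u \<cdot> i = x0" "u \<cdot> j = x1" using ex[OF x] by blast
    have "p \<cdot> u = h \<cdot> l"
      by (rule un[OF comp_Hom[OF C u(1) p(3)] comp_Hom[OF C V(1) h(1)]])
        (use comp_assoc[OF C S(1) u(1) p(3)] comp_assoc[OF C S(2) u(1) p(3)] comp_assoc[OF C S(1) V(1) h(1)]
          comp_assoc[OF C S(2) V(1) h(1)] h(2,3) u(2,3) in simp_all)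
    then obtain k where k: "k \<in> Hom C V X" "k \<cdot> l = u" using lift[OF V(1) p(3) u(1) h(1) _ V(3) p(1)] p(2) by blast
    then show ?thesis using comp_assoc[OF C S(1) V(1) k(1)] comp_assoc[OF C S(2) V(1) k(1)] u(2,3) by auto
  qed
  have "cylinder A V (l \<cdot> i) (l \<cdot> j) t"
    unfolding cylinder_def
  proof (intro conjI allI impI)
    show "t \<cdot> (l \<cdot> i) = idt C A" "t \<cdot> (l \<cdot> j) = idt C A"
      using comp_assoc[OF C S(1) V(1,2)] comp_assoc[OF C S(2) V(1,2)] V(5) s by simp_all
  qed (use comp_Hom[OF C S(1) V(1)] comp_Hom[OF C S(2) V(1)] V(2,4) lifts in blast)+
  moreover have "presentable U lam C S" if "presentable U lam C A"
    by (rule presentable_coproduct[OF that S]) (erule (1) ex, erule (3) un)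
  ultimately show ?thesis using V(6) by blast
qed

text \<open>By cofibrant generation the trivial cofibrations have the form
  \<open>llp C (rlp C I)\<close>, and a class defined by left lifting is closed under
  pushouts.\<close>

lemma tcof_pushout:
  assumes i: "i \<in> cof M" "i \<in> W" and po: "is_pushout C i h k j Q"
  shows "j \<in> W"
proof -
  obtain I where I: "cof M \<inter> W = llp C (rlp C I)"
    using comb unfolding combinatorial_def generated_by_presentables_def by blast
  have P: "i \<in> Hom C (dm C i) (cd C i)" "h \<in> Hom C (dm C i) (cd C h)" "k \<in> Hom C (cd C i) Q" "j \<in> Hom C (cd C h) Q"
    "k \<cdot> i = j \<cdot> h"
    using po by (auto simp: is_pushout_def Hom_def)
  have "has_lift C j p" if p: "p \<in> rlp C I" for p
    unfolding has_lift_def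
  proof (intro ballI impI)
    fix u v assume "u \<in> Hom C (dm C j) (dm C p)" "v \<in> Hom C (cd C j) (cd C p)" and e: "p \<cdot> u = v \<cdot> j"
    then have u: "u \<in> Hom C (cd C h) (dm C p)" and v: "v \<in> Hom C Q (cd C p)" using HomD[OF P(4)] by auto
    have pH: "p \<in> Hom C (dm C p) (cd C p)" using p by (auto simp: rlp_def Hom_def)
    have "i \<in> llp C (rlp C I)" using i I by blast
    then have "has_lift C i p" using p by (simp add: llp_def)
    moreover have "p \<cdot> (u \<cdot> h) = (v \<cdot> k) \<cdot> i"
      using comp_assoc[OF C P(2) u pH] comp_assoc[OF C P(1,3) v] comp_assoc[OF C P(2,4) v] e P(5) by simp
    ultimately obtain w where w: "w \<in> Hom C (cd C i) (dm C p)" "w \<cdot> i = u \<cdot> h" "p \<cdot> w = v \<cdot> k"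
      using comp_Hom[OF C P(2) u] comp_Hom[OF C P(3) v] unfolding has_lift_def by blast
    have "dm C p \<in> Ob C" using Hom_Ob[OF C pH] by simp
    then obtain m where m: "m \<in> Hom C Q (dm C p)" "m \<cdot> k = w" "m \<cdot> j = u"
      using pushout_ex[OF po _ w(1) u w(2)] by blast
    have "p \<cdot> m = v"
      by (rule pushout_unique[OF C po comp_Hom[OF C m(1) pH] v])
        (use comp_assoc[OF C P(3) m(1) pH] comp_assoc[OF C P(4) m(1) pH] m w(3) e in simp_all)
    then show "\<exists>x \<in> Hom C (cd C j) (dm C p). x \<cdot> j = u \<and> p \<cdot> x = v"
      using m HomD[OF P(4)] by auto
  qed
  then have "j \<in> llp C (rlp C I)" using HomD[OF P(4)] by (simp add: llp_def)
  then show ?thesis using I by blast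
qed

lemma extend_to_fibrant:
  assumes i: "i \<in> Hom C a b" "i \<in> cof M" "i \<in> W" and X: "fibrant X" and u: "u \<in> Hom C a X"
  shows "\<exists>h \<in> Hom C b X. h \<cdot> i = u"
proof -
  have XO: "X \<in> Ob C" and XF: "bang C T X \<in> fib M" using X by (auto simp: fibrant_def)
  have bO: "b \<in> Ob C" using Hom_Ob[OF C i(1)] by simp
  note bX = bang_Hom[OF T XO] and bb = bang_Hom[OF T bO]
  have "bang C T X \<cdot> u = bang C T b \<cdot> i"
    using bang_unique[OF T C comp_Hom[OF C u bX]] bang_unique[OF T C comp_Hom[OF C i(1) bb]] by simp
  from lift[OF i(1) bX u bb this i(2) XF] i(3) show ?thesis by blast
qed

end

section \<open>Homotopy classes and the homotopy category\<close>

context strong_comb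
begin

section \<open>Functorial fibrant replacement and the functor to the homotopy category\<close>

definition "R = functr_comp (mid (fact_tcof_fib M)) (over_terminal C T)"

definition "r X = lft (fact_tcof_fib M) (bang C T X)"

lemma R_functor: "is_functor C C R"
proof -
  have m: "is_functor (arrow_cat C) C (mid (fact_tcof_fib M))"
    using ff_tcof by (simp add: functorial_factorization_def natural_def)
  show ?thesis unfolding R_def
    by (rule is_functor_comp[OF over_terminal_is_functor[OF C _ T] m]) (use functor_cats[OF m] in simp)
qed

lemma R_Hom: "f \<in> Hom C X Y \<Longrightarrow> FA R f \<in> Hom C (FO R X) (FO R Y)"
  by (rule functor_Hom[OF R_functor])

lemma R_Ob: "X \<in> Ob C \<Longrightarrow> FO R X \<in> Ob C"
  by (rule functor_Ob[OF R_functor])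

lemma
  assumes "X \<in> Ob C"
  shows r_Hom: "r X \<in> Hom C X (FO R X)" and r_W: "r X \<in> W"
    and fibrant_R: "fibrant (FO R X)"
proof -
  note F = tcof_fib_Hom[OF bang_Hom[OF T assms]]
  have RX: "FO R X = FO (mid (fact_tcof_fib M)) (bang C T X)" by (simp add: R_def over_terminal_def)
  show "r X \<in> Hom C X (FO R X)" "r X \<in> W" unfolding r_def RX by (fact F)+
  have "rgt (fact_tcof_fib M) (bang C T X) = bang C T (FO R X)"
    unfolding RX by (rule bang_unique[OF T C F(2)])
  then show "fibrant (FO R X)" using F(5) R_Ob[OF assms] by (simp add: fibrant_def)
qed

lemma r_natural:
  assumes f: "f \<in> Hom C X Y"
  shows "r Y \<cdot> f = FA R f \<cdot> r X"
proof -
  have n: "natural (arrow_cat C) C (dom_functor C) (mid (fact_tcof_fib M)) (lft (fact_tcof_fib M))"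
    using ff_tcof by (simp add: functorial_factorization_def)
  then have "category (arrow_cat C)" by (simp add: natural_def is_functor_def)
  from functor_Hom[OF over_terminal_is_functor[OF C this T] f] natural_comm[OF n] show ?thesis
    using f by (fastforce simp: over_terminal_def dom_functor_def r_def R_def Hom_def)
qed

text \<open>Two out of three in the naturality square of \<open>r\<close>.\<close>

lemma R_W:
  assumes w: "w \<in> Hom C X Y" "w \<in> W"
  shows "FA R w \<in> W"
proof -
  have o: "X \<in> Ob C" "Y \<in> Ob C" using Hom_Ob[OF C w(1)] by auto
  have "FA R w \<cdot> r X \<in> W"
    using W_comp[OF w(1) r_Hom[OF o(2)] w(2) r_W[OF o(2)]] r_natural[OF w(1)] by simp
  then show ?thesis using W_left[OF r_Hom[OF o(1)] R_Hom[OF w(1)] r_W[OF o(1)]] by blast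
qed

lemma R_preserves:
  fixes J :: "('u, 'u) cat"
  assumes "small_category U J" "filtered lam J" "is_functor J C D" "is_colimit C J D K \<delta>"
  shows "is_colimit C J (functr_comp R D) (FO R K) (\<lambda>d. FA R (\<delta> d))"
proof -
  obtain I where I: "generated_by_presentables U lam C (cof M \<inter> W) I"
    "small_object_factorization C lam I (fact_tcof_fib M)"
    using comb unfolding combinatorial_def by blast
  then have "I \<subseteq> Ar C" "\<And>i. i \<in> I \<Longrightarrow> presentable U lam C (dm C i)"
    unfolding generated_by_presentables_def by blast+
  then show ?thesis unfolding R_def
    using small_object_factorization_preserves[OF C ls lam T _ _ I(2) assms] by blast
qed

lemma H_category: "category H"
  by (rule category_Ho[OF C W_Ar])

lemma P_functor: "is_functor C H P"
  by (rule Ho_functor_is_functor[OF C W_Ar])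

lemma P_Hom: "f \<in> Hom C X Y \<Longrightarrow> FA P f \<in> Hom H X Y"
  by (rule Ho_functor_Hom[OF C W_Ar])

lemma P_comp: "f \<in> Hom C X Y \<Longrightarrow> g \<in> Hom C Y Z \<Longrightarrow> FA P (g \<cdot> f) = FA P g \<star> FA P f"
  by (rule functor_comp[OF P_functor])

lemmas P_inverse = Ho_inverse[OF C W_Ar]
lemmas P_cancel_left = Ho_cancel_left[OF C W_Ar]
lemmas P_cancel_right = Ho_cancel_right[OF C W_Ar]

end

section \<open>Left homotopies on a fixed cylinder\<close>

locale cyl = strong_comb U lam C M for U :: "'u rel" and lam :: "'l rel" and C :: "('o, 'm) cat" and M +
  fixes A V e0 e1 t
  assumes cofA: "cofibrant A" and cylA: "cylinder A V e0 e1 t"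
begin

lemma A_Ob: "A \<in> Ob C"
  using cofA by (simp add: cofibrant_def)

lemma ends: "e0 \<in> Hom C A V" "e1 \<in> Hom C A V" "t \<in> Hom C V A" "t \<in> W"
  "t \<cdot> e0 = idt C A" "t \<cdot> e1 = idt C A"
  using cylA by (simp_all add: cylinder_def)

lemma cyl_lift:
  assumes "p \<in> fib M" "p \<in> W" "p \<in> Hom C X Y" "x0 \<in> Hom C A X" "x1 \<in> Hom C A X"
     "h \<in> Hom C V Y" "h \<cdot> e0 = p \<cdot> x0" "h \<cdot> e1 = p \<cdot> x1"
  shows "\<exists>k \<in> Hom C V X. k \<cdot> e0 = x0 \<and> k \<cdot> e1 = x1"
proof -
  have "\<forall>X Y p x0 x1 h. p \<in> fib M \<longrightarrow> p \<in> W \<longrightarrow> p \<in> Hom C X Y \<longrightarrow> x0 \<in> Hom C A X \<longrightarrow> x1 \<in> Hom C A X \<longrightarrow>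
        h \<in> Hom C V Y \<longrightarrow> h \<cdot> e0 = p \<cdot> x0 \<longrightarrow> h \<cdot> e1 = p \<cdot> x1 \<longrightarrow>
        (\<exists>k \<in> Hom C V X. k \<cdot> e0 = x0 \<and> k \<cdot> e1 = x1)"
    using cylA unfolding cylinder_def by (elim conjE)
  from this[rule_format, OF assms] show ?thesis .
qed

lemma cof_lift:
  assumes "p \<in> fib M" "p \<in> W" "p \<in> Hom C X Y" "y \<in> Hom C A Y"
  shows "\<exists>x \<in> Hom C A X. p \<cdot> x = y"
  using cofA assms unfolding cofibrant_def by blast

definition htp :: "'o \<Rightarrow> 'm \<Rightarrow> 'm \<Rightarrow> bool" where
  "htp X x y \<longleftrightarrow> (\<exists>h \<in> Hom C V X. h \<cdot> e0 = x \<and> h \<cdot> e1 = y)"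

text \<open>Taking the generated equivalence relation replaces the usual gluing of cylinders. Later
  arguments run by induction over the generating homotopies, all of which live on the one cylinder
  \<open>V\<close>.\<close>

definition heq :: "'o \<Rightarrow> 'm \<Rightarrow> 'm \<Rightarrow> bool" where
  "heq X = equivclp (htp X)"

lemma htp_Hom: "htp X x y \<Longrightarrow> x \<in> Hom C A X \<and> y \<in> Hom C A X"
  unfolding htp_def using comp_Hom[OF C ends(1)] comp_Hom[OF C ends(2)] by blast

lemma heq_refl: "heq X x x"
  by (simp add: heq_def)

lemma heq_sym: "heq X x y \<Longrightarrow> heq X y x"
  unfolding heq_def by (rule equivclp_sym)

lemma heq_trans: "heq X x y \<Longrightarrow> heq X y z \<Longrightarrow> heq X x z"
  unfolding heq_def by (rule equivclp_trans)

lemma htp_heq: "htp X x y \<Longrightarrow> heq X x y"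
  unfolding heq_def by (rule r_into_equivclp)

lemma heq_induct [consumes 1, case_names base fwd bwd]:
  assumes "heq X x y" "Q x" "\<And>y z. heq X x y \<Longrightarrow> htp X y z \<Longrightarrow> Q y \<Longrightarrow> Q z"
    "\<And>y z. heq X x y \<Longrightarrow> htp X z y \<Longrightarrow> Q y \<Longrightarrow> Q z"
  shows "Q y"
  using assms(1) unfolding heq_def
proof (induction rule: equivclp_induct)
  case base
  then show ?case by (rule assms(2))
next
  case (step y z)
  then show ?case using assms(3,4) unfolding heq_def by blast
qed

lemma heq_Hom:
  assumes "heq X x y" "x \<in> Hom C A X"
  shows "y \<in> Hom C A X"
  using assms by (induction rule: heq_induct) (use htp_Hom in blast)+

lemma htp_post:
  assumes f: "f \<in> Hom C X Y" and h: "htp X x y"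
  shows "htp Y (f \<cdot> x) (f \<cdot> y)"
proof -
  obtain k where k: "k \<in> Hom C V X" "k \<cdot> e0 = x" "k \<cdot> e1 = y" using h unfolding htp_def by blast
  show ?thesis unfolding htp_def
    by (rule bexI[of _ "f \<cdot> k"])
      (use comp_assoc[OF C ends(1) k(1) f] comp_assoc[OF C ends(2) k(1) f] k comp_Hom[OF C k(1) f] in simp_all)
qed

lemma heq_post:
  assumes f: "f \<in> Hom C X Y" and h: "heq X x y"
  shows "heq Y (f \<cdot> x) (f \<cdot> y)"
  using h
proof (induction rule: heq_induct)
  case base
  then show ?case by (rule heq_refl)
next
  case (fwd y z)
  show ?case by (rule heq_trans[OF fwd(3) htp_heq[OF htp_post[OF f fwd(2)]]])
next
  case (bwd y z)
  show ?case by (rule heq_trans[OF bwd(3) heq_sym[OF htp_heq[OF htp_post[OF f bwd(2)]]]])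
qed

text \<open>A single homotopy lifts along a trivial fibration with both ends prescribed, by
  \<open>cyl_lift\<close>. For a chain of homotopies the intermediate maps have to be lifted as
  well, which is possible because \<open>A\<close> is cofibrant.\<close>

lemma heq_reflect_tfib:
  assumes p: "p \<in> fib M" "p \<in> W" "p \<in> Hom C X Y" and x: "x \<in> Hom C A X" "x' \<in> Hom C A X"
    and h: "heq Y (p \<cdot> x) (p \<cdot> x')"
  shows "heq X x x'"
proof -
  have refl: "htp X a b" if ab: "a \<in> Hom C A X" "b \<in> Hom C A X" and h: "htp Y (p \<cdot> a) (p \<cdot> b)" for a b
  proof -
    obtain k where k: "k \<in> Hom C V Y" "k \<cdot> e0 = p \<cdot> a" "k \<cdot> e1 = p \<cdot> b"
      using h unfolding htp_def by blast
    show ?thesis using cyl_lift[OF p ab k] by (simp add: htp_def)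
  qed
  \<comment> \<open>Two lifts of one map are homotopic: the homotopy to be lifted is the constant
    one, \<open>p \<cdot> a\<close> precomposed with \<open>t\<close>.\<close>
  have same: "htp X a b" if ab: "a \<in> Hom C A X" "b \<in> Hom C A X" and e: "p \<cdot> a = p \<cdot> b" for a b
  proof (rule refl[OF ab])
    have pa: "p \<cdot> a \<in> Hom C A Y" by (rule comp_Hom[OF C ab(1) p(3)])
    show "htp Y (p \<cdot> a) (p \<cdot> b)"
      unfolding htp_def
      by (rule bexI[of _ "(p \<cdot> a) \<cdot> t"])
        (use comp_assoc[OF C ends(1,3) pa] comp_assoc[OF C ends(2,3) pa] ends(5,6) comp_idr[OF C pa] e
          comp_Hom[OF C ends(3) pa] in simp_all)
  qed
  \<comment> \<open>The induction ranges over every lift of the current endpoint. Hence an arbitrary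
    lift may be inserted at each step, and the last one can be the given \<open>x'\<close>.\<close>
  have "\<forall>x'. x' \<in> Hom C A X \<longrightarrow> p \<cdot> x' = y \<longrightarrow> heq X x x'" if "heq Y (p \<cdot> x) y" for y
    using that
  proof (induction rule: heq_induct)
    case base
    then show ?case using same[OF x(1)] htp_heq by metis
  next
    case (fwd y z)
    obtain a where a: "a \<in> Hom C A X" "p \<cdot> a = y" using cof_lift[OF p] htp_Hom[OF fwd(2)] by blast
    show ?case
    proof (intro allI impI)
      fix b assume b: "b \<in> Hom C A X" "p \<cdot> b = z"
      have "htp X a b" using refl[OF a(1) b(1)] fwd(2) a(2) b(2) by simp
      then show "heq X x b" using fwd(3) a htp_heq heq_trans by blast
    qed
  next
    case (bwd y z)
    obtain a where a: "a \<in> Hom C A X" "p \<cdot> a = y" using cof_lift[OF p] htp_Hom[OF bwd(2)] by blast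
    show ?case
    proof (intro allI impI)
      fix b assume b: "b \<in> Hom C A X" "p \<cdot> b = z"
      have "htp X b a" using refl[OF b(1) a(1)] bwd(2) a(2) b(2) by simp
      then show "heq X x b" using bwd(3) a htp_heq heq_sym heq_trans by blast
    qed
  qed
  then show ?thesis using h x(2) by blast
qed

text \<open>The retraction \<open>s\<close> of a trivial cofibration \<open>i : X \<rightarrow> Z\<close> satisfies \<open>i s \<sim> 1\<close>: factor the
  codiagonal \<open>Z \<union>\<^sub>X Z \<rightarrow> Z\<close> into a cofibration followed by a trivial fibration; the former is
  trivial, so \<open>(i s, 1)\<close> extends along it.\<close>

lemma tcof_surj:
  assumes i: "i \<in> Hom C X Z" "i \<in> cof M" "i \<in> W" and X: "fibrant X" and Z: "fibrant Z" and z: "z \<in> Hom C A Z"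
  shows "\<exists>x \<in> Hom C A X. heq Z (i \<cdot> x) z"
proof -
  have o: "X \<in> Ob C" "Z \<in> Ob C" using Hom_Ob[OF C i(1)] by auto
  note idZ = idt_Hom[OF C o(2)]
  obtain s where s: "s \<in> Hom C Z X" "s \<cdot> i = idt C X"
    using extend_to_fibrant[OF i X idt_Hom[OF C o(1)]] by blast
  obtain Q k j where po: "is_pushout C i i k j Q" using cocomplete_pushout[OF C cocomplete U i(1) i(1)] by blast
  have ci: "cd C i = Z" using HomD[OF i(1)] by simp
  have kj: "k \<in> Hom C Z Q" "j \<in> Hom C Z Q" using po ci by (auto simp: is_pushout_def)
  obtain n where n: "n \<in> Hom C Q Z" "n \<cdot> k = idt C Z" "n \<cdot> j = idt C Z"
    using pushout_ex[OF po o(2)] idZ ci by auto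
  obtain G l p where G: "l \<in> Hom C Q G" "p \<in> Hom C G Z" "l \<in> cof M" "p \<in> fib M" "p \<in> W" "p \<cdot> l = n"
    using cof_tfib_factor[OF n(1)] by blast
  have lk: "l \<cdot> k \<in> Hom C Z G" and lj: "l \<cdot> j \<in> Hom C Z G"
    using comp_Hom[OF C kj(1) G(1)] comp_Hom[OF C kj(2) G(1)] by auto
  have plk: "p \<cdot> (l \<cdot> k) = idt C Z" and plj: "p \<cdot> (l \<cdot> j) = idt C Z"
    using comp_assoc[OF C kj(1) G(1,2)] comp_assoc[OF C kj(2) G(1,2)] G(6) n by simp_all
  \<comment> \<open>\<open>l \<cdot> j\<close> is a section of the weak equivalence
    \<open>p\<close>, and \<open>j\<close> is a weak equivalence as a pushout of \<open>i\<close>;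
    two out of three then gives \<open>l \<in> W\<close>.\<close>
  have "l \<cdot> j \<in> W" using W_right[OF lj G(2,5)] plj idt_W[OF o(2)] by simp
  then have "l \<in> W" using W_left[OF kj(2) G(1) tcof_pushout[OF i(2,3) po]] by blast
  have "i \<cdot> s \<in> Hom C Z Z" by (rule comp_Hom[OF C s(1) i(1)])
  moreover have "(i \<cdot> s) \<cdot> i = idt C Z \<cdot> i"
    using comp_assoc[OF C i(1) s(1) i(1)] s(2) comp_idr[OF C i(1)] comp_idl[OF C i(1)] by simp
  ultimately obtain u where u: "u \<in> Hom C Q Z" "u \<cdot> k = i \<cdot> s" "u \<cdot> j = idt C Z"
    using pushout_ex[OF po o(2)] idZ ci by auto
  obtain g where g: "g \<in> Hom C G Z" "g \<cdot> l = u" using extend_to_fibrant[OF G(1,3) \<open>l \<in> W\<close> Z u(1)] by blast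
  have sz: "s \<cdot> z \<in> Hom C A X" by (rule comp_Hom[OF C z s(1)])
  note lkz = comp_Hom[OF C z lk] and ljz = comp_Hom[OF C z lj]
  \<comment> \<open>Here the homotopy carried by \<open>G\<close> becomes one on \<open>V\<close>:
    both composites are lifts of \<open>z\<close> through the trivial fibration \<open>p\<close>,
    hence related by \<open>heq\<close>, and \<open>g\<close> sends them to
    \<open>i \<cdot> (s \<cdot> z)\<close> and to \<open>z\<close>.\<close>
  have "p \<cdot> ((l \<cdot> k) \<cdot> z) = p \<cdot> ((l \<cdot> j) \<cdot> z)"
    using comp_assoc[OF C z lk G(2)] comp_assoc[OF C z lj G(2)] plk plj by simp
  then have "heq G ((l \<cdot> k) \<cdot> z) ((l \<cdot> j) \<cdot> z)"
    using heq_reflect_tfib[OF G(4,5,2) lkz ljz] heq_refl by simp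
  then have "heq Z (g \<cdot> ((l \<cdot> k) \<cdot> z)) (g \<cdot> ((l \<cdot> j) \<cdot> z))" by (rule heq_post[OF g(1)])
  moreover have "g \<cdot> ((l \<cdot> k) \<cdot> z) = i \<cdot> (s \<cdot> z)"
    using comp_assoc[OF C z lk g(1)] comp_assoc[OF C kj(1) G(1) g(1)] g(2) u(2) comp_assoc[OF C z s(1) i(1)] by simp
  moreover have "g \<cdot> ((l \<cdot> j) \<cdot> z) = z"
    using comp_assoc[OF C z lj g(1)] comp_assoc[OF C kj(2) G(1) g(1)] g(2) u(3) comp_idl[OF C z] by simp
  ultimately show ?thesis using sz by auto
qed

text \<open>Factor \<open>w\<close> into a trivial cofibration \<open>i\<close> and a fibration
  \<open>p\<close>, which is trivial by two out of three. The middle object is fibrant, so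
  \<open>tcof_surj\<close> applies to \<open>i\<close>, and \<open>i\<close> has a retraction
  \<open>s\<close> because \<open>X\<close> is fibrant; \<open>p\<close> is handled by lifting.
  Together the two claims say that \<open>w\<close> is bijective on homotopy classes.\<close>

lemma
  assumes w: "w \<in> Hom C X Y" "w \<in> W" and X: "fibrant X" and Y: "fibrant Y"
  shows heq_reflect_W: "x \<in> Hom C A X \<Longrightarrow> x' \<in> Hom C A X \<Longrightarrow> heq Y (w \<cdot> x) (w \<cdot> x') \<Longrightarrow> heq X x x'"
    and heq_surj_W: "y \<in> Hom C A Y \<Longrightarrow> \<exists>x \<in> Hom C A X. heq Y (w \<cdot> x) y"
proof -
  define Z where "Z = FO (mid (fact_tcof_fib M)) w"
  define i where "i = lft (fact_tcof_fib M) w"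
  define p where "p = rgt (fact_tcof_fib M) w"
  have F: "i \<in> Hom C X Z" "p \<in> Hom C Z Y" "i \<in> cof M" "i \<in> W" "p \<in> fib M" "p \<cdot> i = w"
    unfolding Z_def i_def p_def by (fact tcof_fib_Hom[OF w(1)])+
  have pW: "p \<in> W" using W_left[OF F(1,2,4)] F(6) w(2) by simp
  have o: "X \<in> Ob C" "Y \<in> Ob C" "Z \<in> Ob C" using Hom_Ob[OF C F(1)] Hom_Ob[OF C F(2)] by auto
  have "bang C T Y \<cdot> p = bang C T Z"
    by (rule bang_unique[OF T C comp_Hom[OF C F(2) bang_Hom[OF T o(2)]]])
  then have Z: "fibrant Z"
    using fib_comp[OF F(2) bang_Hom[OF T o(2)] F(5)] Y o by (simp add: fibrant_def)
  obtain s where s: "s \<in> Hom C Z X" "s \<cdot> i = idt C X"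
    using extend_to_fibrant[OF F(1,3,4) X idt_Hom[OF C o(1)]] by blast
  have wx: "w \<cdot> x = p \<cdot> (i \<cdot> x)" if "x \<in> Hom C A X" for x
    using comp_assoc[OF C that F(1,2)] F(6) by simp
  have six: "s \<cdot> (i \<cdot> x) = x" if "x \<in> Hom C A X" for x
    by (rule comp_idl'[OF C that F(1) s])
  show "heq X x x'" if x: "x \<in> Hom C A X" "x' \<in> Hom C A X" and h: "heq Y (w \<cdot> x) (w \<cdot> x')"
  proof -
    have "heq Z (i \<cdot> x) (i \<cdot> x')"
      by (rule heq_reflect_tfib[OF F(5) pW F(2) comp_Hom[OF C x(1) F(1)] comp_Hom[OF C x(2) F(1)]])
        (use h wx[OF x(1)] wx[OF x(2)] in simp)
    from heq_post[OF s(1) this] show ?thesis unfolding six[OF x(1)] six[OF x(2)] .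
  qed
  show "\<exists>x \<in> Hom C A X. heq Y (w \<cdot> x) y" if y: "y \<in> Hom C A Y"
  proof -
    obtain z where z: "z \<in> Hom C A Z" "p \<cdot> z = y" using cof_lift[OF F(5) pW F(2) y] by blast
    obtain x where x: "x \<in> Hom C A X" "heq Z (i \<cdot> x) z" using tcof_surj[OF F(1,3,4) X Z z(1)] by blast
    from heq_post[OF F(2) x(2)] have "heq Y (w \<cdot> x) y" unfolding wx[OF x(1)] z(2) .
    then show ?thesis using x(1) by blast
  qed
qed

section \<open>Homotopy classes compared with arrows of the homotopy category\<close>

lemma heq_P:
  assumes "heq X x y" "x \<in> Hom C A X"
  shows "FA P x = FA P y"
proof -
  note PtH = P_Hom[OF ends(3)]
  \<comment> \<open>Both ends of the cylinder are sections of \<open>t\<close>, which is invertible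
    in \<open>Ho\<close>. So they become equal there, and with them the two ends of any
    homotopy.\<close>
  have "FA P t \<star> FA P e0 = FA P t \<star> FA P e1"
    unfolding P_comp[OF ends(1,3), symmetric] P_comp[OF ends(2,3), symmetric] ends(5,6) ..
  then have e: "FA P e0 = FA P e1" by (rule P_cancel_left[OF ends(4,3) P_Hom[OF ends(1)] P_Hom[OF ends(2)]])
  have h: "FA P a = FA P b" if ab: "htp X a b" for a b
  proof -
    obtain k where k: "k \<in> Hom C V X" "k \<cdot> e0 = a" "k \<cdot> e1 = b" using ab unfolding htp_def by blast
    show ?thesis unfolding k(2,3)[symmetric] P_comp[OF ends(1) k(1)] P_comp[OF ends(2) k(1)] e ..
  qed
  show ?thesis using assms(1)
    by (induction rule: heq_induct) (simp_all only: h)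
qed

text \<open>Induction on the zigzag, removing its last step. A forward step along \<open>f\<close>
  is absorbed by composing with \<open>FA R f\<close>. A backward step along \<open>w\<close> is
  undone up to homotopy, since \<open>FA R w\<close> is onto on homotopy classes, and homotopic maps
  agree in \<open>Ho\<close>.\<close>

lemma Ho_full:
  assumes "u \<in> Hom H A X"
  shows "\<exists>g \<in> Hom C A (FO R X). FA P (r X) \<star> u = FA P g"
proof -
  have "zigzag C W A p X \<Longrightarrow> \<exists>g \<in> Hom C A (FO R X). FA P (r X) \<star> zz C W A p X = FA P g" for p
  proof (induction p arbitrary: X rule: rev_induct)
    case Nil
    then have X: "X = A" by simp
    have "FA P (r A) \<star> idt H A = FA P (r A)"
      by (rule comp_idr[OF H_category P_Hom[OF r_Hom[OF A_Ob]]])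
    then show ?case unfolding X using r_Hom[OF A_Ob] by auto
  next
    case (snoc s p)
    then obtain X' where p: "zigzag C W A p X'" and s: "zigzag C W X' [s] X"
      using zigzag_append[OF C W_Ar] by blast
    let ?u = "zz C W A p X'"
    have u: "?u \<in> Hom H A X'" by (rule zz_Hom[OF p])
    have eq: "zz C W A (p @ [s]) X = zz C W X' [s] X \<star> ?u" by (rule zz_comp[OF C W_Ar p s, symmetric])
    obtain g where g: "g \<in> Hom C A (FO R X')" "FA P (r X') \<star> ?u = FA P g" using snoc.IH[OF p] by blast
    show ?case
    proof (cases s)
      case (Fwd f)
      with s have f: "f \<in> Hom C X' X" by (auto simp: Hom_def)
      have Pf: "zz C W X' [s] X = FA P f" using Fwd HomD[OF f] by simp
      have o: "X' \<in> Ob C" "X \<in> Ob C" using Hom_Ob[OF C f] by auto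
      have "FA P (r X) \<star> (FA P f \<star> ?u) = FA P (r X \<cdot> f) \<star> ?u"
        using comp_assoc[OF H_category u P_Hom[OF f] P_Hom[OF r_Hom[OF o(2)]]] P_comp[OF f r_Hom[OF o(2)]] by simp
      also have "\<dots> = FA P (FA R f) \<star> (FA P (r X') \<star> ?u)"
        unfolding r_natural[OF f] P_comp[OF r_Hom[OF o(1)] R_Hom[OF f]]
        by (rule comp_assoc[OF H_category u P_Hom[OF r_Hom[OF o(1)]] P_Hom[OF R_Hom[OF f]]])
      also have "\<dots> = FA P (FA R f \<cdot> g)" unfolding g(2) P_comp[OF g(1) R_Hom[OF f]] ..
      finally show ?thesis unfolding eq Pf using comp_Hom[OF C g(1) R_Hom[OF f]] by blast
    next
      case (Bwd w)
      with s W_Ar have w: "w \<in> Hom C X X'" "w \<in> W" by (auto simp: Hom_def)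
      have o: "X' \<in> Ob C" "X \<in> Ob C" using Hom_Ob[OF C w(1)] by auto
      let ?v = "zz C W X' [Bwd w] X \<star> ?u"
      have v: "?v \<in> Hom H A X" by (rule comp_Hom[OF H_category u P_inverse(1)[OF w(2,1)]])
      have wv: "FA P w \<star> ?v = ?u"
        by (rule comp_idl'[OF H_category u P_inverse(1)[OF w(2,1)] P_Hom[OF w(1)]])
          (use P_inverse(3)[OF w(2,1)] in simp)
      obtain g' where g': "g' \<in> Hom C A (FO R X)" "heq (FO R X') (FA R w \<cdot> g') g"
        using heq_surj_W[OF R_Hom[OF w(1)] R_W[OF w] fibrant_R[OF o(2)] fibrant_R[OF o(1)] g(1)] by blast
      note PR = P_Hom[OF R_Hom[OF w(1)]]
      note Rg' = comp_Hom[OF C g'(1) R_Hom[OF w(1)]]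
      have "FA P (FA R w) \<star> (FA P (r X) \<star> ?v) = FA P (FA R w \<cdot> r X) \<star> ?v"
        using comp_assoc[OF H_category v P_Hom[OF r_Hom[OF o(2)]] PR] P_comp[OF r_Hom[OF o(2)] R_Hom[OF w(1)]] by simp
      also have "\<dots> = FA P (r X') \<star> (FA P w \<star> ?v)"
        unfolding r_natural[OF w(1), symmetric] P_comp[OF w(1) r_Hom[OF o(1)]]
        by (rule comp_assoc[OF H_category v P_Hom[OF w(1)] P_Hom[OF r_Hom[OF o(1)]]])
      also have "\<dots> = FA P (FA R w \<cdot> g')" unfolding wv g(2) by (rule heq_P[OF g'(2) Rg', symmetric])
      also have "\<dots> = FA P (FA R w) \<star> FA P g'" by (rule P_comp[OF g'(1) R_Hom[OF w(1)]])
      finally have "FA P (r X) \<star> ?v = FA P g'"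
        by (rule P_cancel_left[OF R_W[OF w] R_Hom[OF w(1)] comp_Hom[OF H_category v P_Hom[OF r_Hom[OF o(2)]]] P_Hom[OF g'(1)]])
      then show ?thesis unfolding eq[unfolded Bwd] Bwd using g'(1) by blast
    qed
  qed
  then show ?thesis using assms unfolding Hom_Ho by blast
qed

text \<open>The functor \<open>X \<mapsto> [A, R X]\<close> inverts weak equivalences, hence zigzags act on it.\<close>

definition cls :: "'o \<Rightarrow> 'm \<Rightarrow> 'm set" where
  "cls X x = {y. heq (FO R X) x y}"

text \<open>A backward step takes a preimage instead of choosing a lift, which keeps the function
  total. On genuine homotopy classes the preimage is a single class because weak equivalences are
  bijective on classes; this is the content of \<open>act_Bwd\<close> and
  \<open>classes_W\<close>.\<close>

fun act :: "'m step \<Rightarrow> 'm set \<Rightarrow> 'm set" where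
  "act (Fwd f) c = {y. \<exists>x \<in> c. heq (FO R (cd C f)) (FA R f \<cdot> x) y}"
| "act (Bwd w) c = {x \<in> Hom C A (FO R (dm C w)). FA R w \<cdot> x \<in> c}"

definition classes :: "'o \<Rightarrow> 'm set set" where
  "classes X = cls X ` Hom C A (FO R X)"

lemma cls_eq_iff: "cls X x = cls X y \<longleftrightarrow> heq (FO R X) x y"
  using heq_refl heq_sym heq_trans unfolding cls_def by blast

lemma act_Fwd:
  assumes f: "f \<in> Hom C X Y"
  shows "act (Fwd f) (cls X x) = cls Y (FA R f \<cdot> x)"
proof -
  have "heq (FO R Y) (FA R f \<cdot> x') y \<longleftrightarrow> heq (FO R Y) (FA R f \<cdot> x) y" if "heq (FO R X) x x'" for x' y
    using heq_post[OF R_Hom[OF f] that] heq_sym heq_trans by blast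
  then have "(\<exists>x'. heq (FO R X) x x' \<and> heq (FO R Y) (FA R f \<cdot> x') y) \<longleftrightarrow> heq (FO R Y) (FA R f \<cdot> x) y" for y
    using heq_refl by blast
  then show ?thesis by (simp add: cls_def HomD[OF f])
qed

lemma act_Bwd:
  assumes w: "w \<in> Hom C X Y" "w \<in> W" and x: "x \<in> Hom C A (FO R X)"
  shows "act (Bwd w) (cls Y (FA R w \<cdot> x)) = cls X x"
proof -
  have o: "X \<in> Ob C" "Y \<in> Ob C" using Hom_Ob[OF C w(1)] by auto
  note inj = heq_reflect_W[OF R_Hom[OF w(1)] R_W[OF w] fibrant_R[OF o(1)] fibrant_R[OF o(2)] x]
  have eq: "x' \<in> Hom C A (FO R X) \<and> heq (FO R Y) (FA R w \<cdot> x) (FA R w \<cdot> x') \<longleftrightarrow> heq (FO R X) x x'" for x'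
    using inj heq_post[OF R_Hom[OF w(1)]] heq_Hom[OF _ x] by blast
  show ?thesis by (simp add: cls_def HomD[OF w(1)] eq)
qed

lemma classes_W:
  assumes w: "w \<in> Hom C X Y" "w \<in> W" and c: "c \<in> classes Y"
  shows "\<exists>x \<in> Hom C A (FO R X). c = cls Y (FA R w \<cdot> x)"
proof -
  have o: "X \<in> Ob C" "Y \<in> Ob C" using Hom_Ob[OF C w(1)] by auto
  obtain y where y: "y \<in> Hom C A (FO R Y)" "c = cls Y y" using c unfolding classes_def by blast
  obtain x where "x \<in> Hom C A (FO R X)" "heq (FO R Y) (FA R w \<cdot> x) y"
    using heq_surj_W[OF R_Hom[OF w(1)] R_W[OF w] fibrant_R[OF o(1)] fibrant_R[OF o(2)] y(1)] by blast
  then show ?thesis unfolding y(2) using cls_eq_iff by metis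
qed

lemma acts_classes: "zigzag C W X p Y \<Longrightarrow> c \<in> classes X \<Longrightarrow> fold act p c \<in> classes Y"
proof (induction p arbitrary: X c)
  case Nil
  then show ?case by simp
next
  case (Cons s p)
  show ?case
  proof (cases s)
    case (Fwd f)
    with Cons have f: "f \<in> Hom C X (cd C f)" "zigzag C W (cd C f) p Y" by (auto simp: Hom_def)
    obtain x where x: "x \<in> Hom C A (FO R X)" "c = cls X x" using Cons.prems(2) unfolding classes_def by blast
    have "act s c \<in> classes (cd C f)"
      unfolding Fwd x(2) act_Fwd[OF f(1)] using comp_Hom[OF C x(1) R_Hom[OF f(1)]] by (simp add: classes_def)
    then show ?thesis using Cons.IH[OF f(2)] by simp
  next
    case (Bwd w)
    with Cons W_Ar have w: "w \<in> Hom C (dm C w) X" "w \<in> W" "zigzag C W (dm C w) p Y" by (auto simp: Hom_def)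
    obtain x where x: "x \<in> Hom C A (FO R (dm C w))" "c = cls X (FA R w \<cdot> x)"
      using classes_W[OF w(1,2) Cons.prems(2)] by blast
    have "act s c \<in> classes (dm C w)"
      unfolding Bwd x(2) act_Bwd[OF w(1,2) x(1)] using x(1) by (simp add: classes_def)
    then show ?thesis using Cons.IH[OF w(3)] by simp
  qed
qed

text \<open>Each defining relation of the localization is checked on the class reached after the
  common prefix \<open>l\<close>. By \<open>acts_classes\<close> this is a genuine homotopy class,
  so it has a representative to which \<open>act_Fwd\<close> and \<open>act_Bwd\<close>
  apply.\<close>

lemma acts_step:
  assumes st: "zigzag_step C W p q" and p: "zigzag C W X p Y" and c: "c \<in> classes X"
  shows "fold act p c = fold act q c"
  using st
proof (cases rule: zigzag_step.cases)
  case (1 x l s)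
  then obtain X' Y' where X': "zigzag C W X l X'" "zigzag C W X' [Fwd (idt C x)] Y'"
    using p zigzag_append[OF C W_Ar] by metis
  have i: "idt C x \<in> Hom C x x" by (rule idt_Hom[OF C 1(3)])
  then have "X' = x" using X'(2) by (simp add: Hom_def)
  then have "fold act l c \<in> classes x" using acts_classes[OF X'(1) c] by simp
  then obtain y where y: "y \<in> Hom C A (FO R x)" "fold act l c = cls x y" unfolding classes_def by blast
  have "act (Fwd (idt C x)) (fold act l c) = fold act l c"
    unfolding y(2) act_Fwd[OF i] functor_idt[OF R_functor 1(3)] comp_idl[OF C y(1)] ..
  then show ?thesis using 1 by simp
next
  case (2 f g l s)
  then obtain X' Y' where X': "zigzag C W X l X'" "zigzag C W X' [Fwd f, Fwd g] Y'"
    using p zigzag_append[OF C W_Ar] by metis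
  then have X'f: "X' = dm C f" by simp
  then have f: "f \<in> Hom C X' (cd C f)" and g: "g \<in> Hom C (cd C f) (cd C g)" using 2(3-5) by (auto simp: Hom_def)
  obtain y where y: "y \<in> Hom C A (FO R X')" "fold act l c = cls X' y"
    using acts_classes[OF X'(1) c] unfolding classes_def by blast
  have "act (Fwd g) (act (Fwd f) (fold act l c)) = act (Fwd (g \<cdot> f)) (fold act l c)"
    unfolding y(2) act_Fwd[OF f] act_Fwd[OF g] act_Fwd[OF comp_Hom[OF C f g]] functor_comp[OF R_functor f g]
      comp_assoc[OF C y(1) R_Hom[OF f] R_Hom[OF g]] ..
  then show ?thesis using 2 by simp
next
  case (3 w l s)
  then obtain X' Y' where X': "zigzag C W X l X'" "zigzag C W X' [Fwd w, Bwd w] Y'"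
    using p zigzag_append[OF C W_Ar] by metis
  then have w: "w \<in> Hom C X' (cd C w)" "w \<in> W" using 3(3) by (auto simp: Hom_def)
  obtain y where y: "y \<in> Hom C A (FO R X')" "fold act l c = cls X' y"
    using acts_classes[OF X'(1) c] unfolding classes_def by blast
  have "act (Bwd w) (act (Fwd w) (fold act l c)) = fold act l c"
    unfolding y(2) act_Fwd[OF w(1)] act_Bwd[OF w y(1)] ..
  then show ?thesis using 3 by simp
next
  case (4 w l s)
  then obtain X' Y' where X': "zigzag C W X l X'" "zigzag C W X' [Bwd w, Fwd w] Y'"
    using p zigzag_append[OF C W_Ar] by metis
  then have w: "w \<in> Hom C (dm C w) X'" "w \<in> W" using 4(3) W_Ar by (auto simp: Hom_def)
  obtain y where y: "y \<in> Hom C A (FO R (dm C w))" "fold act l c = cls X' (FA R w \<cdot> y)"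
    using classes_W[OF w acts_classes[OF X'(1) c]] by blast
  have "act (Fwd w) (act (Bwd w) (fold act l c)) = fold act l c"
    unfolding y(2) act_Bwd[OF w y(1)] act_Fwd[OF w(1)] ..
  then show ?thesis using 4 by simp
qed

lemma acts_zeq:
  assumes "zeq C W X Y p q" "c \<in> classes X"
  shows "fold act p c = fold act q c"
  using assms(1) unfolding zeq_def
proof (induction rule: equivclp_induct)
  case base
  then show ?case by simp
next
  case (step y z)
  have *: "fold act a c = fold act b c" if "zigzag C W X a Y \<and> zigzag C W X b Y \<and> zigzag_step C W a b" for a b
    by (rule acts_step[OF _ _ assms(2), of a b Y]) (use that in simp_all)
  have "fold act y c = fold act z c" using step(2) by (elim disjE) (rule *, assumption, rule *[symmetric], assumption)
  with step(3) show ?case by (rule trans)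
qed

text \<open>Evaluation at the class of \<open>r A\<close>, in the manner of the Yoneda lemma: by
  naturality \<open>g\<close> sends it to the class of \<open>r X \<cdot> g\<close>. Equality in
  \<open>Ho\<close> thus gives a homotopy after composing with \<open>r X\<close>, and as
  \<open>X\<close> is fibrant this weak equivalence can be cancelled.\<close>

lemma Ho_faithful:
  assumes X: "fibrant X" and g: "g \<in> Hom C A X" and h: "h \<in> Hom C A X" and e: "FA P g = FA P h"
  shows "heq X g h"
proof -
  have XO: "X \<in> Ob C" using X by (simp add: fibrant_def)
  have z: "zigzag C W A [Fwd g] X" "zigzag C W A [Fwd h] X" using g h XO by (auto simp: Hom_def)
  have "zz C W A [Fwd g] X = zz C W A [Fwd h] X" using e HomD[OF g] HomD[OF h] by simp
  then have "zeq C W A X [Fwd g] [Fwd h]" using zz_eq_iff[OF z] by simp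
  moreover have "cls A (r A) \<in> classes A" using r_Hom[OF A_Ob] by (simp add: classes_def)
  ultimately have "fold act [Fwd g] (cls A (r A)) = fold act [Fwd h] (cls A (r A))" by (rule acts_zeq)
  then have "act (Fwd g) (cls A (r A)) = act (Fwd h) (cls A (r A))" by simp
  then have "heq (FO R X) (r X \<cdot> g) (r X \<cdot> h)"
    unfolding act_Fwd[OF g] act_Fwd[OF h] cls_eq_iff r_natural[OF g] r_natural[OF h] .
  then show ?thesis by (rule heq_reflect_W[OF r_Hom[OF XO] r_W[OF XO] X fibrant_R[OF XO] g h])
qed

text \<open>The relation \<open>heq\<close> is witnessed by a finite chain of homotopies from
  \<open>V\<close> to \<open>K\<close>. Each of them comes from a stage as \<open>V\<close> is
  presentable, consecutive ones meet at a later stage as \<open>A\<close> is presentable, and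
  filteredness joins the finitely many stages involved.\<close>

lemma heq_descend:
  fixes J :: "('u, 'u) cat"
  assumes pA: "presentable U lam C A" and pV: "presentable U lam C V"
    and J: "small_category U J" "filtered lam J" and D: "is_functor J C D" and col: "is_colimit C J D K \<delta>"
    and h: "heq K (\<delta> d \<cdot> g) (\<delta> d \<cdot> g')" and d: "d \<in> Ob J" and g: "g \<in> Hom C A (FO D d)" "g' \<in> Hom C A (FO D d)"
  shows "\<exists>e. \<exists>m \<in> Hom J d e. heq (FO D e) (FA D m \<cdot> g) (FA D m \<cdot> g')"
proof -
  note \<delta> = cocone_Hom[OF colimit_cocone[OF col]] and \<delta>c = cocone_comm[OF colimit_cocone[OF col]]
  note Dm = functor_Hom[OF D]
  have Jc: "category J" using J(2) by (simp add: filtered_def)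
  have same: "\<exists>e m n. m \<in> Hom J a e \<and> n \<in> Hom J b e \<and> FA D m \<cdot> u = FA D n \<cdot> v"
    if ab: "a \<in> Ob J" "b \<in> Ob J" and u: "u \<in> Hom C A (FO D a)" and v: "v \<in> Hom C A (FO D b)" and e: "\<delta> a \<cdot> u = \<delta> b \<cdot> v"
    for a b u v
  proof -
    obtain z m n where z: "z \<in> Ob J" "m \<in> Hom J a z" "n \<in> Hom J b z" using filtered_join[OF J(2) lam ab] by blast
    note mu = comp_Hom[OF C u Dm[OF z(2)]] and nv = comp_Hom[OF C v Dm[OF z(3)]]
    have "\<delta> z \<cdot> (FA D m \<cdot> u) = \<delta> z \<cdot> (FA D n \<cdot> v)"
      unfolding comp_assoc[OF C u Dm[OF z(2)] \<delta>[OF z(1)], symmetric] comp_assoc[OF C v Dm[OF z(3)] \<delta>[OF z(1)], symmetric]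
        \<delta>c[OF z(2)] \<delta>c[OF z(3)] by (rule e)
    from presentable_eq[OF C ls lam pA J D col z(1) mu nv this]
    obtain w k where k: "k \<in> Hom J z w" "FA D k \<cdot> (FA D m \<cdot> u) = FA D k \<cdot> (FA D n \<cdot> v)" by blast
    have "FA D (k \<cdot>\<^bsub>J\<^esub> m) \<cdot> u = FA D (k \<cdot>\<^bsub>J\<^esub> n) \<cdot> v"
      unfolding functor_comp[OF D z(2) k(1)] functor_comp[OF D z(3) k(1)]
        comp_assoc[OF C u Dm[OF z(2)] Dm[OF k(1)]] comp_assoc[OF C v Dm[OF z(3)] Dm[OF k(1)]] by (rule k(2))
    then show ?thesis using comp_Hom[OF Jc z(2) k(1)] comp_Hom[OF Jc z(3) k(1)] by blast
  qed
  have push: "heq (FO D w) (FA D (k \<cdot>\<^bsub>J\<^esub> m) \<cdot> u) (FA D (k \<cdot>\<^bsub>J\<^esub> n) \<cdot> v)"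
    if m: "m \<in> Hom J a e" and n: "n \<in> Hom J b e" and u: "u \<in> Hom C A (FO D a)" and v: "v \<in> Hom C A (FO D b)"
      and k: "k \<in> Hom J e w" and h: "heq (FO D e) (FA D m \<cdot> u) (FA D n \<cdot> v)" for m n k a b e w u v
    unfolding functor_comp[OF D m k] functor_comp[OF D n k] comp_assoc[OF C u Dm[OF m] Dm[OF k]]
      comp_assoc[OF C v Dm[OF n] Dm[OF k]] by (rule heq_post[OF Dm[OF k] h])
  \<comment> \<open>The invariant quantifies over all representatives \<open>v\<close> of the
    current endpoint, so consecutive homotopies may be represented at unrelated stages.\<close>
  let ?Q = "\<lambda>y. \<forall>b v. b \<in> Ob J \<longrightarrow> v \<in> Hom C A (FO D b) \<longrightarrow> \<delta> b \<cdot> v = y \<longrightarrow>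
      (\<exists>e m n. m \<in> Hom J d e \<and> n \<in> Hom J b e \<and> heq (FO D e) (FA D m \<cdot> g) (FA D n \<cdot> v))"
  \<comment> \<open>\<open>\<epsilon>\<close> and \<open>\<epsilon>'\<close> stand for the ends of
    the cylinder in either order, so one argument serves homotopies traversed forward and
    backward.\<close>
  have step: "?Q z" if Q: "?Q y" and h: "h \<in> Hom C V K" "h \<cdot> \<epsilon> = y" "h \<cdot> \<epsilon>' = z"
    and \<epsilon>: "\<epsilon> \<in> Hom C A V" "\<epsilon>' \<in> Hom C A V"
    and he: "\<And>X k. k \<in> Hom C V X \<Longrightarrow> heq X (k \<cdot> \<epsilon>) (k \<cdot> \<epsilon>')" for y z h \<epsilon> \<epsilon>'
  proof (intro allI impI)
    fix b v assume b: "b \<in> Ob J" and v: "v \<in> Hom C A (FO D b)" and z: "\<delta> b \<cdot> v = z"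
    obtain c k where c: "c \<in> Ob J" and k: "k \<in> Hom C V (FO D c)" "\<delta> c \<cdot> k = h"
      using presentable_factor[OF C ls pV J D col h(1)] by blast
    note ke = comp_Hom[OF C \<epsilon>(1) k(1)] and ke' = comp_Hom[OF C \<epsilon>(2) k(1)]
    have cy: "\<delta> c \<cdot> (k \<cdot> \<epsilon>) = y" "\<delta> c \<cdot> (k \<cdot> \<epsilon>') = z"
      unfolding comp_assoc[OF C \<epsilon>(1) k(1) \<delta>[OF c], symmetric] comp_assoc[OF C \<epsilon>(2) k(1) \<delta>[OF c], symmetric] k(2)
      by (fact h(2,3))+
    obtain e m n where m: "m \<in> Hom J d e" "n \<in> Hom J c e" "heq (FO D e) (FA D m \<cdot> g) (FA D n \<cdot> (k \<cdot> \<epsilon>))"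
      using Q[rule_format, OF c ke cy(1)] by blast
    have "\<delta> c \<cdot> (k \<cdot> \<epsilon>') = \<delta> b \<cdot> v" using cy(2) z by simp
    from same[OF c b ke' v this] obtain e' m' n' where m': "m' \<in> Hom J c e'" "n' \<in> Hom J b e'"
      "FA D m' \<cdot> (k \<cdot> \<epsilon>') = FA D n' \<cdot> v" by blast
    \<comment> \<open>The chain built so far and the comparison with \<open>v\<close> use different
      arrows out of \<open>c\<close>; closing this span brings both to one stage.\<close>
    obtain w p q where w: "p \<in> Hom J e w" "q \<in> Hom J e' w" "p \<cdot>\<^bsub>J\<^esub> n = q \<cdot>\<^bsub>J\<^esub> m'"
      using filtered_span[OF J(2) lam m(2) m'(1)] by blast
    note pn = comp_Hom[OF Jc m(2) w(1)]
    have 1: "heq (FO D w) (FA D (p \<cdot>\<^bsub>J\<^esub> m) \<cdot> g) (FA D (p \<cdot>\<^bsub>J\<^esub> n) \<cdot> (k \<cdot> \<epsilon>))"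
      by (rule push[OF m(1,2) g(1) ke w(1) m(3)])
    have 2: "heq (FO D w) (FA D (p \<cdot>\<^bsub>J\<^esub> n) \<cdot> (k \<cdot> \<epsilon>)) (FA D (p \<cdot>\<^bsub>J\<^esub> n) \<cdot> (k \<cdot> \<epsilon>'))"
      by (rule heq_post[OF Dm[OF pn] he[OF k(1)]])
    have 3: "heq (FO D w) (FA D (p \<cdot>\<^bsub>J\<^esub> n) \<cdot> (k \<cdot> \<epsilon>')) (FA D (q \<cdot>\<^bsub>J\<^esub> n') \<cdot> v)"
      unfolding w(3) by (rule push[OF m'(1,2) ke' v w(2)]) (simp only: m'(3) heq_refl)
    show "\<exists>e m n. m \<in> Hom J d e \<and> n \<in> Hom J b e \<and> heq (FO D e) (FA D m \<cdot> g) (FA D n \<cdot> v)"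
      using heq_trans[OF 1 heq_trans[OF 2 3]] comp_Hom[OF Jc m(1) w(1)] comp_Hom[OF Jc m'(2) w(2)] by blast
  qed
  have he: "heq X (k \<cdot> e0) (k \<cdot> e1)" if "k \<in> Hom C V X" for X k
    by (rule htp_heq) (use that in \<open>auto simp: htp_def\<close>)
  have "?Q (\<delta> d \<cdot> g')"
    using h
  proof (induction rule: heq_induct)
    case base
    show ?case
    proof (intro allI impI)
      fix b v assume b: "b \<in> Ob J" and v: "v \<in> Hom C A (FO D b)" and e: "\<delta> b \<cdot> v = \<delta> d \<cdot> g"
      from same[OF d b g(1) v e[symmetric]] obtain e m n where m: "m \<in> Hom J d e" "n \<in> Hom J b e"
        "FA D m \<cdot> g = FA D n \<cdot> v" by blast
      have "heq (FO D e) (FA D m \<cdot> g) (FA D n \<cdot> v)" unfolding m(3) by (rule heq_refl)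
      then show "\<exists>e m n. m \<in> Hom J d e \<and> n \<in> Hom J b e \<and> heq (FO D e) (FA D m \<cdot> g) (FA D n \<cdot> v)"
        using m by blast
    qed
  next
    case (fwd y z)
    obtain k where k: "k \<in> Hom C V K" "k \<cdot> e0 = y" "k \<cdot> e1 = z" using fwd(2) unfolding htp_def by blast
    show ?case by (rule step[OF fwd(3) k ends(1,2) he])
  next
    case (bwd y z)
    obtain k where k: "k \<in> Hom C V K" "k \<cdot> e1 = y" "k \<cdot> e0 = z" using bwd(2) unfolding htp_def by blast
    show ?case by (rule step[OF bwd(3) k ends(2,1) heq_sym[OF he]])
  qed
  then obtain e m n where e: "m \<in> Hom J d e" "n \<in> Hom J d e" "heq (FO D e) (FA D m \<cdot> g) (FA D n \<cdot> g')"
    using d g(2) by blast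
  \<comment> \<open>The two arrows from \<open>d\<close> to \<open>e\<close> may differ;
    coequalizing them yields the single arrow that is asked for.\<close>
  obtain w k where k: "k \<in> Hom J e w" "k \<cdot>\<^bsub>J\<^esub> m = k \<cdot>\<^bsub>J\<^esub> n"
    using filtered_coequalize[OF J(2) lam e(1,2)] by blast
  have "heq (FO D w) (FA D (k \<cdot>\<^bsub>J\<^esub> m) \<cdot> g) (FA D (k \<cdot>\<^bsub>J\<^esub> m) \<cdot> g')"
    using push[OF e(1,2) g k(1) e(3)] unfolding k(2) .
  then show ?thesis using comp_Hom[OF Jc e(1) k(1)] by blast
qed

text \<open>After composing with \<open>r K\<close>, the arrow \<open>u\<close> is represented by a
  map into \<open>FO R K\<close>. This object is the colimit of \<open>R\<close> applied to the
  diagram, so the map comes from some stage, and inverting \<open>r\<close> there in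
  \<open>Ho\<close> yields the factor.\<close>

lemma Ho_factor_cofibrant:
  fixes J :: "('u, 'u) cat"
  assumes pA: "presentable U lam C A"
    and J: "small_category U J" "filtered lam J" and D: "is_functor J C D" and col: "is_colimit C J D K \<delta>"
    and u: "u \<in> Hom H A K"
  shows "\<exists>d \<in> Ob J. \<exists>v \<in> Hom H A (FO D d). FA P (\<delta> d) \<star> v = u"
proof -
  note \<delta> = cocone_Hom[OF colimit_cocone[OF col]]
  have K: "K \<in> Ob C" using colimit_cocone[OF col] by (simp add: is_cocone_def)
  obtain g where g: "g \<in> Hom C A (FO R K)" "FA P (r K) \<star> u = FA P g" using Ho_full[OF u] by blast
  obtain d g' where d: "d \<in> Ob J" and g': "g' \<in> Hom C A (FO R (FO D d))" "FA R (\<delta> d) \<cdot> g' = g"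
    using presentable_factor[OF C ls pA J is_functor_comp[OF D R_functor] R_preserves[OF J D col] g(1)] by auto
  have o: "FO D d \<in> Ob C" by (rule functor_Ob[OF D d])
  let ?X = "FO D d"
  note rH = r_Hom[OF o] and rW = r_W[OF o]
  let ?v = "zz C W (FO R ?X) [Bwd (r ?X)] ?X \<star> FA P g'"
  have v: "?v \<in> Hom H A ?X" by (rule comp_Hom[OF H_category P_Hom[OF g'(1)] P_inverse(1)[OF rW rH]])
  have rv: "FA P (r ?X) \<star> ?v = FA P g'"
    by (rule comp_idl'[OF H_category P_Hom[OF g'(1)] P_inverse(1)[OF rW rH] P_Hom[OF rH] P_inverse(3)[OF rW rH]])
  note \<delta>d = \<delta>[OF d]
  have "FA P (r K) \<star> (FA P (\<delta> d) \<star> ?v) = FA P (r K \<cdot> \<delta> d) \<star> ?v"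
    unfolding P_comp[OF \<delta>d r_Hom[OF K]] by (rule comp_assoc[OF H_category v P_Hom[OF \<delta>d] P_Hom[OF r_Hom[OF K]], symmetric])
  also have "\<dots> = FA P (FA R (\<delta> d)) \<star> FA P g'"
    unfolding r_natural[OF \<delta>d] P_comp[OF rH R_Hom[OF \<delta>d]] comp_assoc[OF H_category v P_Hom[OF rH] P_Hom[OF R_Hom[OF \<delta>d]]] rv ..
  also have "\<dots> = FA P (r K) \<star> u" unfolding P_comp[OF g'(1) R_Hom[OF \<delta>d], symmetric] g'(2) g(2) ..
  finally have "FA P (\<delta> d) \<star> ?v = u"
    by (rule P_cancel_left[OF r_W[OF K] r_Hom[OF K] comp_Hom[OF H_category v P_Hom[OF \<delta>d]] u])
  then show ?thesis using d v by blast
qed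

text \<open>The equation in \<open>Ho\<close> becomes, by \<open>Ho_faithful\<close>, a homotopy
  between maps into the fibrant object \<open>FO R K\<close>. It descends along \<open>R\<close>
  applied to the diagram, and cancelling \<open>r\<close> at the later stage gives an equation in
  \<open>Ho\<close> again.\<close>

lemma Ho_eq_cofibrant:
  fixes J :: "('u, 'u) cat"
  assumes pA: "presentable U lam C A" and pV: "presentable U lam C V"
    and J: "small_category U J" "filtered lam J" and D: "is_functor J C D" and col: "is_colimit C J D K \<delta>"
    and d: "d \<in> Ob J" and u: "u \<in> Hom H A (FO D d)" and v: "v \<in> Hom H A (FO D d)"
    and e: "FA P (\<delta> d) \<star> u = FA P (\<delta> d) \<star> v"
  shows "\<exists>e. \<exists>m \<in> Hom J d e. FA P (FA D m) \<star> u = FA P (FA D m) \<star> v"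
proof -
  note \<delta> = cocone_Hom[OF colimit_cocone[OF col]]
  have K: "K \<in> Ob C" using colimit_cocone[OF col] by (simp add: is_cocone_def)
  have Jc: "category J" using J(2) by (simp add: filtered_def)
  have o: "FO D d \<in> Ob C" by (rule functor_Ob[OF D d])
  have move: "FA P (r Y) \<star> (FA P f \<star> x) = FA P (FA R f \<cdot> k)"
    if f: "f \<in> Hom C X Y" and x: "x \<in> Hom H A X" and k: "k \<in> Hom C A (FO R X)" "FA P (r X) \<star> x = FA P k" for X Y f x k
  proof -
    have XY: "X \<in> Ob C" "Y \<in> Ob C" using Hom_Ob[OF C f] by auto
    have "FA P (r Y) \<star> (FA P f \<star> x) = FA P (r Y \<cdot> f) \<star> x"
      unfolding P_comp[OF f r_Hom[OF XY(2)]]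
      by (rule comp_assoc[OF H_category x P_Hom[OF f] P_Hom[OF r_Hom[OF XY(2)]], symmetric])
    also have "\<dots> = FA P (FA R f) \<star> FA P k"
      unfolding r_natural[OF f] P_comp[OF r_Hom[OF XY(1)] R_Hom[OF f]]
        comp_assoc[OF H_category x P_Hom[OF r_Hom[OF XY(1)]] P_Hom[OF R_Hom[OF f]]] k(2) ..
    finally show ?thesis unfolding P_comp[OF k(1) R_Hom[OF f]] .
  qed
  obtain g where g: "g \<in> Hom C A (FO R (FO D d))" "FA P (r (FO D d)) \<star> u = FA P g" using Ho_full[OF u] by blast
  obtain h where h: "h \<in> Hom C A (FO R (FO D d))" "FA P (r (FO D d)) \<star> v = FA P h" using Ho_full[OF v] by blast
  have "FA P (FA R (\<delta> d) \<cdot> g) = FA P (FA R (\<delta> d) \<cdot> h)"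
    unfolding move[OF \<delta>[OF d] u g, symmetric] move[OF \<delta>[OF d] v h, symmetric] e ..
  then have "heq (FO R K) (FA R (\<delta> d) \<cdot> g) (FA R (\<delta> d) \<cdot> h)"
    by (rule Ho_faithful[OF fibrant_R[OF K] comp_Hom[OF C g(1) R_Hom[OF \<delta>[OF d]]] comp_Hom[OF C h(1) R_Hom[OF \<delta>[OF d]]]])
  from heq_descend[OF pA pV J is_functor_comp[OF D R_functor] R_preserves[OF J D col] this d] g(1) h(1)
  obtain e m where m: "m \<in> Hom J d e" "heq (FO R (FO D e)) (FA R (FA D m) \<cdot> g) (FA R (FA D m) \<cdot> h)" by auto
  note Dm = functor_Hom[OF D m(1)]
  have eO: "FO D e \<in> Ob C" using Hom_Ob[OF C Dm] by simp
  have "FA P (r (FO D e)) \<star> (FA P (FA D m) \<star> u) = FA P (r (FO D e)) \<star> (FA P (FA D m) \<star> v)"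
    unfolding move[OF Dm u g] move[OF Dm v h] by (rule heq_P[OF m(2) comp_Hom[OF C g(1) R_Hom[OF Dm]]])
  then have "FA P (FA D m) \<star> u = FA P (FA D m) \<star> v"
    by (rule P_cancel_left[OF r_W[OF eO] r_Hom[OF eO] comp_Hom[OF H_category u P_Hom[OF Dm]] comp_Hom[OF H_category v P_Hom[OF Dm]]])
  then show ?thesis using m(1) by blast
qed

end

context strong_comb
begin

text \<open>\<open>A\<close> is isomorphic in \<open>Ho\<close> to a presentable cofibrant object,
  so the cofibrant case carries over by composing with \<open>FA P q\<close> and its
  inverse.\<close>

lemma Ho_factor:
  fixes J :: "('u, 'u) cat"
  assumes pA: "presentable U lam C A"
    and J: "small_category U J" "filtered lam J" and D: "is_functor J C D" and col: "is_colimit C J D K \<delta>"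
    and u: "u \<in> Hom H A K"
  shows "\<exists>d \<in> Ob J. \<exists>v \<in> Hom H A (FO D d). FA P (\<delta> d) \<star> v = u"
proof -
  have A: "A \<in> Ob C" using pA by (simp add: presentable_def)
  obtain Q q where Q: "q \<in> Hom C Q A" "q \<in> W" "cofibrant Q" "presentable U lam C Q"
    using cofibrant_replacement[OF A] pA by blast
  then obtain V e0 e1 t where V: "cylinder Q V e0 e1 t"
    using cylinder_exists[of Q] unfolding cofibrant_def by blast
  interpret cyl U lam C M Q V e0 e1 t using Q(3) V by unfold_locales
  note Pq = P_Hom[OF Q(1)]
  obtain d v where d: "d \<in> Ob J" and v: "v \<in> Hom H Q (FO D d)" "FA P (\<delta> d) \<star> v = u \<star> FA P q"
    using Ho_factor_cofibrant[OF Q(4) J D col comp_Hom[OF H_category Pq u]] by blast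
  let ?i = "zz C W A [Bwd q] Q"
  note i = P_inverse[OF Q(2,1)]
  note P\<delta> = P_Hom[OF cocone_Hom[OF colimit_cocone[OF col] d]]
  have "FA P (\<delta> d) \<star> (v \<star> ?i) = u"
    unfolding comp_assoc[OF H_category i(1) v(1) P\<delta>, symmetric] v(2) comp_assoc[OF H_category i(1) Pq u] i(3)
    by (rule comp_idr[OF H_category u])
  then show ?thesis using d comp_Hom[OF H_category i(1) v(1)] by blast
qed

lemma Ho_eq:
  fixes J :: "('u, 'u) cat"
  assumes pA: "presentable U lam C A"
    and J: "small_category U J" "filtered lam J" and D: "is_functor J C D" and col: "is_colimit C J D K \<delta>"
    and d: "d \<in> Ob J" and u: "u \<in> Hom H A (FO D d)" and v: "v \<in> Hom H A (FO D d)"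
    and e: "FA P (\<delta> d) \<star> u = FA P (\<delta> d) \<star> v"
  shows "\<exists>e. \<exists>m \<in> Hom J d e. FA P (FA D m) \<star> u = FA P (FA D m) \<star> v"
proof -
  have A: "A \<in> Ob C" using pA by (simp add: presentable_def)
  obtain Q q where Q: "q \<in> Hom C Q A" "q \<in> W" "cofibrant Q" "presentable U lam C Q"
    using cofibrant_replacement[OF A] pA by blast
  then obtain V e0 e1 t where V: "cylinder Q V e0 e1 t" "presentable U lam C V"
    using cylinder_exists[of Q] unfolding cofibrant_def by blast
  interpret cyl U lam C M Q V e0 e1 t using Q(3) V(1) by unfold_locales
  note Pq = P_Hom[OF Q(1)]
  note P\<delta> = P_Hom[OF cocone_Hom[OF colimit_cocone[OF col] d]]
  have "FA P (\<delta> d) \<star> (u \<star> FA P q) = FA P (\<delta> d) \<star> (v \<star> FA P q)"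
    unfolding comp_assoc[OF H_category Pq u P\<delta>, symmetric] comp_assoc[OF H_category Pq v P\<delta>, symmetric] e ..
  from Ho_eq_cofibrant[OF Q(4) V(2) J D col d comp_Hom[OF H_category Pq u] comp_Hom[OF H_category Pq v] this]
  obtain e m where m: "m \<in> Hom J d e"
    "FA P (FA D m) \<star> (u \<star> FA P q) = FA P (FA D m) \<star> (v \<star> FA P q)" by blast
  note PD = P_Hom[OF functor_Hom[OF D m(1)]]
  have "(FA P (FA D m) \<star> u) \<star> FA P q = (FA P (FA D m) \<star> v) \<star> FA P q"
    unfolding comp_assoc[OF H_category Pq u PD] comp_assoc[OF H_category Pq v PD] by (rule m(2))
  then have "FA P (FA D m) \<star> u = FA P (FA D m) \<star> v"
    by (rule P_cancel_right[OF Q(2,1) comp_Hom[OF H_category u PD] comp_Hom[OF H_category v PD]])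
  then show ?thesis using m(1) by blast
qed

text \<open>Smallness of the hom-sets of a localization is not automatic. Here an arrow is recovered
  from a map of \<open>C\<close> from \<open>Q\<close> to \<open>FO R X\<close> that represents it,
  so the hom-set injects into a small one. This allows presheaves of small sets on
  \<open>Ho_presentables\<close>.\<close>

lemma Ho_small:
  assumes A: "A \<in> Ob C" and X: "X \<in> Ob C"
  shows "small U (Hom H A X)"
proof -
  obtain Q q where Q: "q \<in> Hom C Q A" "q \<in> W" "cofibrant Q" using cofibrant_replacement[OF A] by blast
  then obtain V e0 e1 t where V: "cylinder Q V e0 e1 t"
    using cylinder_exists[of Q] unfolding cofibrant_def by blast
  interpret cyl U lam C M Q V e0 e1 t using Q(3) V by unfold_locales
  note Pq = P_Hom[OF Q(1)] and Pr = P_Hom[OF r_Hom[OF X]]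
  have "\<exists>g \<in> Hom C Q (FO R X). FA P (r X) \<star> (u \<star> FA P q) = FA P g" if "u \<in> Hom H A X" for u
    by (rule Ho_full[OF comp_Hom[OF H_category Pq that]])
  then obtain G where G: "\<And>u. u \<in> Hom H A X \<Longrightarrow> G u \<in> Hom C Q (FO R X)"
    "\<And>u. u \<in> Hom H A X \<Longrightarrow> FA P (r X) \<star> (u \<star> FA P q) = FA P (G u)" by metis
  have "inj_on G (Hom H A X)"
  proof (rule inj_onI)
    fix u v assume u: "u \<in> Hom H A X" and v: "v \<in> Hom H A X" and e: "G u = G v"
    have "FA P (r X) \<star> (u \<star> FA P q) = FA P (r X) \<star> (v \<star> FA P q)"
      unfolding G(2)[OF u] G(2)[OF v] e ..
    then have "u \<star> FA P q = v \<star> FA P q"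
      by (rule P_cancel_left[OF r_W[OF X] r_Hom[OF X] comp_Hom[OF H_category Pq u] comp_Hom[OF H_category Pq v]])
    then show "u = v" by (rule P_cancel_right[OF Q(2,1) u v])
  qed
  then have "|Hom H A X| \<le>o |Hom C Q (FO R X)|"
    using G(1) card_of_ordLeq[of "Hom H A X" "Hom C Q (FO R X)"] by blast
  moreover have "|Hom C Q (FO R X)| <o U"
    using ls R_Ob[OF X] A_Ob unfolding locally_small_def small_def by blast
  ultimately show ?thesis unfolding small_def by (rule ordLeq_ordLess_trans)
qed

end

section \<open>The restricted Yoneda functor\<close>

lemma restricted_yoneda_simps:
  "FO (restricted_yoneda C A) = hom_presheaf C A"
  "FA (restricted_yoneda C A) f =
     (hom_presheaf C A (dm C f), restrict (\<lambda>a. FA (hom_functor C a) f) (Ob A), hom_presheaf C A (cd C f))"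
  by (simp_all add: restricted_yoneda_def)

lemma FO_hom_presheaf: "a \<in> Ob A \<Longrightarrow> FO (hom_presheaf C A X) a = Hom C a X"
  by (simp add: hom_presheaf_def)

lemma hom_functor_Hom:
  assumes "category C" "f \<in> Hom C X Y" "small U (Hom C a X)" "small U (Hom C a Y)"
  shows "FA (hom_functor C a) f \<in> Hom (set_cat U) (Hom C a X) (Hom C a Y)"
  using assms HomD[OF assms(2)] comp_Hom[OF assms(1) _ assms(2)] by (auto simp: Hom_set_cat)

lemma ap_hom_functor: "f \<in> Hom C X Y \<Longrightarrow> h \<in> Hom C a X \<Longrightarrow> ap (FA (hom_functor C a) f) h = f \<cdot>\<^bsub>C\<^esub> h"
  by (auto simp: Hom_def)

locale full_small_subcat =
  fixes U :: "'u rel" and C :: "('o, 'm) cat" and S :: "'o set"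
  assumes C: "category C" and small_Hom: "\<And>a X. a \<in> Ob C \<Longrightarrow> X \<in> Ob C \<Longrightarrow> small U (Hom C a X)"
begin

abbreviation "A \<equiv> full_subcat C S"
abbreviation "Y \<equiv> restricted_yoneda C A"
abbreviation "PSh \<equiv> presheaf_cat U A"

lemma A_Hom: "f \<in> Hom A a b \<Longrightarrow> f \<in> Hom C a b \<and> a \<in> Ob A \<and> b \<in> Ob A"
  using Hom_full_subcatD[of f C S a b] Hom_Ob[OF C, of f a b] by simp

lemma FA_hom_presheaf:
  assumes "f \<in> Hom A a b"
  shows "FA (hom_presheaf C A X) f = (Hom C b X, restrict (\<lambda>h. h \<cdot>\<^bsub>C\<^esub> f) (Hom C b X), Hom C a X)"
  using assms by (auto simp: hom_presheaf_def Hom_def)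

lemma hom_presheaf_functor:
  assumes X: "X \<in> Ob C"
  shows "is_functor (op_cat A) (set_cat U) (hom_presheaf C A X)"
proof -
  let ?F = "hom_presheaf C A X"
  have FA: "FA ?F f \<in> Hom (set_cat U) (Hom C b X) (Hom C a X)" if f: "f \<in> Hom A a b" for f a b
    using small_Hom[OF _ X] A_Hom[OF f] comp_Hom[OF C] unfolding FA_hom_presheaf[OF f]
    by (auto simp: Hom_set_cat)
  have ap: "ap (FA ?F f) h = h \<cdot>\<^bsub>C\<^esub> f" if "f \<in> Hom A a b" "h \<in> Hom C b X" for f a b h
    unfolding FA_hom_presheaf[OF that(1)] using that(2) by simp
  have Ac: "category A" by (rule category_full_subcat[OF C])
  show ?thesis
    unfolding is_functor_def
  proof (intro conjI ballI impI)
    fix f assume "f \<in> Ar (op_cat A)"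
    then have f: "f \<in> Hom A (dm C f) (cd C f)" by (simp add: Hom_def)
    have o: "dm C f \<in> Ob A" "cd C f \<in> Ob A" using A_Hom[OF f] by auto
    show "FA ?F f \<in> Hom (set_cat U) (FO ?F (dm (op_cat A) f)) (FO ?F (cd (op_cat A) f))"
      using FA[OF f] FO_hom_presheaf[OF o(1)] FO_hom_presheaf[OF o(2)] by simp
    fix g assume "g \<in> Ar (op_cat A)" "dm (op_cat A) g = cd (op_cat A) f"
    then have g: "g \<in> Hom A (dm C g) (dm C f)" by (simp add: Hom_def)
    have fg: "f \<cdot>\<^bsub>C\<^esub> g \<in> Hom A (dm C g) (cd C f)" using comp_Hom[OF Ac g f] by simp
    have fC: "f \<in> Hom C (dm C f) (cd C f)" and gC: "g \<in> Hom C (dm C g) (dm C f)" using A_Hom[OF f] A_Hom[OF g] by auto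
    have "FA ?F g \<cdot>\<^bsub>set_cat U\<^esub> FA ?F f = FA ?F (f \<cdot>\<^bsub>C\<^esub> g)"
    proof (rule comp_set_cat_eqI[OF FA[OF f] FA[OF g] FA[OF fg]])
      fix h assume h: "h \<in> Hom C (cd C f) X"
      show "ap (FA ?F g) (ap (FA ?F f) h) = ap (FA ?F (f \<cdot>\<^bsub>C\<^esub> g)) h"
        unfolding ap[OF f h] ap[OF g comp_Hom[OF C fC h]] ap[OF fg h] by (rule comp_assoc[OF C gC fC h])
    qed
    then show "FA ?F (g \<cdot>\<^bsub>op_cat A\<^esub> f) = FA ?F g \<cdot>\<^bsub>set_cat U\<^esub> FA ?F f" by simp
  next
    fix a assume a: "a \<in> Ob (op_cat A)"
    then have aC: "a \<in> Ob C" and aA: "a \<in> Ob A" by auto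
    show "FO ?F a \<in> Ob (set_cat U)" using small_Hom[OF aC X] FO_hom_presheaf[OF aA] by simp
    have i: "idt C a \<in> Hom A a a" using idt_Hom[OF Ac aA] by simp
    show "FA ?F (idt (op_cat A) a) = idt (set_cat U) (FO ?F a)"
      using FA_hom_presheaf[OF i] FO_hom_presheaf[OF aA] comp_idr[OF C] by (auto intro!: restrict_ext)
  qed (use Ac category_op_cat category_set_cat in auto)
qed

lemma hom_presheaf_Ob:
  assumes "X \<in> Ob C"
  shows "hom_presheaf C A X \<in> Ob PSh"
  using hom_presheaf_functor[OF assms]
  by (simp add: presheaf_cat_def functor_cat_def Let_def hom_presheaf_def)

lemma Hom_PSh: "\<eta> \<in> Hom PSh F G \<longleftrightarrow> (\<exists>\<theta>. \<eta> = (F, \<theta>, G) \<and> F \<in> Ob PSh \<and> G \<in> Ob PSh \<and>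
    natural (op_cat A) (set_cat U) F G \<theta> \<and> \<theta> \<in> extensional (Ob A))"
  by (cases \<eta>) (auto simp: presheaf_cat_def functor_cat_def Hom_def)

lemma comp_PSh: "(G', \<theta>, K) \<cdot>\<^bsub>PSh\<^esub> (F, \<eta>, G) = (F, restrict (\<lambda>x. \<theta> x \<cdot>\<^bsub>set_cat U\<^esub> \<eta> x) (Ob A), K)"
  by (simp add: presheaf_cat_def functor_cat_def Let_def)

lemma yoneda_Hom:
  assumes f: "f \<in> Hom C X Z"
  shows "FA Y f \<in> Hom PSh (FO Y X) (FO Y Z)"
proof -
  have o: "X \<in> Ob C" "Z \<in> Ob C" using Hom_Ob[OF C f] by auto
  have H: "FA (hom_functor C a) f \<in> Hom (set_cat U) (Hom C a X) (Hom C a Z)" if "a \<in> Ob C" for a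
    by (rule hom_functor_Hom[OF C f small_Hom[OF that o(1)] small_Hom[OF that o(2)]])
  let ?\<theta> = "restrict (\<lambda>a. FA (hom_functor C a) f) (Ob A)"
  have "natural (op_cat A) (set_cat U) (hom_presheaf C A X) (hom_presheaf C A Z) ?\<theta>"
    unfolding natural_def
  proof (intro conjI ballI)
    fix a assume "a \<in> Ob (op_cat A)"
    then have a: "a \<in> Ob A" "a \<in> Ob C" by auto
    show "?\<theta> a \<in> Hom (set_cat U) (FO (hom_presheaf C A X) a) (FO (hom_presheaf C A Z) a)"
      unfolding FO_hom_presheaf[OF a(1)] restrict_apply' [OF a(1)] by (rule H[OF a(2)])
  next
    fix g assume "g \<in> Ar (op_cat A)"
    then have g: "g \<in> Hom A (dm C g) (cd C g)" by (simp add: Hom_def)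
    let ?a = "dm C g" and ?b = "cd C g"
    have gC: "g \<in> Hom C ?a ?b" and ab: "?a \<in> Ob A" "?b \<in> Ob A" "?a \<in> Ob C" "?b \<in> Ob C" using A_Hom[OF g] by auto
    note FX = functor_Hom[OF hom_presheaf_functor[OF o(1)], of g ?b ?a, simplified Hom_op_cat, OF g,
        unfolded FO_hom_presheaf[OF ab(1)] FO_hom_presheaf[OF ab(2)]]
    note FZ = functor_Hom[OF hom_presheaf_functor[OF o(2)], of g ?b ?a, simplified Hom_op_cat, OF g,
        unfolded FO_hom_presheaf[OF ab(1)] FO_hom_presheaf[OF ab(2)]]
    have "FA (hom_functor C ?a) f \<cdot>\<^bsub>set_cat U\<^esub> FA (hom_presheaf C A X) g =
        FA (hom_presheaf C A Z) g \<cdot>\<^bsub>set_cat U\<^esub> FA (hom_functor C ?b) f"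
    proof (rule comp_set_cat_eqI[OF FX H[OF ab(3)] comp_Hom[OF category_set_cat H[OF ab(4)] FZ]])
      fix h assume h: "h \<in> Hom C ?b X"
      have 1: "ap (FA (hom_presheaf C A X) g) h = h \<cdot>\<^bsub>C\<^esub> g" unfolding FA_hom_presheaf[OF g] using h by simp
      have 2: "ap (FA (hom_presheaf C A Z) g) (f \<cdot>\<^bsub>C\<^esub> h) = (f \<cdot>\<^bsub>C\<^esub> h) \<cdot>\<^bsub>C\<^esub> g"
        unfolding FA_hom_presheaf[OF g] using comp_Hom[OF C h f] by simp
      show "ap (FA (hom_functor C ?a) f) (ap (FA (hom_presheaf C A X) g) h) =
          ap (FA (hom_presheaf C A Z) g \<cdot>\<^bsub>set_cat U\<^esub> FA (hom_functor C ?b) f) h"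
        unfolding ap_comp[OF H[OF ab(4)] h] ap_hom_functor[OF f h] 1 2 ap_hom_functor[OF f comp_Hom[OF C gC h]]
        by (rule comp_assoc[OF C gC h f, symmetric])
    qed
    then show "?\<theta> (cd (op_cat A) g) \<cdot>\<^bsub>set_cat U\<^esub> FA (hom_presheaf C A X) g =
        FA (hom_presheaf C A Z) g \<cdot>\<^bsub>set_cat U\<^esub> ?\<theta> (dm (op_cat A) g)"
      using ab by simp
  qed (rule hom_presheaf_functor[OF o(1)], rule hom_presheaf_functor[OF o(2)])
  then show ?thesis
    unfolding Hom_PSh restricted_yoneda_simps using hom_presheaf_Ob o HomD[OF f] by (auto simp del: hom_functor_simps)
qed

lemma yoneda_comp:
  assumes f: "f \<in> Hom C X Z" and g: "g \<in> Hom C Z V"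
  shows "FA Y (g \<cdot>\<^bsub>C\<^esub> f) = FA Y g \<cdot>\<^bsub>PSh\<^esub> FA Y f"
proof -
  have o: "X \<in> Ob C" "Z \<in> Ob C" "V \<in> Ob C" using Hom_Ob[OF C f] Hom_Ob[OF C g] by auto
  have "FA (hom_functor C a) (g \<cdot>\<^bsub>C\<^esub> f) = FA (hom_functor C a) g \<cdot>\<^bsub>set_cat U\<^esub> FA (hom_functor C a) f" if "a \<in> Ob A" for a
    by (rule functor_comp[OF hom_functor_is_functor[OF C] f g]) (use small_Hom that in auto)
  then show ?thesis
    unfolding restricted_yoneda_simps comp_PSh using HomD[OF f] HomD[OF g] HomD[OF comp_Hom[OF C f g]]
    by (auto simp del: hom_functor_simps intro!: restrict_ext)
qed

text \<open>Evaluate at the identity of \<open>x\<close>, which is available because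
  \<open>x\<close> belongs to the subcategory.\<close>

lemma yoneda_faithful:
  assumes x: "x \<in> Ob A" and f: "f \<in> Hom C x Z" and g: "g \<in> Hom C x Z" and e: "FA Y f = FA Y g"
  shows "f = g"
proof -
  have "restrict (\<lambda>a. FA (hom_functor C a) f) (Ob A) x = restrict (\<lambda>a. FA (hom_functor C a) g) (Ob A) x"
    using e unfolding restricted_yoneda_simps by (simp del: hom_functor_simps)
  then have fg: "FA (hom_functor C x) f = FA (hom_functor C x) g" using x by (simp del: hom_functor_simps)
  have i: "idt C x \<in> Hom C x x" using idt_Hom[OF C] x by simp
  have "f \<cdot>\<^bsub>C\<^esub> idt C x = g \<cdot>\<^bsub>C\<^esub> idt C x"
    unfolding ap_hom_functor[OF f i, symmetric] ap_hom_functor[OF g i, symmetric] fg ..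
  then show ?thesis unfolding comp_idr[OF C f] comp_idr[OF C g] .
qed

lemma yoneda_eq_idt:
  assumes f: "f \<in> Hom C X X" and e: "\<And>a h. a \<in> Ob A \<Longrightarrow> h \<in> Hom C a X \<Longrightarrow> f \<cdot>\<^bsub>C\<^esub> h = h"
  shows "FA Y f = idt PSh (FO Y X)"
proof -
  have eq: "FA (hom_functor C a) f = idt (set_cat U) (FO (hom_presheaf C A X) a)" if a: "a \<in> Ob A" for a
    unfolding FO_hom_presheaf[OF a] using HomD[OF f] e[OF a] by (auto intro!: restrict_ext)
  have "restrict (\<lambda>a. FA (hom_functor C a) f) (Ob A) =
      restrict (\<lambda>a. idt (set_cat U) (FO (hom_presheaf C A X) a)) (Ob A)"
    by (rule restrict_ext) (rule eq)
  then show ?thesis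
    unfolding restricted_yoneda_simps using HomD[OF f]
    by (simp add: presheaf_cat_def functor_cat_def Let_def del: hom_functor_simps set_cat_simps)
qed

text \<open>Colimits of presheaves are pointwise, and evaluating \<open>Y\<close> at
  \<open>a\<close> gives \<open>hom_functor C a\<close>; so the claim is one about hom-functors of
  objects of \<open>A\<close>.\<close>

lemma yoneda_colimit:
  assumes D: "is_functor J C D" and c: "is_cocone C J D X \<delta>"
    and pw: "\<And>a. a \<in> Ob A \<Longrightarrow> is_colimit (set_cat U) J (functr_comp (hom_functor C a) D)
      (FO (hom_functor C a) X) (\<lambda>d. FA (hom_functor C a) (\<delta> d))"
  shows "is_colimit PSh J (functr_comp Y D) (FO Y X) (\<lambda>d. FA Y (\<delta> d))"
  unfolding presheaf_cat_def
proof (rule functor_cat_colimit_pointwise[OF category_set_cat])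
  have Jc: "category J" using functor_cats[OF D] by simp
  have "is_cocone PSh J (functr_comp Y D) (FO Y X) (\<lambda>d. FA Y (\<delta> d))"
    unfolding is_cocone_def
  proof (intro conjI ballI)
    have "X \<in> Ob C" using c by (simp add: is_cocone_def)
    then show "FO Y X \<in> Ob PSh" unfolding restricted_yoneda_simps by (rule hom_presheaf_Ob)
    show "FA Y (\<delta> d) \<in> Hom PSh (FO (functr_comp Y D) d) (FO Y X)" if "d \<in> Ob J" for d
      using yoneda_Hom[OF cocone_Hom[OF c that]] by simp
    fix m assume "m \<in> Ar J"
    then have m: "m \<in> Hom J (dm J m) (cd J m)" by (rule Ar_Hom)
    then have "cd J m \<in> Ob J" using Hom_Ob[OF Jc m] by simp
    from yoneda_comp[OF functor_Hom[OF D m] cocone_Hom[OF c this]] cocone_comm[OF c m]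
    show "FA Y (\<delta> (cd J m)) \<cdot>\<^bsub>PSh\<^esub> FA (functr_comp Y D) m = FA Y (\<delta> (dm J m))"
      by (simp del: hom_functor_simps)
  qed
  then show "is_cocone (functor_cat (op_cat A) (set_cat U)) J (functr_comp Y D) (FO Y X) (\<lambda>d. FA Y (\<delta> d))"
    by (simp only: presheaf_cat_def)
  fix a assume "a \<in> Ob (op_cat A)"
  then have a: "a \<in> Ob A" "a \<in> Ob C" by auto
  have eq: "\<lparr>FO = \<lambda>d. FO (FO (functr_comp Y D) d) a, FA = \<lambda>m. fst (snd (FA (functr_comp Y D) m)) a\<rparr> =
      functr_comp (hom_functor C a) D"
    unfolding functr_comp_def restricted_yoneda_simps using FO_hom_presheaf[OF a(1)] a(1)
    by (simp add: fun_eq_iff del: hom_functor_simps(2))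
  show "is_functor J (set_cat U) \<lparr>FO = \<lambda>d. FO (FO (functr_comp Y D) d) a, FA = \<lambda>m. fst (snd (FA (functr_comp Y D) m)) a\<rparr>"
    unfolding eq by (rule is_functor_comp[OF D hom_functor_is_functor[OF C small_Hom[OF a(2)]]])
  show "is_colimit (set_cat U) J \<lparr>FO = \<lambda>d. FO (FO (functr_comp Y D) d) a, FA = \<lambda>m. fst (snd (FA (functr_comp Y D) m)) a\<rparr>
      (FO (FO Y X) a) (\<lambda>d. fst (snd (FA Y (\<delta> d))) a)"
    unfolding eq using pw[OF a(1)] a(1) FO_hom_presheaf[OF a(1)]
    by (simp add: restricted_yoneda_simps del: hom_functor_simps(2))
qed

text \<open>\<open>Ind\<close> is built from the Yoneda embedding of \<open>A\<close>, whereas the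
  functor of interest lives on \<open>C\<close>. The hom-sets coincide on a full subcategory, so
  both give the same diagram of presheaves.\<close>

lemma yoneda_full_subcat:
  assumes J: "is_functor J A D"
  shows "is_colimit PSh J (functr_comp (restricted_yoneda A A) D) G \<gamma> \<longleftrightarrow> is_colimit PSh J (functr_comp Y D) G \<gamma>"
proof (rule is_colimit_cong)
  have Hom: "Hom A a b = Hom C a b" if "a \<in> Ob A" "b \<in> Ob A" for a b
    using that by (intro Hom_full_subcat) auto
  have ob: "hom_presheaf A A x = hom_presheaf C A x" if x: "x \<in> Ob A" for x
    unfolding hom_presheaf_def using Hom[OF _ x] A_Hom[OF Ar_Hom[of _ A]]
    by (auto intro!: restrict_ext)
  show "category J" using functor_cats[OF J] by simp
  show "FO (functr_comp (restricted_yoneda A A) D) d = FO (functr_comp Y D) d" if "d \<in> Ob J" for d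
    using ob[OF functor_Ob[OF J that]] by (simp add: restricted_yoneda_simps)
  show "FA (functr_comp (restricted_yoneda A A) D) m = FA (functr_comp Y D) m" if m: "m \<in> Ar J" for m
  proof -
    have "FA D m \<in> Ar A" using HomD[OF functor_Hom[OF J Ar_Hom[OF m]]] by blast
    from Ar_Hom[OF this] have f: "FA D m \<in> Hom A (dm C (FA D m)) (cd C (FA D m))"
      by (simp only: full_subcat_simps)
    have o: "dm C (FA D m) \<in> Ob A" "cd C (FA D m) \<in> Ob A" using A_Hom[OF f] by auto
    have "FA (hom_functor A a) (FA D m) = FA (hom_functor C a) (FA D m)" if "a \<in> Ob A" for a
      using Hom[OF that o(1)] Hom[OF that o(2)] by simp
    then show ?thesis using ob[OF o(1)] ob[OF o(2)]
      by (simp add: restricted_yoneda_simps del: hom_functor_simps cong: restrict_cong)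
  qed
qed simp

end

section \<open>Filtered colimits are weak colimits in the homotopy category\<close>

context strong_comb
begin

abbreviation "HL \<equiv> Ho_presentables U lam C W"
abbreviation "E \<equiv> E_functor U lam C W"

lemma HL_eq: "HL = full_subcat H {A. presentable U lam C A}"
proof -
  have "FO P ` Ob (presentables U lam C) = {A. presentable U lam C A}"
    by (auto simp: presentables_def presentable_def)
  then show ?thesis unfolding Ho_presentables_def by simp
qed

sublocale HLs: full_small_subcat U H "{A. presentable U lam C A}"
  by unfold_locales (use H_category Ho_small in auto)

lemma E_eq: "E = HLs.Y"
  by (simp add: E_functor_def HL_eq)

text \<open>The two conditions in the description of filtered colimits of sets, surjectivity and
  injectivity, are supplied by \<open>Ho_factor\<close> and \<open>Ho_eq\<close>.\<close>

lemma hom_P_colimit: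
  fixes J :: "('u, 'u) cat"
  assumes pA: "presentable U lam C A"
    and J: "small_category U J" "filtered lam J" and D: "is_functor J C D" and col: "is_colimit C J D K \<delta>"
  shows "is_colimit (set_cat U) J (functr_comp (hom_functor H A) (functr_comp P D))
      (FO (hom_functor H A) K) (\<lambda>d. FA (hom_functor H A) (FA P (\<delta> d)))"
proof -
  have A: "A \<in> Ob C" using pA by (simp add: presentable_def)
  have G: "is_functor H (set_cat U) (hom_functor H A)"
    by (rule hom_functor_is_functor[OF H_category]) (use Ho_small[OF A] in simp)
  note PD = is_functor_comp[OF D P_functor]
  note coc = functor_cocone[OF P_functor D colimit_cocone[OF col]]
  note \<delta> = P_Hom[OF cocone_Hom[OF colimit_cocone[OF col]]]
  have FOP: "FO P X = X" for X by simp
  show ?thesis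
  proof (rule set_filtered_colimitI[OF J(2) lam is_functor_comp[OF PD G] functor_cocone[OF G PD coc, unfolded FOP]])
    fix x assume "x \<in> FO (hom_functor H A) K"
    then have x: "x \<in> Hom H A K" by simp
    from Ho_factor[OF pA J D col x] obtain d v where d: "d \<in> Ob J" "v \<in> Hom H A (FO D d)" "FA P (\<delta> d) \<star> v = x"
      by blast
    have "ap (FA (hom_functor H A) (FA P (\<delta> d))) v = x"
      unfolding ap_hom_functor[OF \<delta>[OF d(1)] d(2)] by (rule d(3))
    moreover have "v \<in> FO (functr_comp (hom_functor H A) (functr_comp P D)) d" using d(2) by simp
    ultimately show "\<exists>d \<in> Ob J. \<exists>y \<in> FO (functr_comp (hom_functor H A) (functr_comp P D)) d.
        ap (FA (hom_functor H A) (FA P (\<delta> d))) y = x"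
      using d(1) by blast
  next
    fix d u v assume d: "d \<in> Ob J" and "u \<in> FO (functr_comp (hom_functor H A) (functr_comp P D)) d"
      "v \<in> FO (functr_comp (hom_functor H A) (functr_comp P D)) d"
      and e: "ap (FA (hom_functor H A) (FA P (\<delta> d))) u = ap (FA (hom_functor H A) (FA P (\<delta> d))) v"
    then have u: "u \<in> Hom H A (FO D d)" and v: "v \<in> Hom H A (FO D d)" by simp_all
    from Ho_eq[OF pA J D col d u v e[unfolded ap_hom_functor[OF \<delta>[OF d] u] ap_hom_functor[OF \<delta>[OF d] v]]]
    obtain e m where m: "m \<in> Hom J d e" "FA P (FA D m) \<star> u = FA P (FA D m) \<star> v" by blast
    note PDm = P_Hom[OF functor_Hom[OF D m(1)]]
    have "ap (FA (functr_comp (hom_functor H A) (functr_comp P D)) m) u =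
        ap (FA (functr_comp (hom_functor H A) (functr_comp P D)) m) v"
      unfolding functr_comp_simps ap_hom_functor[OF PDm u] ap_hom_functor[OF PDm v] by (rule m(2))
    then show "\<exists>e. \<exists>m \<in> Hom J d e. ap (FA (functr_comp (hom_functor H A) (functr_comp P D)) m) u =
        ap (FA (functr_comp (hom_functor H A) (functr_comp P D)) m) v"
      using m(1) by blast
  qed
qed

lemma E_colimit:
  fixes J :: "('u, 'u) cat"
  assumes J: "small_category U J" "filtered lam J" and D: "is_functor J C D" and col: "is_colimit C J D K \<delta>"
  shows "is_colimit HLs.PSh J (functr_comp E (functr_comp P D)) (FO E K) (\<lambda>d. FA E (FA P (\<delta> d)))"
  unfolding E_eq
proof (rule HLs.yoneda_colimit[OF is_functor_comp[OF D P_functor]])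
  show "is_cocone H J (functr_comp P D) K (\<lambda>d. FA P (\<delta> d))"
    using functor_cocone[OF P_functor D colimit_cocone[OF col]] by simp
  fix a assume "a \<in> Ob HLs.A"
  then have "presentable U lam C a" by simp
  from hom_P_colimit[OF this J D col] show "is_colimit (set_cat U) J (functr_comp (hom_functor H a) (functr_comp P D))
      (FO (hom_functor H a) K) (\<lambda>d. FA (hom_functor H a) (FA P (\<delta> d)))" .
qed

text \<open>The diagrams supplied by local presentability lie in a small set of presentable objects;
  only their target is enlarged.\<close>

lemma presentable_diagram:
  assumes X: "X \<in> Ob C"
  shows "\<exists>(J :: ('u, 'u) cat) D \<delta>. small_category U J \<and> filtered lam J \<and>
    is_functor J (presentables U lam C) D \<and> is_colimit C J D X \<delta>"
proof -
  have "locally_presentable U lam C" using comb by (simp add: combinatorial_def)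
  then obtain G where G: "\<forall>A \<in> G. presentable U lam C A"
    and ex: "\<forall>X \<in> Ob C. \<exists>(J :: ('u, 'u) cat) D \<delta>. small_category U J \<and> filtered lam J \<and>
            is_functor J (full_subcat C G) D \<and> is_colimit C J D X \<delta>"
    unfolding locally_presentable_def by blast
  obtain J :: "('u, 'u) cat" and D \<delta> where J: "small_category U J" "filtered lam J"
    and D: "is_functor J (full_subcat C G) D" and col: "is_colimit C J D X \<delta>" using ex X by blast
  have "FO D d \<in> {A. presentable U lam C A}" if "d \<in> Ob J" for d
    using functor_Ob[OF D that] G by simp
  from is_functor_into_full_subcat[OF is_functor_full_subcat[OF D C] this]
  have "is_functor J (presentables U lam C) D" by (simp add: presentables_def)
  then show ?thesis using J col by blast
qed

lemma presentables_functor: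
  assumes "is_functor J (presentables U lam C) D"
  shows "is_functor J C D" "is_functor J HL (functr_comp P D)"
proof -
  show D: "is_functor J C D"
    using is_functor_full_subcat[OF assms[unfolded presentables_def] C] .
  have "FO (functr_comp P D) d \<in> {A. presentable U lam C A}" if "d \<in> Ob J" for d
    using functor_Ob[OF assms that] by (simp add: presentables_def)
  from is_functor_into_full_subcat[OF is_functor_comp[OF D P_functor] this]
  show "is_functor J HL (functr_comp P D)" unfolding HL_eq .
qed

text \<open>Fullness is assumed for \<open>E\<close> with values in \<open>Ind\<close>, so
  membership has to be established before it can be used. A presentation of \<open>X\<close> by
  presentable objects becomes under \<open>E\<close> a filtered colimit of representables.\<close>

lemma E_Ind:
  assumes X: "X \<in> Ob C"
  shows "FO E X \<in> Ob (Ind U lam HL)"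
proof -
  obtain J :: "('u, 'u) cat" and D \<delta> where J: "small_category U J" "filtered lam J"
    and D: "is_functor J (presentables U lam C) D" and col: "is_colimit C J D X \<delta>"
    using presentable_diagram[OF X] by blast
  note D' = presentables_functor[OF D]
  have "is_colimit HLs.PSh J (functr_comp (restricted_yoneda HL HL) (functr_comp P D)) (FO E X) (\<lambda>d. FA E (FA P (\<delta> d)))"
    unfolding HL_eq HLs.yoneda_full_subcat[OF D'(2)[unfolded HL_eq]]
    using E_colimit[OF J D'(1) col] unfolding E_eq .
  moreover have "FO E X \<in> Ob HLs.PSh"
    unfolding E_eq restricted_yoneda_simps using HLs.hom_presheaf_Ob X by simp
  ultimately show ?thesis using J D'(2) unfolding Ind_def HL_eq by auto
qed

lemma Hom_Ind:
  assumes "X \<in> Ob C" "Z \<in> Ob C"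
  shows "Hom (Ind U lam HL) (FO E X) (FO E Z) = Hom HLs.PSh (FO E X) (FO E Z)"
  using E_Ind[OF assms(1)] E_Ind[OF assms(2)] unfolding Ind_def HL_eq by (intro Hom_full_subcat) simp_all

lemma P_weak_colimit:
  fixes J :: "('u, 'u) cat"
  assumes brown: "brown_on_morphisms U lam C M"
    and J: "small_category U J" "filtered lam J" and D: "is_functor J (presentables U lam C) D"
    and col: "is_colimit C J D K \<delta>"
  shows "is_weak_colimit H J (functr_comp P D) K (\<lambda>d. FA P (\<delta> d))"
  unfolding is_weak_colimit_def
proof (intro conjI allI impI)
  note D' = presentables_functor[OF D]
  show coc: "is_cocone H J (functr_comp P D) K (\<lambda>d. FA P (\<delta> d))"
    using functor_cocone[OF P_functor D'(1) colimit_cocone[OF col]] by simp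
  have K: "K \<in> Ob C" using coc by (simp add: is_cocone_def)
  have Jc: "category J" using J(2) by (simp add: filtered_def)
  fix Z \<epsilon> assume ce: "is_cocone H J (functr_comp P D) Z \<epsilon>"
  have Z: "Z \<in> Ob C" using ce by (simp add: is_cocone_def)
  note colE = E_colimit[OF J D'(1) col]
  have "is_cocone HLs.PSh J (functr_comp E (functr_comp P D)) (FO E Z) (\<lambda>d. FA E (\<epsilon> d))"
    unfolding is_cocone_def
  proof (intro conjI ballI)
    show "FO E Z \<in> Ob HLs.PSh"
      unfolding E_eq restricted_yoneda_simps using HLs.hom_presheaf_Ob Z by simp
    show "FA E (\<epsilon> d) \<in> Hom HLs.PSh (FO (functr_comp E (functr_comp P D)) d) (FO E Z)" if "d \<in> Ob J" for d
      using HLs.yoneda_Hom[OF cocone_Hom[OF ce that]] by (simp add: E_eq)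
    fix m assume "m \<in> Ar J"
    then have m: "m \<in> Hom J (dm J m) (cd J m)" by (rule Ar_Hom)
    then have "cd J m \<in> Ob J" using Hom_Ob[OF Jc m] by simp
    from HLs.yoneda_comp[OF functor_Hom[OF is_functor_comp[OF D'(1) P_functor] m] cocone_Hom[OF ce this]]
    show "FA E (\<epsilon> (cd J m)) \<cdot>\<^bsub>HLs.PSh\<^esub> FA (functr_comp E (functr_comp P D)) m = FA E (\<epsilon> (dm J m))"
      unfolding E_eq functr_comp_simps cocone_comm[OF ce m, unfolded functr_comp_simps] by (rule sym)
  qed
  from colimit_ex[OF colE this] obtain h where h: "h \<in> Hom HLs.PSh (FO E K) (FO E Z)"
    and hd: "\<And>d. d \<in> Ob J \<Longrightarrow> h \<cdot>\<^bsub>HLs.PSh\<^esub> FA E (FA P (\<delta> d)) = FA E (\<epsilon> d)" by blast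
  \<comment> \<open>\<open>Ind\<close> is full in presheaves, so the induced presheaf map is already
    an arrow to which the Brown property applies.\<close>
  have "h \<in> Hom (Ind U lam HL) (FO E K) (FO E Z)" unfolding Hom_Ind[OF K Z] by (rule h)
  then obtain f where f: "f \<in> Hom H K Z" "FA E f = h"
    using brown K Z unfolding brown_on_morphisms_def full_functor_def Ho_simps by blast
  have "f \<star> FA P (\<delta> d) = \<epsilon> d" if d: "d \<in> Ob J" for d
  \<comment> \<open>The lift \<open>f\<close> matches the cocone only after applying
    \<open>E\<close>. Since \<open>FO D d\<close> is presentable, equations of arrows out of it may
    be tested there.\<close>
  proof (rule HLs.yoneda_faithful)
    note \<delta>d = P_Hom[OF cocone_Hom[OF colimit_cocone[OF col] d]]
    show "FO D d \<in> Ob HLs.A"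
      using functor_Ob[OF D'(2) d] by (simp add: HL_eq)
    show "f \<star> FA P (\<delta> d) \<in> Hom H (FO D d) Z" by (rule comp_Hom[OF H_category \<delta>d f(1)])
    show "\<epsilon> d \<in> Hom H (FO D d) Z" using cocone_Hom[OF ce d] by simp
    show "FA HLs.Y (f \<star> FA P (\<delta> d)) = FA HLs.Y (\<epsilon> d)"
      unfolding HLs.yoneda_comp[OF \<delta>d f(1)] using hd[OF d] f(2) unfolding E_eq by blast
  qed
  then show "\<exists>h. h \<in> Hom H K Z \<and> (\<forall>d \<in> Ob J. h \<star> FA P (\<delta> d) = \<epsilon> d)" using f(1) by blast
qed

lemma P_minimal:
  fixes J :: "('u, 'u) cat"
  assumes refl: "reflects_isos H (Ind U lam HL) E"
    and J: "small_category U J" "filtered lam J" and D: "is_functor J (presentables U lam C) D"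
    and col: "is_colimit C J D K \<delta>"
    and f: "f \<in> Hom H K K" and fd: "\<And>d. d \<in> Ob J \<Longrightarrow> f \<star> FA P (\<delta> d) = FA P (\<delta> d)"
  shows "is_iso H f"
proof -
  note D' = presentables_functor[OF D]
  have K: "K \<in> Ob C" using Hom_Ob[OF H_category f] by simp
  \<comment> \<open>Every arrow in \<open>Ho\<close> from a presentable object to \<open>K\<close>
    factors through a leg, and the legs are fixed by \<open>f\<close>.\<close>
  have fh: "f \<star> h = h" if a: "a \<in> Ob HLs.A" and h: "h \<in> Hom H a K" for a h
  proof -
    have "presentable U lam C a" using a by simp
    from Ho_factor[OF this J D'(1) col h] obtain d v where d: "d \<in> Ob J" "v \<in> Hom H a (FO D d)" "FA P (\<delta> d) \<star> v = h"
      by blast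
    show ?thesis
      unfolding d(3)[symmetric]
        comp_assoc[OF H_category d(2) P_Hom[OF cocone_Hom[OF colimit_cocone[OF col] d(1)]] f, symmetric] fd[OF d(1)] ..
  qed
  have ff: "f \<star> f \<in> Hom H K K" by (rule comp_Hom[OF H_category f f])
  have ffh: "(f \<star> f) \<star> h = h" if "a \<in> Ob HLs.A" "h \<in> Hom H a K" for a h
    unfolding comp_assoc[OF H_category that(2) f f] fh[OF that] ..
  have id: "FA E f = idt HLs.PSh (FO E K)" unfolding E_eq by (rule HLs.yoneda_eq_idt[OF f fh])
  \<comment> \<open>The inverse offered for \<open>FA E f\<close> is \<open>FA E f\<close> itself.
    Its square is computed as the image of \<open>f \<star> f\<close>, which also fixes all arrows
    from presentable objects.\<close>
  have "FA E f \<cdot>\<^bsub>HLs.PSh\<^esub> FA E f = idt HLs.PSh (FO E K)"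
    unfolding E_eq HLs.yoneda_comp[OF f f, symmetric] by (rule HLs.yoneda_eq_idt[OF ff ffh])
  moreover have "FA E f \<in> Hom (Ind U lam HL) (FO E K) (FO E K)"
    unfolding Hom_Ind[OF K K] unfolding E_eq by (rule HLs.yoneda_Hom[OF f])
  moreover have "idt (Ind U lam HL) = idt HLs.PSh" "cmp (Ind U lam HL) = cmp HLs.PSh"
    by (simp_all add: Ind_def HL_eq)
  ultimately have "is_iso (Ind U lam HL) (FA E f)" unfolding is_iso_def using HomD by fastforce
  then show ?thesis using refl HomD[OF f] unfolding reflects_isos_def by blast
qed

end

theorem mainTheorem2:
  fixes U :: "'u rel" and lam :: "'l rel"
    and C :: "('o, 'm) cat" and M :: "('o, 'm) model_structure"
  assumes "inaccessible U" and "regular_cardinal lam" and "lam <o U"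
    and "strongly_combinatorial U lam C M"
    and "brown_on_morphisms U lam C M"
  defines "H \<equiv> Ho C (weq M)"
    and "P \<equiv> Ho_functor C (weq M)"
    and "HL \<equiv> Ho_presentables U lam C (weq M)"
    and "E \<equiv> E_functor U lam C (weq M)"
  shows "(\<forall>(\<D> :: ('u, 'u) cat) D K \<delta>.
            small_category U \<D> \<longrightarrow> filtered lam \<D> \<longrightarrow> is_functor \<D> (presentables U lam C) D \<longrightarrow>
            is_colimit C \<D> D K \<delta> \<longrightarrow>
            is_weak_colimit H \<D> (functr_comp P D) (FO P K) (\<lambda>d. FA P (\<delta> d))) \<and>
         (\<forall>X \<in> Ob H. \<exists>(\<D> :: ('u, 'u) cat) D \<delta>.
            small_category U \<D> \<and> filtered lam \<D> \<and> is_functor \<D> HL D \<and>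
            is_weak_colimit H \<D> D X \<delta>) \<and>
         (reflects_isos H (Ind U lam HL) E \<longrightarrow>
           (\<forall>(\<D> :: ('u, 'u) cat) D K \<delta>.
              small_category U \<D> \<longrightarrow> filtered lam \<D> \<longrightarrow> is_functor \<D> (presentables U lam C) D \<longrightarrow>
              is_colimit C \<D> D K \<delta> \<longrightarrow>
              (\<forall>f \<in> Hom H (FO P K) (FO P K).
                 (\<forall>d \<in> Ob \<D>. f \<cdot>\<^bsub>H\<^esub> FA P (\<delta> d) = FA P (\<delta> d)) \<longrightarrow> is_iso H f)) \<and>
           (\<forall>X \<in> Ob H. \<exists>(\<D> :: ('u, 'u) cat) D \<delta>.
              small_category U \<D> \<and> filtered lam \<D> \<and> is_functor \<D> HL D \<and>
              is_minimal_weak_colimit H \<D> D X \<delta>))"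
proof -
  interpret S: strong_comb U lam C M using assms(1,2,4) by unfold_locales
  have FOP: "FO P X = X" and ObH: "Ob H = Ob C" for X by (simp_all add: P_def H_def)
  note weak = S.P_weak_colimit[OF assms(5), folded H_def P_def]
  note minimal = S.P_minimal[folded H_def P_def HL_def E_def]
  show ?thesis
    unfolding FOP ObH
  proof (intro conjI allI impI ballI)
    fix \<D> :: "('u, 'u) cat" and D K \<delta>
    assume "small_category U \<D>" "filtered lam \<D>" "is_functor \<D> (presentables U lam C) D" "is_colimit C \<D> D K \<delta>"
    then show "is_weak_colimit H \<D> (functr_comp P D) K (\<lambda>d. FA P (\<delta> d))" by (rule weak)
  next
    fix X assume "X \<in> Ob C"
    \<comment> \<open>The objects of \<open>Ho\<close> are those of \<open>C\<close>, so
      \<open>X\<close> itself has a presentation as a filtered colimit; the same diagram serves for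
      the weak and for the minimal weak colimit.\<close>
    from S.presentable_diagram[OF this] obtain \<D> :: "('u, 'u) cat" and D \<delta> where
      D: "small_category U \<D>" "filtered lam \<D>" "is_functor \<D> (presentables U lam C) D" "is_colimit C \<D> D X \<delta>" by blast
    note F = S.presentables_functor(2)[OF D(3), folded P_def HL_def]
    show "\<exists>(\<D> :: ('u, 'u) cat) D \<delta>. small_category U \<D> \<and> filtered lam \<D> \<and> is_functor \<D> HL D \<and> is_weak_colimit H \<D> D X \<delta>"
      using D(1,2) F weak[OF D] by blast
    assume refl: "reflects_isos H (Ind U lam HL) E"
    have "is_minimal_weak_colimit H \<D> (functr_comp P D) X (\<lambda>d. FA P (\<delta> d))"
      unfolding is_minimal_weak_colimit_def using weak[OF D] minimal[OF refl D] by blast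
    then show "\<exists>(\<D> :: ('u, 'u) cat) D \<delta>. small_category U \<D> \<and> filtered lam \<D> \<and> is_functor \<D> HL D \<and>
        is_minimal_weak_colimit H \<D> D X \<delta>"
      using D(1,2) F by blast
  next
    fix \<D> :: "('u, 'u) cat" and D K \<delta> f
    assume refl: "reflects_isos H (Ind U lam HL) E" and D: "small_category U \<D>" "filtered lam \<D>"
      "is_functor \<D> (presentables U lam C) D" "is_colimit C \<D> D K \<delta>"
      and f: "f \<in> Hom H K K" "\<forall>d \<in> Ob \<D>. f \<cdot>\<^bsub>H\<^esub> FA P (\<delta> d) = FA P (\<delta> d)"
    show "is_iso H f" by (rule minimal[OF refl D f(1)]) (use f(2) in blast)
  qed
qed

end
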